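(* Let $\gamma\in(0,\frac32)$, $p\ge1$, and let $X_0\in H$ satisfy $(I-\mathbb L)X_0\in\mathbb H^\gamma$. Let $Y^N_k$, $0\le k\le K$, be defined by the implicit recursion $$Y^N_{k+1}=Y^N_k-A^2Y^N_{k+1}\delta t-AP^Nf(Y^N_{k+1}+Z^N(t_{k+1}))\delta t,\quad k\le K-1,\qquad Y^N_0=P^NX_0,$$ with $\delta t=T/K$, $t_k=k\delta t$, where $Z^N$ is the spectral projection of the stochastic convolution of one-dimensional space-time white noise. Then there is a positive constant $C(X_0,T,p)$ such that $$\mathbb E\Big[\sup_{k\le K}\big\|(I-\mathbb L)Y^N_k\big\|_{\mathbb H^\gamma}^p\Big]\le C(X_0,T,p),$$ and, for all $k_1,k\le K$, $$\mathbb E\Big[\big\|Y^N_k-Y^N_{k_1}\big\|^p\Big]\le C(X_0,T,p)\,|(k-k_1)\delta t|^{\frac{\gamma p}4}.$$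
   Context: Fix $T>0$, $L>0$, $\mathcal O=[0,L]$ (dimension $d=1$), $H=L^2(\mathcal O)$ with norm $\|\cdot\|$. $A=-\Delta$ is the Neumann Laplacian on $H$ with orthonormal eigensystem $\{(\lambda_j,e_j)\}_{j\ge0}$, $0=\lambda_0<\lambda_1\le\lambda_2\le\cdots$, $e_0=|\mathcal O|^{-1/2}$. $\mathbb L v=|\mathcal O|^{-1}\int_{\mathcal O}v\,dx$ and $\mathbb H=(I-\mathbb L)H$. For $\alpha\in\mathbb R$, $\mathbb H^\alpha$ is the space of series $v=\sum_{j\ge1}v_je_j$ with $\|v\|_{\mathbb H^\alpha}=(\sum_{j\ge1}\lambda_j^\alpha v_j^2)^{1/2}<\infty$. $F(\xi)=c_4\xi^4+c_3\xi^3+c_2\xi^2+c_1\xi+c_0$ with real coefficients, $c_4>0$, and $f(v)(x)=F'(v(x))$. $L_f$ is a one-sided Lipschitz constant: $-F''(\xi)\le L_f$ for all $\xi$. $W$ is an $H$-cylindrical Wiener process (covariance $Q=I$) on a filtered probability space. $X_0$ is deterministic. $S(t)=e^{-tA^2}$. $P^N$, $N\in\mathbb N^+$, is the orthogonal projection of $H$ onto $\mathrm{span}\{e_0,\dots,e_N\}$ and $Z^N(t)=\int_0^tS(t-s)P^N\,dW(s)$. The step size $\delta t=T/K$, $K\in\mathbb N^+$, is taken with $\delta t<\min\big(1,\frac1{(L_f-\lambda_1)\vee0}\big)$ (with $1/0=\infty$) so that the implicit scheme is solvable. The constant depends on $X_0,T,p$ and the fixed data ($L,f,\gamma$), not on $N,\delta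 t,k,k_1$. *)

theory Defs
  imports "HOL-Probability.Probability" "HOL-Computational_Algebra.Polynomial"
begin

text \<open>
  Elements of \<open>H = L\<^sup>2([0,L])\<close> are represented by functions \<open>real \<Rightarrow> real\<close>, of which only
  the restriction to \<open>[0,L]\<close> matters.
\<close>

definition L2_fun :: "real \<Rightarrow> (real \<Rightarrow> real) set" where
  "L2_fun L = {v. v \<in> borel_measurable (lebesgue_on {0..L}) \<and>
                  integrable (lebesgue_on {0..L}) (\<lambda>x. (v x)\<^sup>2)}"

definition ip :: "real \<Rightarrow> (real \<Rightarrow> real) \<Rightarrow> (real \<Rightarrow> real) \<Rightarrow> real" where
  "ip L v w = (LINT x|lebesgue_on {0..L}. v x * w x)"

definition H_norm :: "real \<Rightarrow> (real \<Rightarrow> real) \<Rightarrow> real" where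
  "H_norm L v = sqrt (ip L v v)"

text \<open>The operator \<open>I - \<bbbL>\<close>, where \<open>\<bbbL> v\<close> is the spatial average of \<open>v\<close>.\<close>

definition mean_free :: "real \<Rightarrow> (real \<Rightarrow> real) \<Rightarrow> real \<Rightarrow> real" where
  "mean_free L v = (\<lambda>x. v x - (1 / L) * (LINT y|lebesgue_on {0..L}. v y))"

text \<open>
  The graph of \<open>A = - \<Delta>\<close> with homogeneous Neumann boundary conditions: \<open>A v = w\<close>, where
  \<open>v\<close> is the \<open>C\<^sup>1\<close> representative of an element of \<open>H\<^sup>2\<close>. That is, \<open>v'\<close> is absolutely
  continuous with \<open>v'' = - w\<close> in \<open>L\<^sup>2\<close>, and \<open>v'(0) = v'(L) = 0\<close>; the condition at \<open>0\<close> is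
  the integral formula for \<open>v'\<close> at \<open>x = 0\<close>.
\<close>

definition neumann_laplacian :: "real \<Rightarrow> (real \<Rightarrow> real) \<Rightarrow> (real \<Rightarrow> real) \<Rightarrow> bool" where
  "neumann_laplacian L v w \<longleftrightarrow> w \<in> L2_fun L \<and>
     (\<exists>v'. (\<forall>x\<in>{0..L}. (v has_real_derivative v' x) (at x within {0..L}) \<and>
                        v' x = - (LINT y|lebesgue_on {0..x}. w y)) \<and>
           v' L = 0)"

definition neumann_eigensystem :: "real \<Rightarrow> (nat \<Rightarrow> real) \<Rightarrow> (nat \<Rightarrow> real \<Rightarrow> real) \<Rightarrow> bool" where
  "neumann_eigensystem L lam e \<longleftrightarrow>
     (\<forall>j. e j \<in> L2_fun L \<and> neumann_laplacian L (e j) (\<lambda>x. lam j * e j x)) \<and>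
     (\<forall>i j. ip L (e i) (e j) = (if i = j then 1 else 0)) \<and>
     (\<forall>v\<in>L2_fun L. (\<forall>j. ip L v (e j) = 0) \<longrightarrow> (AE x in lebesgue_on {0..L}. v x = 0)) \<and>
     lam 0 = 0 \<and> 0 < lam 1 \<and> (\<forall>j. lam j \<le> lam (Suc j)) \<and>
     (\<forall>x\<in>{0..L}. e 0 x = 1 / sqrt L)"

text \<open>
  Functional calculus \<open>\<phi>(A) v\<close>; it is only ever applied to finite linear combinations of the
  \<open>e\<^sub>j\<close>, so that the series is a finite sum.
\<close>

definition spectral_op ::
    "real \<Rightarrow> (nat \<Rightarrow> real) \<Rightarrow> (nat \<Rightarrow> real \<Rightarrow> real) \<Rightarrow> (real \<Rightarrow> real) \<Rightarrow> (real \<Rightarrow> real) \<Rightarrow> real \<Rightarrow> real" where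
  "spectral_op L lam e \<phi> v = (\<lambda>x. \<Sum>j. \<phi> (lam j) * ip L v (e j) * e j x)"

definition A_op :: "real \<Rightarrow> (nat \<Rightarrow> real) \<Rightarrow> (nat \<Rightarrow> real \<Rightarrow> real) \<Rightarrow> (real \<Rightarrow> real) \<Rightarrow> real \<Rightarrow> real" where
  "A_op L lam e = spectral_op L lam e (\<lambda>l. l)"

definition S_op ::
    "real \<Rightarrow> (nat \<Rightarrow> real) \<Rightarrow> (nat \<Rightarrow> real \<Rightarrow> real) \<Rightarrow> real \<Rightarrow> (real \<Rightarrow> real) \<Rightarrow> real \<Rightarrow> real" where
  "S_op L lam e t = spectral_op L lam e (\<lambda>l. exp (- t * l\<^sup>2))"

definition P_op :: "real \<Rightarrow> (nat \<Rightarrow> real \<Rightarrow> real) \<Rightarrow> nat \<Rightarrow> (real \<Rightarrow> real) \<Rightarrow> real \<Rightarrow> real" where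
  "P_op L e N v = (\<lambda>x. \<Sum>j\<le>N. ip L v (e j) * e j x)"

text \<open>Membership of \<open>span {e\<^sub>0, \<dots>, e\<^sub>N}\<close>, as functions on \<open>[0,L]\<close>.\<close>

definition in_PN :: "real \<Rightarrow> (nat \<Rightarrow> real \<Rightarrow> real) \<Rightarrow> nat \<Rightarrow> (real \<Rightarrow> real) \<Rightarrow> bool" where
  "in_PN L e N v \<longleftrightarrow> (\<exists>a. \<forall>x\<in>{0..L}. v x = (\<Sum>j\<le>N. a j * e j x))"

text \<open>The spaces \<open>\<bbbH>\<^sup>\<alpha>\<close> for \<open>\<alpha> \<ge> 0\<close>, where they are subspaces of \<open>H\<close>.\<close>

definition in_Hdot ::
    "real \<Rightarrow> (nat \<Rightarrow> real) \<Rightarrow> (nat \<Rightarrow> real \<Rightarrow> real) \<Rightarrow> real \<Rightarrow> (real \<Rightarrow> real) \<Rightarrow> bool" where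
  "in_Hdot L lam e \<alpha> v \<longleftrightarrow> v \<in> L2_fun L \<and> ip L v (e 0) = 0 \<and>
     summable (\<lambda>j. lam (Suc j) powr \<alpha> * (ip L v (e (Suc j)))\<^sup>2)"

definition Hdot_norm ::
    "real \<Rightarrow> (nat \<Rightarrow> real) \<Rightarrow> (nat \<Rightarrow> real \<Rightarrow> real) \<Rightarrow> real \<Rightarrow> (real \<Rightarrow> real) \<Rightarrow> real" where
  "Hdot_norm L lam e \<alpha> v = sqrt (\<Sum>j. lam (Suc j) powr \<alpha> * (ip L v (e (Suc j)))\<^sup>2)"

definition filtered_prob_space :: "'w measure \<Rightarrow> (real \<Rightarrow> 'w measure) \<Rightarrow> bool" where
  "filtered_prob_space M \<F> \<longleftrightarrow> prob_space M \<and> (\<forall>t\<ge>0. subalgebra M (\<F> t)) \<and>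
     (\<forall>s t. 0 \<le> s \<and> s \<le> t \<longrightarrow> sets (\<F> s) \<subseteq> sets (\<F> t))"

definition brownian_motion ::
    "'w measure \<Rightarrow> (real \<Rightarrow> 'w measure) \<Rightarrow> (real \<Rightarrow> 'w \<Rightarrow> real) \<Rightarrow> bool" where
  "brownian_motion M \<F> B \<longleftrightarrow>
     (\<forall>t\<ge>0. B t \<in> borel_measurable (\<F> t)) \<and>
     (AE \<omega> in M. B 0 \<omega> = 0) \<and>
     (AE \<omega> in M. continuous_on {0..} (\<lambda>t. B t \<omega>)) \<and>
     (\<forall>s t. 0 \<le> s \<and> s < t \<longrightarrow>
        distributed M lborel (\<lambda>\<omega>. B t \<omega> - B s \<omega>) (\<lambda>x. ennreal (normal_density 0 (sqrt (t - s)) x)) \<and>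
        prob_space.indep_set M (sets (\<F> s))
          {(\<lambda>\<omega>. B t \<omega> - B s \<omega>) -` U \<inter> space M | U. U \<in> sets borel})"

text \<open>
  \<open>W t h\<close> stands for \<open>\<langle>W(t), h\<rangle>\<close>. By linearity, the condition on unit vectors gives
  Gaussian increments with covariance \<open>(t - s) \<langle>h, g\<rangle>\<close> for all \<open>h\<close> and \<open>g\<close> in \<open>H\<close>, jointly
  independent of the past, i.e. the covariance operator is the identity. The last condition
  makes \<open>W t\<close> compatible with equality almost everywhere.
\<close>

definition cylindrical_wiener ::
    "real \<Rightarrow> 'w measure \<Rightarrow> (real \<Rightarrow> 'w measure) \<Rightarrow> (real \<Rightarrow> (real \<Rightarrow> real) \<Rightarrow> 'w \<Rightarrow> real) \<Rightarrow> bool" where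
  "cylindrical_wiener L M \<F> W \<longleftrightarrow>
     (\<forall>h\<in>L2_fun L. H_norm L h = 1 \<longrightarrow> brownian_motion M \<F> (\<lambda>t. W t h)) \<and>
     (\<forall>h\<in>L2_fun L. \<forall>g\<in>L2_fun L. \<forall>a b. \<forall>t\<ge>0.
        AE \<omega> in M. W t (\<lambda>x. a * h x + b * g x) \<omega> = a * W t h \<omega> + b * W t g \<omega>) \<and>
     (\<forall>h\<in>L2_fun L. H_norm L h = 0 \<longrightarrow> (\<forall>t\<ge>0. AE \<omega> in M. W t h \<omega> = 0))"

text \<open>
  \<open>I\<close> is (a version of) the It\<open>o\<close> integral of the deterministic function \<open>g\<close> over \<open>[0,t]\<close>
  against \<open>B\<close>: the \<open>L\<^sup>2(\<Omega>)\<close>-limit of the elementary integrals of step functions that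
  converge to \<open>g\<close> in \<open>L\<^sup>2(0,t)\<close>. The \<open>m\<close>-th step function has the grid points
  \<open>\<tau> m 0, \<dots>, \<tau> m (n m)\<close> and the values \<open>a m 0, \<dots>, a m (n m - 1)\<close>.
\<close>

definition wiener_integral ::
    "'w measure \<Rightarrow> (real \<Rightarrow> 'w \<Rightarrow> real) \<Rightarrow> real \<Rightarrow> (real \<Rightarrow> real) \<Rightarrow> ('w \<Rightarrow> real) \<Rightarrow> bool" where
  "wiener_integral M B t g I \<longleftrightarrow> I \<in> borel_measurable M \<and>
     (\<exists>(n :: nat \<Rightarrow> nat) (\<tau> :: nat \<Rightarrow> nat \<Rightarrow> real) (a :: nat \<Rightarrow> nat \<Rightarrow> real).
        (\<forall>m. \<tau> m 0 = 0 \<and> \<tau> m (n m) = t \<and> (\<forall>i<n m. \<tau> m i \<le> \<tau> m (Suc i))) \<and>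
        (\<lambda>m. \<integral>\<^sup>+u\<in>{0..t}. ennreal (((\<Sum>i<n m. a m i * indicator {\<tau> m i<..\<tau> m (Suc i)} u) - g u)\<^sup>2) \<partial>lborel)
           \<longlonglongrightarrow> 0 \<and>
        (\<lambda>m. \<integral>\<^sup>+\<omega>. ennreal (((\<Sum>i<n m. a m i * (B (\<tau> m (Suc i)) \<omega> - B (\<tau> m i) \<omega>)) - I \<omega>)\<^sup>2) \<partial>M)
           \<longlonglongrightarrow> 0)"

text \<open>
  \<open>Z(t) = \<integral>\<^sub>0\<^sup>t S(t - s) P\<^sup>N dW(s) = \<Sum>\<^bsub>j \<le> N\<^esub> \<integral>\<^sub>0\<^sup>t S(t - s) e\<^sub>j d\<langle>W(s), e\<^sub>j\<rangle>\<close>, where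
  \<open>S(t - s) e\<^sub>j\<close> is a multiple of \<open>e\<^sub>j\<close>; see \<open>S_op_eigenfunction\<close> below.
\<close>

definition stochastic_convolution ::
    "real \<Rightarrow> (nat \<Rightarrow> real) \<Rightarrow> (nat \<Rightarrow> real \<Rightarrow> real) \<Rightarrow> 'w measure \<Rightarrow>
     (real \<Rightarrow> (real \<Rightarrow> real) \<Rightarrow> 'w \<Rightarrow> real) \<Rightarrow> nat \<Rightarrow> real \<Rightarrow> (real \<Rightarrow> 'w \<Rightarrow> real \<Rightarrow> real) \<Rightarrow> bool" where
  "stochastic_convolution L lam e M W N T Z \<longleftrightarrow>
     (\<forall>t\<in>{0..T}. \<exists>\<zeta> :: nat \<Rightarrow> 'w \<Rightarrow> real.
        (\<forall>j\<le>N. wiener_integral M (\<lambda>s. W s (e j)) t (\<lambda>s. exp (- (t - s) * (lam j)\<^sup>2)) (\<zeta> j)) \<and>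
        (\<forall>\<omega>\<in>space M. \<forall>x\<in>{0..L}. Z t \<omega> x = (\<Sum>j\<le>N. \<zeta> j \<omega> * e j x)))"

lemma S_op_eigenfunction:
  assumes "neumann_eigensystem L lam e"
  shows "S_op L lam e t (e j) = (\<lambda>x. exp (- t * (lam j)\<^sup>2) * e j x)"
proof
  fix x
  have "(\<Sum>i. exp (- t * (lam i)\<^sup>2) * ip L (e j) (e i) * e i x) =
      (\<Sum>i\<in>{j}. exp (- t * (lam i)\<^sup>2) * ip L (e j) (e i) * e i x)"
    using assms by (intro suminf_finite) (auto simp: neumann_eigensystem_def)
  then show "S_op L lam e t (e j) x = exp (- t * (lam j)\<^sup>2) * e j x"
    using assms by (simp add: S_op_def spectral_op_def neumann_eigensystem_def)
qed

text \<open>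
  The scheme along one realization \<open>z k = Z\<^sup>N(t\<^sub>k)\<close> of the noise, with step size \<open>dt\<close> and
  nonlinearity \<open>f(v)(x) = F'(v(x))\<close>.
\<close>

definition implicit_scheme ::
    "real \<Rightarrow> (nat \<Rightarrow> real) \<Rightarrow> (nat \<Rightarrow> real \<Rightarrow> real) \<Rightarrow> real poly \<Rightarrow> nat \<Rightarrow> nat \<Rightarrow> real \<Rightarrow>
     (real \<Rightarrow> real) \<Rightarrow> (nat \<Rightarrow> real \<Rightarrow> real) \<Rightarrow> (nat \<Rightarrow> real \<Rightarrow> real) \<Rightarrow> bool" where
  "implicit_scheme L lam e F N K dt X0 z y \<longleftrightarrow>
     (\<forall>k\<le>K. in_PN L e N (y k)) \<and>
     (\<forall>x\<in>{0..L}. y 0 x = P_op L e N X0 x) \<and>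
     (\<forall>k<K. \<forall>x\<in>{0..L}.
        y (Suc k) x = y k x
          - A_op L lam e (A_op L lam e (y (Suc k))) x * dt
          - A_op L lam e (P_op L e N (\<lambda>u. poly (pderiv F) (y (Suc k) u + z (Suc k) u))) x * dt)"

end

theory Submission
  imports Defs
begin

text \<open>
  In Fourier coordinates the scheme reads
  \<open>(1 + h \<lambda>\<^sub>j\<^sup>2) y\<^sub>k\<^sub>+\<^sub>1 = y\<^sub>k - h \<lambda>\<^sub>j \<langle>f(Y\<^sub>k\<^sub>+\<^sub>1 + Z(t\<^sub>k\<^sub>+\<^sub>1)), e\<^sub>j\<rangle>\<close> for \<open>1 \<le> j \<le> N\<close>, and the mean of \<open>Y\<close> is conserved. The proof
  separates a deterministic estimate along one realization from an estimate of moments. Along a realization, the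
  noise is measured by \<open>V = 1 + \<Sum>\<^sub>k h \<beta>\<^sub>k\<^sup>1\<^sup>5\<close>, where \<open>\<beta>\<^sub>k - 1\<close> is essentially the square of the \<open>H\<^sup>1\<close> norm of \<open>Z(t\<^sub>k)\<close>, and
  \<open>pathwise_bound\<close> shows that both quantities of the theorem are at most a constant times a power of \<open>V\<close>. Every bound
  is polynomial in \<open>V\<close>; an exponential as in Gronwall's lemma would not be integrable.

  The deterministic estimate has three steps. Testing with \<open>A\<^sup>-\<^sup>1 y\<close> leaves \<open>\<langle>f(y + z), y\<rangle>\<close>, which is bounded below
  because \<open>f\<close> is cubic with positive leading coefficient; this controls \<open>y\<close> in \<open>L\<^sup>\<infinity> \<bbbH>\<^sup>-\<^sup>1\<close> and \<open>L\<^sup>2 \<bbbH>\<^sup>1\<close>. Testing with \<open>y\<close>, an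
  integration by parts and the lower bound of \<open>f'\<close> control \<open>y\<close> in \<open>L\<^sup>\<infinity> H\<close> and \<open>L\<^sup>2 \<bbbH>\<^sup>2\<close>; here the noise must lie in \<open>H\<^sup>1\<close>, as it
  does in dimension one. By Agmon's inequality the drift is then bounded in \<open>L\<^sup>4(0,T; H)\<close>. Finally, the variation
  of constants formula for the powers of \<open>(1 + h A\<^sup>2)\<^sup>-\<^sup>1\<close> converts integrability in time of the drift into regularity: directly
  for \<open>\<gamma> < 1\<close>, and otherwise after the case \<open>3/4\<close> has bounded \<open>y\<close> uniformly in space and time. The same formula, started
  at a later time, gives the increments.

  For the moments of \<open>V\<close> (\<open>noise_total_moment\<close>), the sum over time is inside the power \<open>V\<^sup>m\<close>, so convexity reduces the
  question to fixed times, and the \<open>H\<^sup>1\<close> norm is a sum of squares with weights that reduce it to single Fourier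
  coefficients: \<open>\<Sum>\<^sub>j \<lambda>\<^sub>j \<zeta>\<^sub>j\<^sup>2 = \<Sum>\<^sub>j \<lambda>\<^sub>j\<^sup>-\<^sup>1 (\<lambda>\<^sub>j \<zeta>\<^sub>j)\<^sup>2\<close>, where \<open>\<lambda>\<^sub>j \<zeta>\<^sub>j\<close> has bounded moments. These are obtained from the
  exponential moments of elementary integrals, and \<open>\<Sum>\<^sub>j \<lambda>\<^sub>j\<^sup>-\<^sup>1 < \<infinity>\<close> from \<open>\<lambda>\<^sub>j \<ge> (j \<pi> / L)\<^sup>2\<close>.
\<close>

section \<open>Neumann eigenfunctions\<close>

lemma LINT_eq_integral:
  fixes \<phi> :: "real \<Rightarrow> real"
  assumes "continuous_on {a..b} \<phi>"
  shows "(LINT x|lebesgue_on {a..b}. \<phi> x) = integral {a..b} \<phi>"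
  by (intro lebesgue_integral_eq_integral continuous_imp_integrable_real assms) simp

lemma LINT_deriv:
  fixes \<phi> \<phi>' :: "real \<Rightarrow> real"
  assumes "a \<le> b" and "continuous_on {a..b} \<phi>'"
    and "\<And>x. x \<in> {a..b} \<Longrightarrow> (\<phi> has_real_derivative \<phi>' x) (at x within {a..b})"
  shows "(LINT x|lebesgue_on {a..b}. \<phi>' x) = \<phi> b - \<phi> a"
proof -
  have "(\<phi>' has_integral (\<phi> b - \<phi> a)) {a..b}"
    using assms by (intro fundamental_theorem_of_calculus)
      (auto simp: has_real_derivative_iff_has_vector_derivative)
  then show ?thesis
    using assms by (simp add: LINT_eq_integral integral_unique)
qed

lemma L2_fun_continuous:
  assumes "continuous_on {0..L} v"
  shows "v \<in> L2_fun L"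
proof -
  have "integrable (lebesgue_on {0..L}) v" "integrable (lebesgue_on {0..L}) (\<lambda>x. (v x)\<^sup>2)"
    using assms by (intro continuous_imp_integrable_real continuous_intros; simp)+
  then show ?thesis by (auto simp: L2_fun_def)
qed

lemma integrable_L2_mult:
  assumes "v \<in> L2_fun L" "w \<in> L2_fun L"
  shows "integrable (lebesgue_on {0..L}) (\<lambda>x. v x * w x)"
proof (rule Bochner_Integration.integrable_bound)
  show "integrable (lebesgue_on {0..L}) (\<lambda>x. (v x)\<^sup>2 + (w x)\<^sup>2)"
    using assms by (auto simp: L2_fun_def)
  show "(\<lambda>x. v x * w x) \<in> borel_measurable (lebesgue_on {0..L})"
    using assms by (auto simp: L2_fun_def)
  have "\<bar>v x * w x\<bar> \<le> (v x)\<^sup>2 + (w x)\<^sup>2" for x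
  proof -
    have "2 * (\<bar>v x\<bar> * \<bar>w x\<bar>) \<le> (v x)\<^sup>2 + (w x)\<^sup>2"
      using sum_squares_bound[of "\<bar>v x\<bar>" "\<bar>w x\<bar>"] by simp
    moreover have "0 \<le> \<bar>v x\<bar> * \<bar>w x\<bar>" by simp
    ultimately show ?thesis unfolding abs_mult by linarith
  qed
  then show "AE x in lebesgue_on {0..L}. norm (v x * w x) \<le> norm ((v x)\<^sup>2 + (w x)\<^sup>2)"
    by (auto simp del: abs_mult)
qed

locale neumann =
  fixes L :: real and lam :: "nat \<Rightarrow> real" and e :: "nat \<Rightarrow> real \<Rightarrow> real"
  assumes L_pos: "0 < L" and eigen: "neumann_eigensystem L lam e"
begin

definition de :: "nat \<Rightarrow> real \<Rightarrow> real" where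
  "de j x = - (LINT y|lebesgue_on {0..x}. lam j * e j y)"

lemma e_L2: "e j \<in> L2_fun L"
  using eigen by (auto simp: neumann_eigensystem_def)

lemma e_deriv: "x \<in> {0..L} \<Longrightarrow> (e j has_real_derivative de j x) (at x within {0..L})"
  and de_L [simp]: "de j L = 0"
proof -
  have "neumann_laplacian L (e j) (\<lambda>x. lam j * e j x)"
    using eigen by (auto simp: neumann_eigensystem_def)
  then obtain v' where *: "\<forall>x\<in>{0..L}. (e j has_real_derivative v' x) (at x within {0..L}) \<and>
                        v' x = de j x" "v' L = 0"
    by (auto simp: neumann_laplacian_def de_def)
  then show "x \<in> {0..L} \<Longrightarrow> (e j has_real_derivative de j x) (at x within {0..L})" by metis
  show "de j L = 0" using * L_pos by (metis atLeastAtMost_iff less_eq_real_def)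
qed

lemma e_cont [continuous_intros]: "continuous_on {0..L} (e j)"
  by (rule DERIV_continuous_on[OF e_deriv])

lemma de_0 [simp]: "de j 0 = 0"
proof -
  have "(LINT y|lebesgue_on {0..0::real}. lam j * e j y) = integral {0..0} (\<lambda>y. lam j * e j y)"
    by (rule LINT_eq_integral) simp
  then show ?thesis by (simp add: de_def)
qed

lemma de_deriv:
  assumes "x \<in> {0..L}"
  shows "(de j has_real_derivative - lam j * e j x) (at x within {0..L})"
proof -
  have "((\<lambda>x. - integral {0..x} (\<lambda>y. lam j * e j y)) has_real_derivative - (lam j * e j x)) (at x within {0..L})"
    using assms by (intro DERIV_minus integral_has_real_derivative continuous_intros)
  moreover have "- integral {0..t} (\<lambda>y. lam j * e j y) = de j t" if "t \<in> {0..L}" for t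
    unfolding de_def using that
    by (subst LINT_eq_integral) (auto intro!: continuous_intros continuous_on_subset[OF e_cont])
  ultimately show ?thesis
    using has_field_derivative_transform_within[of _ "- (lam j * e j x)" x "{0..L}" 1 "de j"] assms
    by simp
qed

lemma de_cont [continuous_intros]: "continuous_on {0..L} (de j)"
  by (rule DERIV_continuous_on[OF de_deriv])

lemma ip_e: "ip L (e i) (e j) = (if i = j then 1 else 0)"
  using eigen by (auto simp: neumann_eigensystem_def)

lemma lam_0 [simp]: "lam 0 = 0" and lam_1: "0 < lam 1" and lam_Suc: "lam j \<le> lam (Suc j)"
  and e_0: "x \<in> {0..L} \<Longrightarrow> e 0 x = 1 / sqrt L"
  using eigen by (auto simp: neumann_eigensystem_def)

lemma lam_mono: "i \<le> j \<Longrightarrow> lam i \<le> lam j"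
  by (rule lift_Suc_mono_le[of lam]) (rule lam_Suc)

lemma lam_pos: "1 \<le> j \<Longrightarrow> 0 < lam j"
  using lam_mono[of 1 j] lam_1 by simp

lemma lam_nonneg: "0 \<le> lam j"
  using lam_mono[of 0 j] by simp

lemma ip_de: "(LINT x|lebesgue_on {0..L}. de i x * de j x) = (if i = j then lam j else 0)"
proof -
  have "(LINT x|lebesgue_on {0..L}. de i x * de j x + e i x * (- lam j * e j x)) = e i L * de j L - e i 0 * de j 0"
    using L_pos by (intro LINT_deriv) (auto intro!: continuous_intros derivative_eq_intros e_deriv de_deriv)
  moreover have "(LINT x|lebesgue_on {0..L}. de i x * de j x + e i x * (- lam j * e j x)) =
     (LINT x|lebesgue_on {0..L}. de i x * de j x) + (LINT x|lebesgue_on {0..L}. (- lam j) * (e i x * e j x))"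
    by (subst Bochner_Integration.integral_add[symmetric])
       (auto intro!: continuous_imp_integrable_real continuous_intros simp: algebra_simps)
  ultimately have "(LINT x|lebesgue_on {0..L}. de i x * de j x) = lam j * ip L (e i) (e j)"
    by (simp add: ip_def del: mult_minus_left)
  then show ?thesis by (simp add: ip_e)
qed

lemma const_if_deriv_0:
  assumes "\<And>x. x \<in> {0..L} \<Longrightarrow> (\<phi> has_real_derivative 0) (at x within {0..L})" "x \<in> {0..L}"
  shows "\<phi> x = (\<phi> 0 :: real)"
  using has_derivative_zero_constant[of "{0..L}" \<phi>] assms L_pos
  by (force simp: has_field_derivative_def lambda_zero)

text \<open>The eigenvalue equation conserves \<open>\<lambda> e\<^sup>2 + (e')\<^sup>2\<close>. Integrating this identity over \<open>[0,L]\<close> yields the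
  amplitude of \<open>e\<close>, hence a bound on the eigenfunctions that is uniform in \<open>j\<close>.\<close>

lemma e_energy: "x \<in> {0..L} \<Longrightarrow> lam j * (e j x)\<^sup>2 + (de j x)\<^sup>2 = lam j * (e j 0)\<^sup>2"
  by (rule const_if_deriv_0[of "\<lambda>x. lam j * (e j x)\<^sup>2 + (de j x)\<^sup>2" x, simplified])
    (auto intro!: derivative_eq_intros e_deriv de_deriv)

lemma e_bound_sq:
  assumes "x \<in> {0..L}"
  shows "(e j x)\<^sup>2 \<le> 2 / L"
proof (cases "j = 0")
  case True
  then show ?thesis using e_0[OF assms] L_pos by (simp add: power_divide divide_right_mono)
next
  case False
  then have l: "0 < lam j" by (simp add: lam_pos)
  have "(LINT x|lebesgue_on {0..L}. lam j * (e j x * e j x) + de j x * de j x) =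
     lam j * ip L (e j) (e j) + lam j"
    by (subst Bochner_Integration.integral_add)
       (auto intro!: continuous_imp_integrable_real continuous_intros simp: ip_de ip_def)
  also have "(LINT x|lebesgue_on {0..L}. lam j * (e j x * e j x) + de j x * de j x) =
     (LINT x|lebesgue_on {0..L}. lam j * (e j 0)\<^sup>2)"
    by (intro Bochner_Integration.integral_cong refl) (use e_energy in \<open>auto simp: power2_eq_square\<close>)
  also have "\<dots> = L * (lam j * (e j 0)\<^sup>2)"
    using L_pos by (simp add: measure_restrict_space)
  finally have "L * (e j 0)\<^sup>2 = 2"
    using l by (simp add: ip_e)
  moreover have "(e j x)\<^sup>2 \<le> (e j 0)\<^sup>2"
  proof -
    have "lam j * (e j x)\<^sup>2 \<le> lam j * (e j 0)\<^sup>2"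
      using e_energy[OF assms, of j] zero_le_power2[of "de j x"] by linarith
    then show ?thesis using l by simp
  qed
  ultimately have "L * (e j x)\<^sup>2 \<le> 2"
    using L_pos mult_left_mono[of "(e j x)\<^sup>2" "(e j 0)\<^sup>2" L] by simp
  then show ?thesis using L_pos by (simp add: field_simps)
qed

text \<open>An explicit solution of the eigenvalue problem: in the phase plane \<open>(e, e' / \<surd>\<lambda>)\<close> is a rotation by the
  angle \<open>\<surd>\<lambda> x\<close>, so rotating back gives two constants. The condition \<open>e'(L) = 0\<close> then quantises \<open>\<lambda>\<close>.\<close>

lemma e_cos:
  assumes "1 \<le> j" "x \<in> {0..L}"
  shows "e j x = e j 0 * cos (sqrt (lam j) * x)"
    and "de j x = - sqrt (lam j) * e j 0 * sin (sqrt (lam j) * x)"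
proof -
  define w where "w = sqrt (lam j)"
  have w: "0 < w" "lam j = w * w" using lam_pos[OF assms(1)] by (auto simp: w_def)
  have 1: "w * e j x * cos (w * x) - de j x * sin (w * x) = w * e j 0"
    by (rule const_if_deriv_0[of "\<lambda>x. w * e j x * cos (w * x) - de j x * sin (w * x)" x, simplified])
      (auto intro!: derivative_eq_intros e_deriv de_deriv simp: w assms(2)[simplified] algebra_simps)
  have 2: "w * e j x * sin (w * x) + de j x * cos (w * x) = 0"
    by (rule const_if_deriv_0[of "\<lambda>x. w * e j x * sin (w * x) + de j x * cos (w * x)" x, simplified])
      (auto intro!: derivative_eq_intros e_deriv de_deriv simp: w assms(2)[simplified] algebra_simps)
  have sc: "sin (w*x) * sin (w*x) = 1 - cos (w*x) * cos (w*x)"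
    using sin_cos_squared_add[of "w*x"] by (simp add: power2_eq_square)
  have rot: "a * (s * s + c * c) = (a * c - d * s) * c + (a * s + d * c) * s" for a d s c :: real
    by (simp add: algebra_simps)
  have rot': "d * (s * s + c * c) = (a * s + d * c) * c - (a * c - d * s) * s" for a d s c :: real
    by (simp add: algebra_simps)
  have "w * e j x = w * (e j 0 * cos (w * x))"
  proof -
    have "w * e j x = w * e j x * (sin (w*x) * sin (w*x) + cos (w*x) * cos (w*x))"
      using sc by simp
    also have "\<dots> = (w * e j x * cos (w * x) - de j x * sin (w * x)) * cos (w*x)
        + (w * e j x * sin (w * x) + de j x * cos (w * x)) * sin (w*x)"
      by (rule rot)
    finally show ?thesis unfolding 1 2 by simp
  qed
  then have "e j x = e j 0 * cos (w * x)" using w(1) by simp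
  then show "e j x = e j 0 * cos (sqrt (lam j) * x)" unfolding w_def .
  have "de j x = de j x * (sin (w*x) * sin (w*x) + cos (w*x) * cos (w*x))"
    using sc by simp
  also have "\<dots> = (w * e j x * sin (w * x) + de j x * cos (w * x)) * cos (w*x)
       - (w * e j x * cos (w * x) - de j x * sin (w * x)) * sin (w*x)"
    by (rule rot')
  finally have "de j x = - (w * e j 0 * sin (w * x))" unfolding 1 2 by simp
  then show "de j x = - sqrt (lam j) * e j 0 * sin (sqrt (lam j) * x)"
    by (simp add: w_def)
qed

lemma e_ne_0: "e j 0 \<noteq> 0" if "1 \<le> j"
proof
  assume *: "e j 0 = 0"
  have "ip L (e j) (e j) = (LINT x|lebesgue_on {0..L}. 0)"
    unfolding ip_def by (intro Bochner_Integration.integral_cong refl) (use e_cos(1)[OF that] * in auto)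
  then show False by (simp add: ip_e)
qed

text \<open>Two eigenfunctions for the same eigenvalue are proportional by the cosine formula, which contradicts
  orthogonality.\<close>

lemma lam_strict: "lam j < lam (Suc j)" if "1 \<le> j"
proof (rule ccontr)
  assume "\<not> ?thesis"
  then have eq: "lam (Suc j) = lam j" using lam_Suc[of j] by simp
  have "ip L (e (Suc j)) (e j) = (LINT x|lebesgue_on {0..L}. (e (Suc j) 0 / e j 0) * (e j x * e j x))"
    unfolding ip_def
  proof (intro Bochner_Integration.integral_cong refl)
    fix x assume "x \<in> space (lebesgue_on {0..L})"
    then have x: "x \<in> {0..L}" by simp
    have "e (Suc j) x = (e (Suc j) 0 / e j 0) * e j x"
      using e_ne_0[OF that] e_cos(1)[OF that x] e_cos(1)[of "Suc j", OF _ x] eq by simp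
    then show "e (Suc j) x * e j x = e (Suc j) 0 / e j 0 * (e j x * e j x)" by simp
  qed
  also have "\<dots> = (e (Suc j) 0 / e j 0) * ip L (e j) (e j)" by (simp add: ip_def)
  finally have "e (Suc j) 0 = 0" using e_ne_0[OF that] by (simp add: ip_e)
  then show False using e_ne_0[of "Suc j"] by simp
qed

text \<open>\<open>\<surd>\<lambda>\<^sub>j L / \<pi>\<close> is an integer, positive for \<open>j \<ge> 1\<close> and strictly increasing in \<open>j\<close>, hence at least \<open>j\<close>.\<close>

lemma lam_lower: "lam j \<ge> (real j * pi / L)\<^sup>2"
proof -
  have "\<exists>n::int. sqrt (lam j) * L = real_of_int n * pi" if "1 \<le> j" for j
  proof -
    have "sqrt (lam j) * e j 0 * sin (sqrt (lam j) * L) = 0"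
      using e_cos(2)[OF that, of L] L_pos by simp
    then have "sin (sqrt (lam j) * L) = 0"
      using e_ne_0[OF that] lam_pos[OF that] by simp
    then show ?thesis by (simp add: sin_zero_iff_int2)
  qed
  then obtain n :: "nat \<Rightarrow> int" where n: "\<And>j. 1 \<le> j \<Longrightarrow> sqrt (lam j) * L = real_of_int (n j) * pi"
    by metis
  have ge: "real j \<le> real_of_int (n j)" if "1 \<le> j" for j
    using that
  proof (induction rule: dec_induct)
    case base
    have "0 < real_of_int (n 1) * pi" using n[of 1] lam_pos[of 1] L_pos
      by (metis le_refl mult_pos_pos real_sqrt_gt_zero)
    then show ?case by (simp add: zero_less_mult_iff)
  next
    case (step j)
    have "real_of_int (n j) * pi < real_of_int (n (Suc j)) * pi"
      using n[of j] n[of "Suc j"] lam_strict[of j] step L_pos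
      by (metis One_nat_def le_add1 mult_strict_right_mono plus_1_eq_Suc real_sqrt_less_mono)
    then show ?case using step by simp
  qed
  show ?thesis
  proof (cases "j = 0")
    case False
    then have j: "1 \<le> j" by simp
    have "real j * pi / L \<le> sqrt (lam j)"
      using ge[OF j] n[OF j] L_pos by (simp add: field_simps)
    then have "(real j * pi / L)\<^sup>2 \<le> (sqrt (lam j))\<^sup>2"
      using L_pos by (intro power_mono) auto
    then show ?thesis using lam_nonneg by simp
  qed simp
qed

lemma summable_lam: 
  assumes "1 / 2 < s"
  shows "summable (\<lambda>j. lam (Suc j) powr - s)"
proof (rule summable_comparison_test')
  have "summable (\<lambda>j. real (Suc j) powr (- 2 * s))"
    using assms by (subst summable_Suc_iff) (simp add: summable_real_powr_iff)
  then show "summable (\<lambda>j. (pi / L) powr (- 2 * s) * real (Suc j) powr (- 2 * s))"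
    by (rule summable_mult)
  fix j :: nat
  have "lam (Suc j) powr - s \<le> ((real (Suc j) * pi / L)\<^sup>2) powr - s"
    using assms lam_lower[of "Suc j"] L_pos by (intro powr_mono2') (auto intro!: zero_less_power)
  also have "(real (Suc j) * pi / L)\<^sup>2 = (pi / L * real (Suc j)) powr 2"
    using L_pos by (simp add: field_simps)
  also have "\<dots> powr - s = (pi / L * real (Suc j)) powr (- 2 * s)"
    by (simp only: powr_powr) simp
  also have "\<dots> = (pi / L) powr (- 2 * s) * real (Suc j) powr (- 2 * s)"
    by (rule powr_mult)
  finally show "norm (lam (Suc j) powr - s) \<le> (pi / L) powr (- 2 * s) * real (Suc j) powr (- 2 * s)" by simp
qed

end

section \<open>Trigonometric polynomials and Sobolev norms\<close>

lemma Cauchy_Schwarz_weighted: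
  fixes w x y :: "'a \<Rightarrow> real"
  assumes "\<And>i. i \<in> I \<Longrightarrow> 0 \<le> w i"
  shows "(\<Sum>i\<in>I. w i * (x i * y i))\<^sup>2 \<le> (\<Sum>i\<in>I. w i * (x i)\<^sup>2) * (\<Sum>i\<in>I. w i * (y i)\<^sup>2)"
proof -
  have "(\<Sum>i\<in>I. (sqrt (w i) * x i) * (sqrt (w i) * y i))\<^sup>2
      \<le> (\<Sum>i\<in>I. (sqrt (w i) * x i)\<^sup>2) * (\<Sum>i\<in>I. (sqrt (w i) * y i)\<^sup>2)"
    by (rule Cauchy_Schwarz_ineq_sum)
  also have "(\<Sum>i\<in>I. (sqrt (w i) * x i) * (sqrt (w i) * y i)) = (\<Sum>i\<in>I. w i * (x i * y i))"
    using assms by (intro sum.cong) (simp_all add: algebra_simps flip: real_sqrt_mult)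
  also have "(\<Sum>i\<in>I. (sqrt (w i) * x i)\<^sup>2) = (\<Sum>i\<in>I. w i * (x i)\<^sup>2)"
    using assms by (intro sum.cong) (simp_all add: power_mult_distrib)
  also have "(\<Sum>i\<in>I. (sqrt (w i) * y i)\<^sup>2) = (\<Sum>i\<in>I. w i * (y i)\<^sup>2)"
    using assms by (intro sum.cong) (simp_all add: power_mult_distrib)
  finally show ?thesis .
qed

context neumann
begin

abbreviation intO :: "(real \<Rightarrow> real) \<Rightarrow> real" where
  "intO \<phi> \<equiv> (LINT x|lebesgue_on {0..L}. \<phi> x)"

lemma intO_mono:
  assumes "continuous_on {0..L} \<phi>" "continuous_on {0..L} \<psi>" "\<And>x. x \<in> {0..L} \<Longrightarrow> \<phi> x \<le> \<psi> x"
  shows "intO \<phi> \<le> intO \<psi>"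
  using assms by (intro integral_mono continuous_imp_integrable_real) auto

lemma intO_const [simp]: "intO (\<lambda>x. c) = L * c"
  using L_pos by (simp add: measure_restrict_space)

lemma intO_cong: "(\<And>x. x \<in> {0..L} \<Longrightarrow> \<phi> x = \<psi> x) \<Longrightarrow> intO \<phi> = intO \<psi>"
  by (intro Bochner_Integration.integral_cong) auto

lemma intO_add:
  "continuous_on {0..L} \<phi> \<Longrightarrow> continuous_on {0..L} \<psi> \<Longrightarrow> intO (\<lambda>x. \<phi> x + \<psi> x) = intO \<phi> + intO \<psi>"
  by (intro Bochner_Integration.integral_add continuous_imp_integrable_real)

lemma intO_sum:
  "(\<And>i. i \<in> I \<Longrightarrow> continuous_on {0..L} (\<phi> i)) \<Longrightarrow> intO (\<lambda>x. \<Sum>i\<in>I. \<phi> i x) = (\<Sum>i\<in>I. intO (\<phi> i))"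
  by (intro Bochner_Integration.integral_sum continuous_imp_integrable_real)

definition comb :: "nat set \<Rightarrow> (nat \<Rightarrow> real) \<Rightarrow> real \<Rightarrow> real" where
  "comb J a x = (\<Sum>j\<in>J. a j * e j x)"

definition dcomb :: "nat set \<Rightarrow> (nat \<Rightarrow> real) \<Rightarrow> real \<Rightarrow> real" where
  "dcomb J a x = (\<Sum>j\<in>J. a j * de j x)"

text \<open>\<open>sob N s a\<close> is \<open>\<parallel>y\<parallel>\<^sup>2\<close> in \<open>\<bbbH>\<^sup>s\<close> for \<open>y = \<Sum>\<^bsub>1 \<le> j \<le> N\<^esub> a\<^sub>j e\<^sub>j\<close>; the mean \<open>a\<^sub>0\<close> does not enter.\<close>

definition sob :: "nat \<Rightarrow> real \<Rightarrow> (nat \<Rightarrow> real) \<Rightarrow> real" where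
  "sob N s a = (\<Sum>j=1..N. lam j powr s * (a j)\<^sup>2)"

lemma comb_cont [continuous_intros]: "continuous_on {0..L} (comb J a)"
  unfolding comb_def by (intro continuous_intros)

lemma dcomb_cont [continuous_intros]: "continuous_on {0..L} (dcomb J a)"
  unfolding dcomb_def by (intro continuous_intros)

lemma comb_deriv:
  "x \<in> {0..L} \<Longrightarrow> (comb J a has_real_derivative dcomb J a x) (at x within {0..L})"
  unfolding comb_def dcomb_def by (auto intro!: derivative_eq_intros e_deriv simp: mult.commute)

lemma dcomb_deriv:
  "x \<in> {0..L} \<Longrightarrow> (dcomb J a has_real_derivative - comb J (\<lambda>j. lam j * a j) x) (at x within {0..L})"
  unfolding comb_def dcomb_def
  by (auto intro!: derivative_eq_intros de_deriv simp: algebra_simps sum_negf)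

lemma dcomb_bdry [simp]: "dcomb J a 0 = 0" "dcomb J a L = 0"
  by (auto simp: dcomb_def)

lemma intO_comb_mult:
  assumes "continuous_on {0..L} v"
  shows "intO (\<lambda>x. v x * comb J a x) = (\<Sum>j\<in>J. a j * ip L v (e j))"
proof -
  have "intO (\<lambda>x. v x * comb J a x) = intO (\<lambda>x. \<Sum>j\<in>J. a j * (v x * e j x))"
    by (simp add: comb_def sum_distrib_left algebra_simps)
  also have "\<dots> = (\<Sum>j\<in>J. intO (\<lambda>x. a j * (v x * e j x)))"
    by (intro intO_sum continuous_intros assms)
  finally show ?thesis by (simp add: ip_def)
qed

lemma ip_comb:
  assumes "finite J"
  shows "ip L (comb J a) (e j) = (if j \<in> J then a j else 0)"
proof -
  have "ip L (comb J a) (e j) = intO (\<lambda>x. e j x * comb J a x)"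
    by (simp add: ip_def mult.commute)
  also have "\<dots> = (\<Sum>i\<in>J. a i * ip L (e j) (e i))"
    by (intro intO_comb_mult continuous_intros)
  also have "\<dots> = (\<Sum>i\<in>J. if j = i then a i else 0)"
    by (intro sum.cong) (auto simp: ip_e)
  finally show ?thesis using assms by simp
qed

lemma intO_comb_sq:
  assumes "finite J"
  shows "intO (\<lambda>x. (comb J a x)\<^sup>2) = (\<Sum>j\<in>J. (a j)\<^sup>2)"
proof -
  have "intO (\<lambda>x. comb J a x * comb J a x) = (\<Sum>j\<in>J. a j * ip L (comb J a) (e j))"
    by (intro intO_comb_mult continuous_intros)
  then show ?thesis using assms by (simp add: ip_comb power2_eq_square)
qed

lemma intO_dcomb_sq:
  assumes "finite J"
  shows "intO (\<lambda>x. (dcomb J a x)\<^sup>2) = (\<Sum>j\<in>J. lam j * (a j)\<^sup>2)"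
proof -
  have "intO (\<lambda>x. (dcomb J a x)\<^sup>2) = intO (\<lambda>x. \<Sum>i\<in>J. \<Sum>j\<in>J. a i * a j * (de i x * de j x))"
    by (simp add: dcomb_def power2_eq_square sum_product algebra_simps)
  also have "\<dots> = (\<Sum>i\<in>J. \<Sum>j\<in>J. intO (\<lambda>x. a i * a j * (de i x * de j x)))"
    by (subst intO_sum intO_sum continuous_intros; intro sum.cong intO_sum continuous_intros refl)+
  also have "\<dots> = (\<Sum>i\<in>J. \<Sum>j\<in>J. if i = j then lam i * (a i)\<^sup>2 else 0)"
    by (intro sum.cong) (auto simp: ip_de power2_eq_square)
  finally show ?thesis using assms by simp
qed

lemma bessel:
  assumes "finite J" and v: "continuous_on {0..L} v"
  shows "(\<Sum>j\<in>J. (ip L v (e j))\<^sup>2) \<le> intO (\<lambda>x. (v x)\<^sup>2)"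
proof -
  define c where "c = (\<lambda>j. ip L v (e j))"
  have "0 \<le> intO (\<lambda>x. (v x - comb J c x)\<^sup>2)" by simp
  also have "\<dots> = intO (\<lambda>x. ((v x)\<^sup>2 + (comb J c x)\<^sup>2) + (-2) * (v x * comb J c x))"
    by (simp add: power2_eq_square algebra_simps)
  also have "\<dots> = intO (\<lambda>x. (v x)\<^sup>2) + intO (\<lambda>x. (comb J c x)\<^sup>2) - 2 * intO (\<lambda>x. v x * comb J c x)"
    by (subst intO_add intO_add, (intro continuous_intros v)+)+ simp
  finally have "2 * intO (\<lambda>x. v x * comb J c x) \<le> intO (\<lambda>x. (v x)\<^sup>2) + intO (\<lambda>x. (comb J c x)\<^sup>2)"
    by simp
  moreover have "intO (\<lambda>x. v x * comb J c x) = (\<Sum>j\<in>J. (c j)\<^sup>2)"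
    by (subst intO_comb_mult[OF v]) (simp add: c_def power2_eq_square)
  ultimately show ?thesis
    using intO_comb_sq[OF assms(1), of c] by (simp add: c_def)
qed

lemma sob_nonneg [simp]: "0 \<le> sob N s a"
  by (auto simp: sob_def intro!: sum_nonneg)

lemma sob_interpolation: "(sob N s a)\<^sup>2 \<le> sob N (s - t) a * sob N (s + t) a"
proof -
  have *: "(lam j powr ((s - t) / 2))\<^sup>2 = lam j powr (s - t)" "(lam j powr ((s + t) / 2))\<^sup>2 = lam j powr (s + t)"
     "lam j powr ((s - t) / 2) * lam j powr ((s + t) / 2) = lam j powr s" for j
    by (auto simp: power2_eq_square add_divide_distrib diff_divide_distrib simp flip: powr_add)
  have "(sob N s a)\<^sup>2 = (\<Sum>j=1..N. (lam j powr ((s - t) / 2) * a j) * (lam j powr ((s + t) / 2) * a j))\<^sup>2"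
    by (simp add: sob_def power2_eq_square mult_ac flip: *(3))
  also have "\<dots> \<le> (\<Sum>j=1..N. (lam j powr ((s - t) / 2) * a j)\<^sup>2) * (\<Sum>j=1..N. (lam j powr ((s + t) / 2) * a j)\<^sup>2)"
    by (rule Cauchy_Schwarz_ineq_sum)
  finally show ?thesis by (simp add: sob_def power_mult_distrib *)
qed

lemma sob_1: "sob N 1 a = (\<Sum>j=1..N. lam j * (a j)\<^sup>2)"
  and sob_0: "sob N 0 a = (\<Sum>j=1..N. (a j)\<^sup>2)"
  unfolding sob_def
  by (intro sum.cong; use lam_pos in force)+

lemma sob_mono:
  assumes "s \<le> t"
  shows "sob N s a \<le> lam 1 powr (s - t) * sob N t a"
proof -
  have "lam j powr s \<le> lam 1 powr (s - t) * lam j powr t" if "1 \<le> j" for j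
  proof -
    have "lam j powr s = lam j powr (s - t) * lam j powr t" by (simp flip: powr_add)
    also have "\<dots> \<le> lam 1 powr (s - t) * lam j powr t"
      using assms that lam_1 lam_mono[OF that] by (intro mult_right_mono powr_mono2') auto
    finally show ?thesis .
  qed
  then show ?thesis
    unfolding sob_def sum_distrib_left by (intro sum_mono) (auto simp flip: mult.assoc intro!: mult_right_mono)
qed

text \<open>Sobolev embedding into the bounded functions, from \<open>\<Sum>\<^sub>j \<lambda>\<^sub>j\<^sup>-\<^sup>s < \<infinity>\<close> and the uniform
  bound on the eigenfunctions.\<close>

lemma sobolev_sup:
  assumes "1 / 2 < s"
  shows "\<exists>C\<ge>0. \<forall>N a. \<forall>x\<in>{0..L}. (comb {1..N} a x)\<^sup>2 \<le> C * sob N s a"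
proof -
  define \<Lambda> where "\<Lambda> = (\<Sum>j. lam (Suc j) powr - s)"
  have \<Lambda>: "(\<Sum>j=1..N. lam j powr - s) \<le> \<Lambda>" for N
  proof -
    have "(\<Sum>j=1..N. lam j powr - s) = (\<Sum>j<N. lam (Suc j) powr - s)"
      by (rule sum.reindex_bij_witness[of _ Suc "\<lambda>j. j - 1"]) auto
    also have "\<dots> \<le> \<Lambda>"
      unfolding \<Lambda>_def by (intro sum_le_suminf summable_lam assms) auto
    finally show ?thesis .
  qed
  then have \<Lambda>0: "0 \<le> \<Lambda>" using \<Lambda>[of 0] by simp
  have "(comb {1..N} a x)\<^sup>2 \<le> (2 / L * \<Lambda>) * sob N s a" if x: "x \<in> {0..L}" for N a x
  proof -
    have "(comb {1..N} a x)\<^sup>2 = (\<Sum>j=1..N. (lam j powr (s / 2) * a j) * (lam j powr (- s / 2) * e j x))\<^sup>2"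
      unfolding comb_def
      by (intro arg_cong[where f = "\<lambda>x. x\<^sup>2"] sum.cong refl)
         (use lam_pos in \<open>force simp: powr_minus field_simps\<close>)
    also have "\<dots> \<le> (\<Sum>j=1..N. (lam j powr (s / 2) * a j)\<^sup>2) * (\<Sum>j=1..N. (lam j powr (- s / 2) * e j x)\<^sup>2)"
      by (rule Cauchy_Schwarz_ineq_sum)
    also have "(\<Sum>j=1..N. (lam j powr (s / 2) * a j)\<^sup>2) = sob N s a"
      unfolding sob_def by (intro sum.cong) (auto simp: power_mult_distrib power2_eq_square simp flip: powr_add)
    also have "(\<Sum>j=1..N. (lam j powr (- s / 2) * e j x)\<^sup>2) = (\<Sum>j=1..N. lam j powr - s * (e j x)\<^sup>2)"
      by (intro sum.cong) (auto simp: power_mult_distrib power2_eq_square simp flip: powr_add)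
    also have "sob N s a * (\<Sum>j=1..N. lam j powr - s * (e j x)\<^sup>2) \<le> sob N s a * (\<Sum>j=1..N. lam j powr - s * (2 / L))"
      using e_bound_sq[OF x] by (intro mult_left_mono sum_mono) auto
    also have "\<dots> \<le> sob N s a * (\<Lambda> * (2 / L))"
      using \<Lambda>[of N] L_pos unfolding sum_distrib_right[symmetric] by (intro mult_left_mono mult_right_mono) auto
    finally show ?thesis by (simp add: mult_ac)
  qed
  moreover have "0 \<le> 2 / L * \<Lambda>" using \<Lambda>0 L_pos by simp
  ultimately show ?thesis by blast
qed

text \<open>Agmon's inequality \<open>\<parallel>y\<parallel>\<^sub>\<infinity>\<^sup>2 \<le> C \<parallel>y\<parallel> \<parallel>y'\<parallel>\<close> for mean-free \<open>y\<close>: integrate \<open>(y\<^sup>2)' = 2 y y'\<close>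
  and average over the starting point.\<close>

lemma agmon:
  "\<exists>C\<ge>0. \<forall>N a. \<forall>x\<in>{0..L}. (comb {1..N} a x)\<^sup>2 \<le> C * sqrt (sob N 0 a * sob N 1 a)"
proof -
  define C where "C = lam 1 powr (-1/2) / L + 2"
  have "(comb {1..N} a x)\<^sup>2 \<le> C * sqrt (sob N 0 a * sob N 1 a)" if x: "x \<in> {0..L}" for N a x
  proof -
    define y where "y = comb {1..N} a"
    define y' where "y' = dcomb {1..N} a"
    have yc: "continuous_on {0..L} y" "continuous_on {0..L} y'"
      unfolding y_def y'_def by (intro continuous_intros)+
    define R where "R = sqrt (sob N 0 a * sob N 1 a)"
    have R0: "0 \<le> R" by (simp add: R_def)
    have diff: "(y x)\<^sup>2 - (y t)\<^sup>2 \<le> 2 * R" if t: "t \<in> {0..L}" for t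
    proof (cases "sob N 0 a = 0")
      case True
      then have "\<forall>j\<in>{1..N}. a j = 0"
        by (subst (asm) sob_0, subst (asm) sum_nonneg_eq_0_iff) auto
      then show ?thesis using R0 by (simp add: y_def comb_def)
    next
      case False
      then have 0: "0 < sob N 0 a" using sob_nonneg[of N 0 a] by linarith
      have "0 < lam 1 powr (0 - 1) * sob N 1 a" using sob_mono[of 0 1 N a] 0 by simp
      then have 1: "0 < sob N 1 a"
        using sob_nonneg[of N 1 a] by (metis less_eq_real_def mult_zero_right less_irrefl)
      \<comment> \<open>the weight that balances both terms of \<open>2 \<bar>y y'\<bar> \<le> \<sigma> y\<^sup>2 + (y')\<^sup>2 / \<sigma>\<close> after integration\<close>
      define \<sigma> where "\<sigma> = sqrt (sob N 1 a) / sqrt (sob N 0 a)"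
      have \<sigma>: "0 < \<sigma>" using 0 1 by (simp add: \<sigma>_def)
      define h where "h = (\<lambda>t. \<sigma> * (y t)\<^sup>2 + (1 / \<sigma>) * (y' t)\<^sup>2)"
      have hc: "continuous_on {0..L} h" unfolding h_def by (intro continuous_intros yc)
      have h: "\<bar>2 * y t * y' t\<bar> \<le> h t" for t
      proof -
        have "0 \<le> (\<sigma> * \<bar>y t\<bar> - \<bar>y' t\<bar>)\<^sup>2 / \<sigma>" using \<sigma> by simp
        also have "\<dots> = h t - \<bar>2 * y t * y' t\<bar>"
          using \<sigma> by (simp add: h_def power2_eq_square field_simps abs_mult)
        finally show ?thesis by simp
      qed
      have "\<bar>(y \<beta>)\<^sup>2 - (y \<alpha>)\<^sup>2\<bar> \<le> intO h" if "0 \<le> \<alpha>" "\<alpha> \<le> \<beta>" "\<beta> \<le> L" for \<alpha> \<beta>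
      proof -
        have sub: "{\<alpha>..\<beta>} \<subseteq> {0..L}" using that by auto
        have cont: "continuous_on {\<alpha>..\<beta>} (\<lambda>t. 2 * y t * y' t)"
          by (rule continuous_on_subset[OF _ sub]) (intro continuous_intros yc)
        have "((\<lambda>t. 2 * y t * y' t) has_integral ((y \<beta>)\<^sup>2 - (y \<alpha>)\<^sup>2)) {\<alpha>..\<beta>}"
        proof (rule fundamental_theorem_of_calculus[OF that(2)])
          fix t assume "t \<in> {\<alpha>..\<beta>}"
          then have "(y has_real_derivative y' t) (at t within {0..L})"
            unfolding y_def y'_def using sub by (intro comb_deriv) auto
          then have "((\<lambda>t. (y t)\<^sup>2) has_real_derivative 2 * y t * y' t) (at t within {0..L})"
            by (auto intro!: derivative_eq_intros)
          then show "((\<lambda>t. (y t)\<^sup>2) has_vector_derivative 2 * y t * y' t) (at t within {\<alpha>..\<beta>})"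
            unfolding has_real_derivative_iff_has_vector_derivative
            by (rule has_vector_derivative_within_subset[OF _ sub])
        qed
        then have "(y \<beta>)\<^sup>2 - (y \<alpha>)\<^sup>2 = integral {\<alpha>..\<beta>} (\<lambda>t. 2 * y t * y' t)"
          by (simp add: integral_unique)
        moreover have "norm (integral {\<alpha>..\<beta>} (\<lambda>t. 2 * y t * y' t)) \<le> integral {\<alpha>..\<beta>} h"
          using h cont continuous_on_subset[OF hc sub]
          by (intro integral_norm_bound_integral integrable_continuous_interval) auto
        moreover have "integral {\<alpha>..\<beta>} h \<le> integral {0..L} h"
          using hc continuous_on_subset[OF hc sub] sub \<sigma>
          by (intro integral_subset_le integrable_continuous_interval) (auto simp: h_def)
        moreover have "integral {0..L} h = intO h" using LINT_eq_integral[OF hc] by simp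
        ultimately show ?thesis by simp
      qed
      from this[of x t] this[of t x] have "(y x)\<^sup>2 - (y t)\<^sup>2 \<le> intO h"
        using x t by (cases "x \<le> t") auto
      also have "intO h = \<sigma> * sob N 0 a + (1 / \<sigma>) * sob N 1 a"
        unfolding h_def using yc \<sigma>
        by (subst intO_add) (auto intro!: continuous_intros simp: y_def y'_def intO_comb_sq intO_dcomb_sq sob_0 sob_1)
      also have "\<dots> = 2 * R"
      proof -
        have "sob N 0 a = sqrt (sob N 0 a) * sqrt (sob N 0 a)" "sob N 1 a = sqrt (sob N 1 a) * sqrt (sob N 1 a)"
          by auto
        moreover have "sqrt (sob N 0 a) > 0" "sqrt (sob N 1 a) > 0" using 0 1 by auto
        ultimately show ?thesis
          unfolding \<sigma>_def R_def real_sqrt_mult by (simp add: field_simps)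
      qed
      finally show ?thesis .
    qed
    \<comment> \<open>the average over \<open>t\<close> leaves \<open>\<parallel>y\<parallel>\<^sup>2\<close>, which Poincare's inequality bounds by \<open>\<parallel>y\<parallel> \<parallel>y'\<parallel>\<close>\<close>
    have "L * (y x)\<^sup>2 = intO (\<lambda>t. (y x)\<^sup>2)" by (simp only: intO_const)
    also have "\<dots> \<le> intO (\<lambda>t. (y t)\<^sup>2 + 2 * R)"
      using diff yc by (intro intO_mono continuous_intros) (auto simp: algebra_simps)
    also have "\<dots> = sob N 0 a + L * (2 * R)"
      using yc by (subst intO_add) (auto intro!: continuous_intros simp only: intO_const y_def intO_comb_sq sob_0 finite_atLeastAtMost)
    also have "sob N 0 a \<le> lam 1 powr (-1/2) * R"
    proof -
      have "sob N 0 a = sqrt (sob N 0 a * sob N 0 a)" by simp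
      also have "\<dots> \<le> sqrt (sob N 0 a * (lam 1 powr (-1) * sob N 1 a))"
        using sob_mono[of 0 1 N a] by (intro real_sqrt_le_mono mult_left_mono) auto
      also have "\<dots> = sqrt (lam 1 powr (-1)) * R" unfolding R_def real_sqrt_mult by (simp only: mult_ac)
      also have "sqrt (lam 1 powr (-1)) = lam 1 powr (-1/2)"
        unfolding powr_half_sqrt[OF powr_ge_zero, symmetric] powr_powr by simp
      finally show ?thesis .
    qed
    also have "lam 1 powr (-1/2) * R + L * (2 * R) = L * (C * R)"
      using L_pos by (simp add: C_def field_simps)
    finally have "L * (y x)\<^sup>2 \<le> L * (C * R)" by simp
    then show ?thesis using L_pos by (simp add: y_def R_def)
  qed
  moreover have "0 \<le> C" using L_pos by (simp add: C_def)
  ultimately show ?thesis by blast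
qed

end

section \<open>The cubic nonlinearity\<close>

text \<open>The properties of \<open>f = F'\<close> on which the a priori estimates rest. Coercivity is stated for the argument
  \<open>u = y + z\<close> and the smooth part \<open>y = u - z\<close>, because the scheme is tested with \<open>y\<close> and not with \<open>u\<close>.\<close>

locale cubic_drift = neumann +
  fixes \<kappa> :: real and f f' :: "real \<Rightarrow> real"
  assumes \<kappa>_nonneg: "0 \<le> \<kappa>"
    and f_deriv: "\<And>u. (f has_real_derivative f' u) (at u)"
    and f'_cont: "continuous_on UNIV f'"
    and f_coercive: "\<And>u z. - \<kappa> * (1 + z^4) \<le> f u * (u - z)"
    and f_growth: "\<And>u. (f u)\<^sup>2 \<le> \<kappa> * (1 + u^6)"
    and f'_lower: "\<And>u. - \<kappa> \<le> f' u"
    and f'_growth: "\<And>u. f' u \<le> \<kappa> * (1 + u\<^sup>2)"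
begin

lemma f_cont: "continuous_on S f"
  by (meson DERIV_isCont continuous_at_imp_continuous_on f_deriv)

text \<open>The argument of the nonlinearity. The conserved mean of \<open>Y\<close> is carried by the coefficient \<open>b\<^sub>0\<close> of the
  noise, so that the first summand is mean-free and Agmon's inequality applies to it.\<close>

definition u_fun :: "nat \<Rightarrow> (nat \<Rightarrow> real) \<Rightarrow> (nat \<Rightarrow> real) \<Rightarrow> real \<Rightarrow> real" where
  "u_fun N a b x = comb {1..N} a x + comb {..N} b x"

definition drift :: "nat \<Rightarrow> (nat \<Rightarrow> real) \<Rightarrow> (nat \<Rightarrow> real) \<Rightarrow> nat \<Rightarrow> real" where
  "drift N a b j = ip L (\<lambda>x. f (u_fun N a b x)) (e j)"

text \<open>One plus the square of an \<open>H\<^sup>1\<close> norm, the only quantity through which the noise at a fixed time enters. It is a sum of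
  squares of single coefficients, and this makes its moments accessible without joint laws.\<close>

definition noise_size :: "nat \<Rightarrow> (nat \<Rightarrow> real) \<Rightarrow> real" where
  "noise_size N b = 1 + (b 0)\<^sup>2 + sob N 1 b"

lemma noise_size_ge_1: "1 \<le> noise_size N b"
  by (simp add: noise_size_def)

lemma u_cont [continuous_intros]: "continuous_on {0..L} (u_fun N a b)"
  unfolding u_fun_def by (intro continuous_intros)

lemma fu_cont: "continuous_on {0..L} (\<lambda>x. f (u_fun N a b x))"
  by (rule continuous_on_compose2[OF f_cont u_cont]) auto

lemma f'u_cont: "continuous_on {0..L} (\<lambda>x. f' (u_fun N a b x))"
  by (rule continuous_on_compose2[OF f'_cont u_cont]) auto

lemma noise_sup: "\<exists>C\<ge>0. \<forall>N b. \<forall>x\<in>{0..L}. (comb {..N} b x)\<^sup>2 \<le> C * noise_size N b"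
proof -
  obtain C where C: "0 \<le> C" "\<And>N b x. x \<in> {0..L} \<Longrightarrow> (comb {1..N} b x)\<^sup>2 \<le> C * sob N 1 b"
    using sobolev_sup[of 1] by auto
  have "(comb {..N} b x)\<^sup>2 \<le> (2 * C + 4 / L) * noise_size N b" if x: "x \<in> {0..L}" for N b x
  proof -
    have "comb {..N} b x = b 0 * e 0 x + comb {1..N} b x"
      unfolding comb_def by (simp add: sum.atMost_shift sum.atLeast1_atMost_eq lessThan_Suc_atMost)
    then have "(comb {..N} b x)\<^sup>2 \<le> 2 * ((b 0)\<^sup>2 * (e 0 x)\<^sup>2) + 2 * (comb {1..N} b x)\<^sup>2"
      using sum_squares_bound[of "b 0 * e 0 x" "comb {1..N} b x"] by (simp add: power2_eq_square algebra_simps)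
    also have "\<dots> \<le> 2 * ((b 0)\<^sup>2 * (2 / L)) + 2 * (C * sob N 1 b)"
      using C(2)[OF x] e_bound_sq[OF x] by (intro add_mono mult_left_mono) auto
    also have "\<dots> \<le> (2 * C + 4 / L) * noise_size N b"
      using C(1) L_pos sob_nonneg[of N 1 b]
      by (simp add: noise_size_def algebra_simps add_nonneg_nonneg divide_nonneg_pos)
    finally show ?thesis .
  qed
  moreover have "0 \<le> 2 * C + 4 / L" using C L_pos by simp
  ultimately show ?thesis by blast
qed

text \<open>First a priori estimate: testing with \<open>A\<^sup>-\<^sup>1 y\<close> leaves \<open>\<langle>f(u), y\<rangle>\<close>, which is coercive because
  \<open>f\<close> is cubic with positive leading coefficient.\<close>

lemma drift_pairing_lower:
  "\<exists>C\<ge>0. \<forall>N a b. - C * (noise_size N b)\<^sup>2 \<le> (\<Sum>j=1..N. a j * drift N a b j)"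
proof -
  obtain C where C: "0 \<le> C" "\<And>N b x. x \<in> {0..L} \<Longrightarrow> (comb {..N} b x)\<^sup>2 \<le> C * noise_size N b"
    using noise_sup by auto
  have "- (L * \<kappa> * (1 + C\<^sup>2)) * (noise_size N b)\<^sup>2 \<le> (\<Sum>j=1..N. a j * drift N a b j)" for N a b
  proof -
    define \<beta> where "\<beta> = noise_size N b"
    have \<beta>: "1 \<le> \<beta>" "1 \<le> \<beta>\<^sup>2" using noise_size_ge_1 by (auto simp: \<beta>_def)
    have "- (L * \<kappa> * (1 + C\<^sup>2)) * \<beta>\<^sup>2 = intO (\<lambda>x. - \<kappa> * (\<beta>\<^sup>2 + (C * \<beta>)\<^sup>2))"
      by (subst intO_const) (simp add: power2_eq_square algebra_simps)
    also have "\<dots> \<le> intO (\<lambda>x. f (u_fun N a b x) * comb {1..N} a x)"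
    proof (intro intO_mono continuous_intros fu_cont)
      fix x assume x: "x \<in> {0..L}"
      have "(comb {..N} b x)^4 = ((comb {..N} b x)\<^sup>2)\<^sup>2" by simp
      also have "\<dots> \<le> (C * \<beta>)\<^sup>2" using C(2)[OF x] by (intro power_mono) (auto simp: \<beta>_def)
      finally have "1 + (comb {..N} b x)^4 \<le> \<beta>\<^sup>2 + (C * \<beta>)\<^sup>2" using \<beta> by (intro add_mono)
      then have "\<kappa> * (1 + (comb {..N} b x)^4) \<le> \<kappa> * (\<beta>\<^sup>2 + (C * \<beta>)\<^sup>2)"
        using \<kappa>_nonneg by (rule mult_left_mono)
      moreover have "- (\<kappa> * (1 + (comb {..N} b x)^4)) \<le> f (u_fun N a b x) * comb {1..N} a x"
        using f_coercive[of "comb {..N} b x" "u_fun N a b x"] by (simp add: u_fun_def)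
      ultimately show "- \<kappa> * (\<beta>\<^sup>2 + (C * \<beta>)\<^sup>2) \<le> f (u_fun N a b x) * comb {1..N} a x" by simp
    qed
    also have "\<dots> = (\<Sum>j=1..N. a j * drift N a b j)"
      unfolding drift_def by (rule intO_comb_mult[OF fu_cont])
    finally show ?thesis by (simp add: \<beta>_def)
  qed
  moreover have "0 \<le> L * \<kappa> * (1 + C\<^sup>2)" using L_pos \<kappa>_nonneg by simp
  ultimately show ?thesis by blast
qed

text \<open>Second a priori estimate: after integration by parts the pairing with \<open>A y\<close> is
  \<open>\<integral> f'(u) (y' + z') y'\<close>. Completing the square against \<open>f'(u) + \<kappa> \<ge> 0\<close> avoids any upper bound on
  \<open>f'(u) (y')\<^sup>2\<close>, at the price of \<open>\<integral> (1 + u\<^sup>2) (z')\<^sup>2\<close>, which Agmon's inequality and interpolation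
  reduce to \<open>\<parallel>y\<parallel>\<close> in the two norms controlled by the first estimate.\<close>

lemma drift_laplacian_pairing_lower:
  "\<exists>C\<ge>0. \<forall>N a b. - C * (sob N 1 a + (noise_size N b)\<^sup>2 + (noise_size N b)^4 * sob N (-1) a)
      \<le> (\<Sum>j=1..N. (lam j * a j) * drift N a b j)"
proof -
  obtain C where C: "0 \<le> C" "\<And>N b x. x \<in> {0..L} \<Longrightarrow> (comb {..N} b x)\<^sup>2 \<le> C * noise_size N b"
    using noise_sup by auto
  obtain D where D: "0 \<le> D" "\<And>N a x. x \<in> {0..L} \<Longrightarrow> (comb {1..N} a x)\<^sup>2 \<le> D * sqrt (sob N 0 a * sob N 1 a)"
    using agmon by auto
  have "- (\<kappa> * (5 + 4 * D + 2 * C)) * (sob N 1 a + (noise_size N b)\<^sup>2 + (noise_size N b)^4 * sob N (-1) a)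
      \<le> (\<Sum>j=1..N. (lam j * a j) * drift N a b j)" for N a b
  proof -
    define \<beta> where "\<beta> = noise_size N b"
    have \<beta>: "1 \<le> \<beta>" using noise_size_ge_1 by (auto simp: \<beta>_def)
    define R where "R = sqrt (sob N 0 a * sob N 1 a)"
    have R: "0 \<le> R" by (simp add: R_def)
    define y where "y = comb {1..N} a"
    define y' where "y' = dcomb {1..N} a"
    define z' where "z' = dcomb {..N} b"
    define u where "u = u_fun N a b"
    define E where "E = 3 + 2 * (D * R) + 2 * (C * \<beta>)"
    have E: "0 \<le> E" using C(1) D(1) R \<beta> by (simp add: E_def)
    have u_deriv: "(u has_real_derivative y' x + z' x) (at x within {0..L})" if "x \<in> {0..L}" for x
      unfolding u_def u_fun_def y'_def z'_def using that by (auto intro!: derivative_eq_intros comb_deriv)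
    have fu_deriv: "((\<lambda>x. f (u x)) has_real_derivative f' (u x) * (y' x + z' x)) (at x within {0..L})"
      if "x \<in> {0..L}" for x
      using DERIV_chain2[OF f_deriv u_deriv[OF that]] .
    have cont: "continuous_on {0..L} y'" "continuous_on {0..L} z'" "continuous_on {0..L} (\<lambda>x. f (u x))"
       "continuous_on {0..L} (\<lambda>x. f' (u x))"
      unfolding y'_def z'_def u_def by (intro continuous_intros fu_cont f'u_cont)+
    have "intO (\<lambda>x. f' (u x) * (y' x + z' x) * y' x + f (u x) * - comb {1..N} (\<lambda>j. lam j * a j) x)
        = f (u L) * y' L - f (u 0) * y' 0"
      using L_pos fu_deriv dcomb_deriv[of _ "{1..N}" a] unfolding y'_def[symmetric]
      by (intro LINT_deriv) (auto intro!: continuous_intros cont derivative_eq_intros)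
    also have "\<dots> = 0" by (simp add: y'_def)
    finally have "intO (\<lambda>x. f' (u x) * (y' x + z' x) * y' x) = intO (\<lambda>x. f (u x) * comb {1..N} (\<lambda>j. lam j * a j) x)"
      by (subst (asm) intO_add) (auto intro!: continuous_intros cont)
    also have "\<dots> = (\<Sum>j=1..N. (lam j * a j) * drift N a b j)"
      unfolding drift_def u_def by (rule intO_comb_mult[OF fu_cont])
    finally have parts: "(\<Sum>j=1..N. (lam j * a j) * drift N a b j) = intO (\<lambda>x. f' (u x) * (y' x + z' x) * y' x)" ..
    have "- (\<kappa> * (E * \<beta> + 2 * sob N 1 a)) \<le> intO (\<lambda>x. - (\<kappa> * E) * (z' x)\<^sup>2 + - (2 * \<kappa>) * (y' x)\<^sup>2)"
    proof -
      have "intO (\<lambda>x. (z' x)\<^sup>2) = sob N 1 b"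
        unfolding z'_def by (subst intO_dcomb_sq) 
          (auto simp: sob_1 sum.atMost_shift sum.atLeast1_atMost_eq lessThan_Suc_atMost)
      also have "\<dots> \<le> \<beta>" by (simp add: \<beta>_def noise_size_def)
      finally have z: "\<kappa> * E * intO (\<lambda>x. (z' x)\<^sup>2) \<le> \<kappa> * E * \<beta>"
        using E \<kappa>_nonneg by (intro mult_left_mono) auto
      have "intO (\<lambda>x. - (\<kappa> * E) * (z' x)\<^sup>2 + - (2 * \<kappa>) * (y' x)\<^sup>2)
          = - (\<kappa> * E) * intO (\<lambda>x. (z' x)\<^sup>2) + - (2 * \<kappa>) * intO (\<lambda>x. (y' x)\<^sup>2)"
        by (subst intO_add) (auto intro!: continuous_intros cont)
      also have "intO (\<lambda>x. (y' x)\<^sup>2) = sob N 1 a" unfolding y'_def by (subst intO_dcomb_sq) (auto simp: sob_1)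
      finally show ?thesis using z by (simp add: algebra_simps)
    qed
    also have "\<dots> \<le> intO (\<lambda>x. f' (u x) * (y' x + z' x) * y' x)"
    proof (intro intO_mono continuous_intros cont)
      fix x assume x: "x \<in> {0..L}"
      define q where "q = f' (u x) + \<kappa>"
      have q0: "0 \<le> q" using f'_lower[of "u x"] by (simp add: q_def)
      have "(u x)\<^sup>2 \<le> 2 * (comb {1..N} a x)\<^sup>2 + 2 * (comb {..N} b x)\<^sup>2"
        unfolding u_def u_fun_def using sum_squares_bound[of "comb {1..N} a x" "comb {..N} b x"]
        by (simp add: power2_eq_square algebra_simps)
      also have "\<dots> \<le> 2 * (D * R) + 2 * (C * \<beta>)"
        using C(2)[OF x, of N b] D(2)[OF x, of N a] by (auto simp: R_def \<beta>_def)
      finally have "1 + (u x)\<^sup>2 + 1 + 1 \<le> E" by (simp add: E_def)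
      then have "\<kappa> * (1 + (u x)\<^sup>2 + 1 + 1) \<le> \<kappa> * E" using \<kappa>_nonneg by (rule mult_left_mono)
      then have qE: "q + \<kappa> \<le> \<kappa> * E"
        using f'_growth[of "u x"] by (simp add: q_def algebra_simps)
      \<comment> \<open>two completed squares, one for each sign in \<open>f'(u) = q - \<kappa>\<close>\<close>
      have "0 \<le> q * (y' x + z' x / 2)\<^sup>2 + \<kappa> * (y' x - z' x / 2)\<^sup>2" using q0 \<kappa>_nonneg by simp
      also have "\<dots> = f' (u x) * (y' x + z' x) * y' x + (q + \<kappa>) * (z' x)\<^sup>2 / 4 + 2 * \<kappa> * (y' x)\<^sup>2"
        by (simp add: q_def power2_eq_square algebra_simps)
      also have "(q + \<kappa>) * (z' x)\<^sup>2 / 4 \<le> \<kappa> * E * (z' x)\<^sup>2"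
      proof -
        have "(q + \<kappa>) * ((z' x)\<^sup>2 / 4) \<le> \<kappa> * E * (z' x)\<^sup>2"
          using qE q0 \<kappa>_nonneg by (intro mult_mono) auto
        then show ?thesis by simp
      qed
      finally show "- (\<kappa> * E) * (z' x)\<^sup>2 + - (2 * \<kappa>) * (y' x)\<^sup>2 \<le> f' (u x) * (y' x + z' x) * y' x"
        by (simp add: algebra_simps)
    qed
    finally have main: "- (\<kappa> * (E * \<beta> + 2 * sob N 1 a)) \<le> (\<Sum>j=1..N. (lam j * a j) * drift N a b j)"
      unfolding parts .
    define S where "S = sob N 1 a + \<beta>\<^sup>2 + \<beta>^4 * sob N (-1) a"
    \<comment> \<open>\<open>\<beta> \<parallel>y\<parallel> \<parallel>y'\<parallel>\<close> is absorbed by Young's inequality twice, interpolating \<open>\<parallel>y\<parallel>\<close> between \<open>\<bbbH>\<^sup>-\<^sup>1\<close> and \<open>\<bbbH>\<^sup>1\<close>\<close>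
    have "R * \<beta> \<le> S"
    proof -
      have "2 * (R * \<beta>) \<le> \<beta>\<^sup>2 * sob N 0 a + sob N 1 a"
        unfolding R_def using \<beta> sum_squares_bound[of "\<beta> * sqrt (sob N 0 a)" "sqrt (sob N 1 a)"]
        by (simp add: power_mult_distrib real_sqrt_mult mult_ac)
      moreover have "2 * (\<beta>\<^sup>2 * sob N 0 a) \<le> \<beta>^4 * sob N (-1) a + sob N 1 a"
      proof -
        have "sob N 0 a \<le> sqrt (sob N (-1) a * sob N 1 a)"
          using sob_interpolation[of N 0 a 1] by (simp add: real_le_rsqrt)
        then have "2 * (\<beta>\<^sup>2 * sob N 0 a) \<le> 2 * (\<beta>\<^sup>2 * sqrt (sob N (-1) a * sob N 1 a))"
          by (intro mult_left_mono) auto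
        also have "\<dots> \<le> (\<beta>\<^sup>2 * sqrt (sob N (-1) a))\<^sup>2 + (sqrt (sob N 1 a))\<^sup>2"
          using sum_squares_bound[of "\<beta>\<^sup>2 * sqrt (sob N (-1) a)" "sqrt (sob N 1 a)"]
          by (simp add: real_sqrt_mult mult_ac)
        also have "\<dots> = \<beta>^4 * sob N (-1) a + sob N 1 a"
          by (simp add: power_mult_distrib)
        finally show ?thesis .
      qed
      moreover have "0 \<le> \<beta>\<^sup>2" "0 \<le> \<beta>^4 * sob N (-1) a" "0 \<le> sob N 1 a" using \<beta> by auto
      ultimately show ?thesis unfolding S_def by linarith
    qed
    moreover have "\<beta>\<^sup>2 \<le> S" "\<beta> \<le> S" "sob N 1 a \<le> S"
    proof -
      have "0 \<le> \<beta>^4 * sob N (-1) a" using \<beta> by auto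
      then show "\<beta>\<^sup>2 \<le> S" "sob N 1 a \<le> S" by (auto simp: S_def)
      moreover have "\<beta> * 1 \<le> \<beta> * \<beta>" using \<beta> by (intro mult_left_mono) auto
      ultimately show "\<beta> \<le> S" by (simp add: power2_eq_square)
    qed
    moreover have "E * \<beta> = 3 * \<beta> + 2 * D * (R * \<beta>) + 2 * C * \<beta>\<^sup>2"
      by (simp add: E_def power2_eq_square algebra_simps)
    moreover have "D * (R * \<beta>) \<le> D * S" "C * \<beta>\<^sup>2 \<le> C * S"
      using \<open>R * \<beta> \<le> S\<close> \<open>\<beta>\<^sup>2 \<le> S\<close> C(1) D(1) by (auto intro!: mult_left_mono)
    ultimately have "E * \<beta> + 2 * sob N 1 a \<le> 3 * S + 2 * (D * S) + 2 * (C * S) + 2 * S"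
      by (simp add: mult.assoc)
    also have "\<dots> \<le> (5 + 4 * D + 2 * C) * S"
      using D(1) \<beta> by (simp add: algebra_simps S_def)
    finally have "\<kappa> * (E * \<beta> + 2 * sob N 1 a) \<le> \<kappa> * ((5 + 4 * D + 2 * C) * S)"
      using \<kappa>_nonneg by (rule mult_left_mono)
    then show ?thesis using main by (simp add: S_def \<beta>_def mult.assoc)
  qed
  moreover have "0 \<le> \<kappa> * (5 + 4 * D + 2 * C)" using C D \<kappa>_nonneg by simp
  ultimately show ?thesis by blast
qed

text \<open>Bessel's inequality bounds the projected drift by \<open>\<integral> f(u)\<^sup>2\<close>, and the noise part of \<open>u\<^sup>6\<close> by its supremum. What
  remains is \<open>\<integral> y\<^sup>6\<close>, estimated below in two ways, according to the regularity of \<open>y\<close> at hand.\<close>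

lemma drift_sq_le:
  "\<exists>C\<ge>0. \<forall>N a b. (\<Sum>j=1..N. (drift N a b j)\<^sup>2) \<le> C * ((noise_size N b)^3 + intO (\<lambda>x. (comb {1..N} a x)^6))"
proof -
  obtain C where C: "0 \<le> C" "\<And>N b x. x \<in> {0..L} \<Longrightarrow> (comb {..N} b x)\<^sup>2 \<le> C * noise_size N b"
    using noise_sup by auto
  define K where "K = \<kappa> * (L * (1 + 32 * C^3) + 32)"
  have "(\<Sum>j=1..N. (drift N a b j)\<^sup>2) \<le> K * ((noise_size N b)^3 + intO (\<lambda>x. (comb {1..N} a x)^6))" for N a b
  proof -
    define \<beta> where "\<beta> = noise_size N b"
    have \<beta>: "1 \<le> \<beta>" "1 \<le> \<beta>^3" using noise_size_ge_1 by (auto simp: \<beta>_def)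
    define I where "I = intO (\<lambda>x. (comb {1..N} a x)^6)"
    have I: "0 \<le> I" unfolding I_def by (intro Bochner_Integration.integral_nonneg) (simp add: zero_le_even_power)
    have "(\<Sum>j=1..N. (drift N a b j)\<^sup>2) \<le> intO (\<lambda>x. (f (u_fun N a b x))\<^sup>2)"
      unfolding drift_def by (intro bessel fu_cont) simp
    also have "\<dots> \<le> intO (\<lambda>x. \<kappa> * (1 + 32 * C^3) * \<beta>^3 + \<kappa> * 32 * (comb {1..N} a x)^6)"
    proof (intro intO_mono continuous_intros fu_cont)
      fix x assume x: "x \<in> {0..L}"
      define y z where "y = comb {1..N} a x" and "z = comb {..N} b x"
      have six: "(y + z)^6 \<le> 32 * (y^6 + z^6)"
      proof -
        have "(y + z)^6 = ((y + z)\<^sup>2)^3" by (simp flip: power_mult)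
        also have "\<dots> \<le> (2 * y\<^sup>2 + 2 * z\<^sup>2)^3"
        proof (rule power_mono)
          show "(y + z)\<^sup>2 \<le> 2 * y\<^sup>2 + 2 * z\<^sup>2"
            using sum_squares_bound[of y z] by (simp add: power2_eq_square algebra_simps)
        qed simp
        also have "\<dots> = 8 * (y\<^sup>2 + z\<^sup>2)^3"
          by (simp add: power3_eq_cube algebra_simps)
        also have "(y\<^sup>2 + z\<^sup>2)^3 \<le> 4 * ((y\<^sup>2)^3 + (z\<^sup>2)^3)"
        proof -
          have "0 \<le> 3 * (y\<^sup>2 + z\<^sup>2) * (y\<^sup>2 - z\<^sup>2)\<^sup>2" by simp
          also have "\<dots> = 4 * ((y\<^sup>2)^3 + (z\<^sup>2)^3) - (y\<^sup>2 + z\<^sup>2)^3"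
            by (simp add: power2_eq_square power3_eq_cube algebra_simps)
          finally show ?thesis by simp
        qed
        finally show ?thesis by (simp flip: power_mult)
      qed
      have "z^6 = (z\<^sup>2)^3" by (simp flip: power_mult)
      also have "\<dots> \<le> (C * \<beta>)^3" using C(2)[OF x] by (intro power_mono) (auto simp: z_def \<beta>_def)
      finally have "z^6 \<le> C^3 * \<beta>^3" by (simp add: power_mult_distrib)
      then have "1 + (y + z)^6 \<le> (1 + 32 * C^3) * \<beta>^3 + 32 * y^6"
        using six \<beta>(2) unfolding distrib_left distrib_right mult_1 mult.assoc by linarith
      then have "\<kappa> * (1 + (y + z)^6) \<le> \<kappa> * ((1 + 32 * C^3) * \<beta>^3 + 32 * y^6)"
        using \<kappa>_nonneg by (rule mult_left_mono)
      then show "(f (u_fun N a b x))\<^sup>2 \<le> \<kappa> * (1 + 32 * C^3) * \<beta>^3 + \<kappa> * 32 * (comb {1..N} a x)^6"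
        using f_growth[of "y + z"] by (simp add: u_fun_def y_def z_def algebra_simps)
    qed
    also have "\<dots> = L * (\<kappa> * (1 + 32 * C^3) * \<beta>^3) + \<kappa> * 32 * I"
      unfolding I_def
      by (subst intO_add, (intro continuous_intros)+) (simp only: intO_const integral_mult_right_zero mult_ac)
    also have "\<dots> \<le> K * \<beta>^3 + K * I"
    proof (intro add_mono)
      show "L * (\<kappa> * (1 + 32 * C^3) * \<beta>^3) \<le> K * \<beta>^3"
        using \<kappa>_nonneg \<beta> by (simp add: K_def algebra_simps)
      show "\<kappa> * 32 * I \<le> K * I"
        using \<kappa>_nonneg I L_pos C by (intro mult_right_mono) (auto simp: K_def algebra_simps)
    qed
    finally show ?thesis by (simp add: \<beta>_def I_def algebra_simps)
  qed
  moreover have "0 \<le> K" using C L_pos \<kappa>_nonneg by (simp add: K_def)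
  ultimately show ?thesis by blast
qed

text \<open>From \<open>\<integral> y\<^sup>6 \<le> \<parallel>y\<parallel>\<^sub>\<infinity>\<^sup>4 \<parallel>y\<parallel>\<^sup>2\<close> and Agmon's inequality; this form is square integrable in time under the
  energy bounds.\<close>

lemma drift_sq_le_energy:
  "\<exists>C\<ge>0. \<forall>N a b. (\<Sum>j=1..N. (drift N a b j)\<^sup>2) \<le> C * ((noise_size N b)^3 + (sob N 0 a)\<^sup>2 * sob N 1 a)"
proof -
  obtain C where C: "0 \<le> C" "\<And>N a b. (\<Sum>j=1..N. (drift N a b j)\<^sup>2) \<le> C * ((noise_size N b)^3 + intO (\<lambda>x. (comb {1..N} a x)^6))"
    using drift_sq_le by auto
  obtain D where D: "0 \<le> D" "\<And>N a x. x \<in> {0..L} \<Longrightarrow> (comb {1..N} a x)\<^sup>2 \<le> D * sqrt (sob N 0 a * sob N 1 a)"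
    using agmon by auto
  have "(\<Sum>j=1..N. (drift N a b j)\<^sup>2) \<le> C * (1 + D\<^sup>2) * ((noise_size N b)^3 + (sob N 0 a)\<^sup>2 * sob N 1 a)" for N a b
  proof -
    have "intO (\<lambda>x. (comb {1..N} a x)^6) \<le> intO (\<lambda>x. D\<^sup>2 * (sob N 0 a * sob N 1 a) * (comb {1..N} a x)\<^sup>2)"
    proof (intro intO_mono continuous_intros)
      fix x assume x: "x \<in> {0..L}"
      have "((comb {1..N} a x)\<^sup>2)\<^sup>2 \<le> (D * sqrt (sob N 0 a * sob N 1 a))\<^sup>2"
        using D(2)[OF x] by (intro power_mono) auto
      also have "\<dots> = D\<^sup>2 * (sob N 0 a * sob N 1 a)" by (simp add: power_mult_distrib)
      finally have "((comb {1..N} a x)\<^sup>2)\<^sup>2 * (comb {1..N} a x)\<^sup>2 \<le> D\<^sup>2 * (sob N 0 a * sob N 1 a) * (comb {1..N} a x)\<^sup>2"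
        by (intro mult_right_mono) auto
      then show "(comb {1..N} a x)^6 \<le> D\<^sup>2 * (sob N 0 a * sob N 1 a) * (comb {1..N} a x)\<^sup>2"
        by (simp flip: power_mult power_add)
    qed
    also have "\<dots> = D\<^sup>2 * ((sob N 0 a)\<^sup>2 * sob N 1 a)"
      by (simp only: integral_mult_right_zero intO_comb_sq finite_atLeastAtMost sob_0[symmetric])
         (simp add: power2_eq_square)
    finally have "(noise_size N b)^3 + intO (\<lambda>x. (comb {1..N} a x)^6)
        \<le> (1 + D\<^sup>2) * ((noise_size N b)^3 + (sob N 0 a)\<^sup>2 * sob N 1 a)"
      using noise_size_ge_1[of N b] by (simp add: algebra_simps add_increasing)
    then show ?thesis
      using C(2)[of N a b] C(1) by (simp add: mult.assoc order_trans[OF _ mult_left_mono])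
  qed
  moreover have "0 \<le> C * (1 + D\<^sup>2)" using C by simp
  ultimately show ?thesis by blast
qed

text \<open>Once \<open>y\<close> is bounded in \<open>\<bbbH>\<^sup>s\<close> with \<open>s > 1/2\<close> uniformly in time, this form gives every integrability in time.\<close>

lemma drift_sq_le_sobolev:
  assumes "1 / 2 < s"
  shows "\<exists>C\<ge>0. \<forall>N a b. (\<Sum>j=1..N. (drift N a b j)\<^sup>2) \<le> C * ((noise_size N b)^3 + (sob N s a)^3)"
proof -
  obtain C where C: "0 \<le> C" "\<And>N a b. (\<Sum>j=1..N. (drift N a b j)\<^sup>2) \<le> C * ((noise_size N b)^3 + intO (\<lambda>x. (comb {1..N} a x)^6))"
    using drift_sq_le by auto
  obtain D where D: "0 \<le> D" "\<And>N a x. x \<in> {0..L} \<Longrightarrow> (comb {1..N} a x)\<^sup>2 \<le> D * sob N s a"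
    using sobolev_sup[OF assms] by auto
  have "(\<Sum>j=1..N. (drift N a b j)\<^sup>2) \<le> C * (1 + L * D^3) * ((noise_size N b)^3 + (sob N s a)^3)" for N a b
  proof -
    have "intO (\<lambda>x. (comb {1..N} a x)^6) \<le> intO (\<lambda>x. (D * sob N s a)^3)"
    proof (intro intO_mono continuous_intros)
      fix x assume x: "x \<in> {0..L}"
      have "((comb {1..N} a x)\<^sup>2)^3 \<le> (D * sob N s a)^3"
        using D(2)[OF x] by (intro power_mono) auto
      then show "(comb {1..N} a x)^6 \<le> (D * sob N s a)^3"
        by (simp flip: power_mult)
    qed
    also have "\<dots> = L * D^3 * (sob N s a)^3"
      by (simp only: intO_const) (simp add: power_mult_distrib)
    finally have "(noise_size N b)^3 + intO (\<lambda>x. (comb {1..N} a x)^6)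
        \<le> (1 + L * D^3) * ((noise_size N b)^3 + (sob N s a)^3)"
      using noise_size_ge_1[of N b] L_pos D(1) by (simp add: algebra_simps add_increasing)
    then show ?thesis
      using C(2)[of N a b] C(1) by (simp add: mult.assoc order_trans[OF _ mult_left_mono])
  qed
  moreover have "0 \<le> C * (1 + L * D^3)" using C D L_pos by simp
  ultimately show ?thesis by blast
qed

end

section \<open>The implicit scheme in Fourier coordinates\<close>

text \<open>A Riemann sum for \<open>\<integral>\<^sub>0\<^sup>T t\<^sup>-\<^sup>\<theta> dt\<close>. Each term is at most the increment of \<open>t\<^sup>1\<^sup>-\<^sup>\<theta> / (1 - \<theta>)\<close>, which is the weighted
  inequality of the arithmetic and geometric means.\<close>

lemma sum_inverse_powr_le:
  fixes \<theta> h T :: real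
  assumes "0 \<le> \<theta>" "\<theta> < 1" "0 < h" "real k * h \<le> T"
  shows "(\<Sum>n=1..k. h * (real n * h) powr - \<theta>) \<le> T powr (1 - \<theta>) / (1 - \<theta>)"
proof -
  have step: "(1 - \<theta>) * (h * (real (Suc n) * h) powr - \<theta>)
      \<le> (real (Suc n) * h) powr (1 - \<theta>) - (real n * h) powr (1 - \<theta>)" for n
  proof -
    define x where "x = real (Suc n) * h"
    have x: "0 < x" using assms by (simp add: x_def)
    have "(real n * h) powr (1 - \<theta>) * x powr \<theta> \<le> (1 - \<theta>) * (real n * h) + \<theta> * x"
    proof (cases "n = 0")
      case False
      then show ?thesis using assms x by (intro Youngs_inequality_0) auto
    qed (use assms x in simp)
    also have "\<dots> = x - (1 - \<theta>) * h" by (simp add: x_def algebra_simps)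
    finally have "(real n * h) powr (1 - \<theta>) * x powr \<theta> * x powr - \<theta> \<le> (x - (1 - \<theta>) * h) * x powr - \<theta>"
      by (rule mult_right_mono) simp
    moreover have "x powr \<theta> * x powr - \<theta> = 1"
      using x by (simp flip: powr_add)
    moreover have "x * x powr - \<theta> = x powr (1 - \<theta>)"
      using x by (simp add: powr_mult_base diff_conv_add_uminus del: add_uminus_conv_diff)
    ultimately have "(real n * h) powr (1 - \<theta>) \<le> x powr (1 - \<theta>) - (1 - \<theta>) * (h * x powr - \<theta>)"
      by (simp add: left_diff_distrib mult.assoc)
    then show ?thesis unfolding x_def by simp
  qed
  have "(1 - \<theta>) * (\<Sum>n=1..k. h * (real n * h) powr - \<theta>) \<le> (real k * h) powr (1 - \<theta>)"
  proof (induction k)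
    case (Suc k)
    then show ?case using step[of k] by (simp add: algebra_simps)
  qed simp
  also have "\<dots> \<le> T powr (1 - \<theta>)" using assms by (intro powr_mono2) auto
  finally show ?thesis using assms by (simp add: field_simps)
qed

lemma young_power:
  fixes x y :: real
  assumes "0 \<le> x" "0 \<le> y" "2 \<le> m"
  shows "x * y \<le> x powr (real m / (real m - 1)) + y ^ m"
proof (cases "x = 0 \<or> y = 0")
  case True
  then show ?thesis using assms by auto
next
  case False
  then have xy: "0 < x" "0 < y" using assms by auto
  define q where "q = real m / (real m - 1)"
  have m: "0 < real m - 1" using assms by linarith
  show ?thesis
  proof (cases "y \<le> x powr (1 / (real m - 1))")
    case True
    then have "x * y \<le> x * x powr (1 / (real m - 1))" using assms by (intro mult_left_mono)
    also have "\<dots> = x powr q" using xy m by (simp add: powr_mult_base q_def field_simps)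
    finally show ?thesis using assms by (simp add: q_def add_increasing2)
  next
    case False
    have "x = (x powr (1 / (real m - 1))) powr (real m - 1)"
      using xy m by (simp add: powr_powr)
    also have "\<dots> \<le> y powr (real m - 1)" using False m by (intro powr_mono2) auto
    also have "\<dots> = y ^ (m - 1)" using xy assms by (simp add: of_nat_diff flip: powr_realpow)
    finally have "x * y \<le> y ^ (m - 1) * y" using assms by (intro mult_right_mono)
    also have "\<dots> = y ^ m" using assms by (simp flip: power_Suc2)
    finally show ?thesis by (simp add: add_increasing)
  qed
qed

text \<open>With \<open>x = h \<lambda>\<^sup>2\<close>, the number \<open>r\<close> is the resolvent \<open>(1 + h A\<^sup>2)\<^sup>-\<^sup>1\<close> on one mode. The last two bounds are the
  discrete versions of \<open>e\<^sup>-\<^sup>y \<le> y\<^sup>-\<^sup>\<theta>\<close> (smoothing) and \<open>(1 - e\<^sup>-\<^sup>y)\<^sup>2 \<le> y\<^sup>\<theta>\<close> (continuity in time); both follow from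
  Bernoulli's inequality, and \<open>\<theta> \<le> 1\<close> is what makes the interpolation with the trivial bound possible.\<close>

lemma resolvent_power_bounds:
  fixes x \<theta> :: real
  assumes "0 \<le> x" "0 \<le> \<theta>" "\<theta> \<le> 1"
  defines "r \<equiv> 1 / (1 + x)"
  shows "0 < r" "r \<le> 1" "n \<noteq> 0 \<Longrightarrow> 0 < x \<Longrightarrow> r ^ n \<le> (real n * x) powr - \<theta>"
    "(1 - r ^ n)\<^sup>2 \<le> (real n * x) powr \<theta>"
proof -
  show r: "0 < r" "r \<le> 1" using assms by (auto simp: r_def)
  show "r ^ n \<le> (real n * x) powr - \<theta>" if "n \<noteq> 0" "0 < x"
  proof -
    have nx: "0 < real n * x" using that by simp
    have "(real n * x) powr \<theta> \<le> 1 + real n * x"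
    proof (cases "real n * x \<le> 1")
      case True
      then have "(real n * x) powr \<theta> \<le> 1" using nx assms by (intro powr_le1) auto
      then show ?thesis using nx by simp
    next
      case False
      then have "(real n * x) powr \<theta> \<le> (real n * x) powr 1" using assms by (intro powr_mono) auto
      then show ?thesis using nx by simp
    qed
    also have "\<dots> \<le> (1 + x) ^ n" using assms by (intro Bernoulli_inequality) auto
    finally have "1 / (1 + x) ^ n \<le> 1 / (real n * x) powr \<theta>"
      using nx assms that by (intro divide_left_mono mult_pos_pos zero_less_power) auto
    then show ?thesis by (simp add: r_def power_one_over powr_minus_divide)
  qed
  have rn: "0 \<le> 1 - r ^ n" "1 - r ^ n \<le> 1" using r by (auto simp: power_le_one)
  have "1 - r ^ n \<le> real n * x"
  proof -
    have "1 + real n * (r - 1) \<le> r ^ n"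
      using Bernoulli_inequality[of "r - 1" n] r by simp
    moreover have "1 - r \<le> x"
    proof -
      have "1 - r = x / (1 + x)" using assms by (simp add: r_def field_simps)
      also have "\<dots> \<le> x" using assms by (simp add: divide_le_eq algebra_simps)
      finally show ?thesis .
    qed
    then have "real n * (1 - r) \<le> real n * x" by (intro mult_left_mono) auto
    ultimately show ?thesis by (simp add: algebra_simps)
  qed
  have "(1 - r ^ n)\<^sup>2 \<le> 1 - r ^ n"
    using rn mult_right_mono[OF rn(2) rn(1)] by (simp add: power2_eq_square)
  also have "\<dots> \<le> (real n * x) powr \<theta>"
  proof (cases "real n * x \<le> 1")
    case True
    show ?thesis
    proof (cases "real n * x = 0")
      case True
      then have "r ^ n = 1" using \<open>1 - r ^ n \<le> real n * x\<close> rn(1) by linarith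
      then show ?thesis by simp
    next
      case False
      then have "(real n * x) powr 1 \<le> (real n * x) powr \<theta>"
        using True assms by (intro powr_mono') auto
      then show ?thesis using \<open>1 - r ^ n \<le> real n * x\<close> assms by simp
    qed
  next
    case False
    then have "1 \<le> (real n * x) powr \<theta>" using assms by (intro ge_one_powr_ge_zero) auto
    then show ?thesis using rn by simp
  qed
  finally show "(1 - r ^ n)\<^sup>2 \<le> (real n * x) powr \<theta>" .
qed

lemma discrete_duhamel:
  fixes x g :: "nat \<Rightarrow> real"
  assumes "\<And>k. k < K \<Longrightarrow> x (Suc k) = r * (x k - c * g (Suc k))" and "k1 \<le> k" "k \<le> K"
  shows "x k = r ^ (k - k1) * x k1 - (\<Sum>i=Suc k1..k. c * (r ^ (Suc k - i) * g i))"
  using assms(2,3)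
proof (induction k rule: dec_induct)
  case (step k)
  have "(\<Sum>i=Suc k1..Suc k. c * (r ^ (Suc (Suc k) - i) * g i))
      = r * (\<Sum>i=Suc k1..k. c * (r ^ (Suc k - i) * g i)) + c * (r * g (Suc k))"
    using step by (simp add: sum_distrib_left Suc_diff_le algebra_simps)
  moreover have "x (Suc k) = r * (r ^ (k - k1) * x k1) - r * (\<Sum>i=Suc k1..k. c * (r ^ (Suc k - i) * g i)) - c * (r * g (Suc k))"
    using step assms(1)[of k] by (simp add: right_diff_distrib)
  ultimately show ?case
    using step by (simp add: Suc_diff_le)
qed simp

text \<open>A geometric sum, the discrete counterpart of \<open>\<integral> \<lambda>\<^sup>2 exp (- t \<lambda>\<^sup>2) dt \<le> 1\<close>.\<close>

lemma sum_resolvent_powers_le: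
  fixes d :: real
  assumes "0 \<le> d"
  shows "(\<Sum>i=Suc k1..k. d * (1 / (1 + d)) ^ (Suc k - i)) \<le> 1"
proof (cases "k1 \<le> k")
  case True
  define r where "r = 1 / (1 + d)"
  have r: "0 \<le> r" "d * r = 1 - r" using assms by (auto simp: r_def field_simps)
  have "(\<Sum>i=Suc k1..k. d * r ^ (Suc k - i)) = 1 - r ^ (k - k1)"
    using True
  proof (induction k rule: dec_induct)
    case (step k)
    have "(\<Sum>i=Suc k1..Suc k. d * r ^ (Suc (Suc k) - i)) = r * (\<Sum>i=Suc k1..k. d * r ^ (Suc k - i)) + d * r"
      using step by (simp add: sum_distrib_left Suc_diff_le algebra_simps)
    also have "\<dots> = 1 - r * r ^ (k - k1)" using step r by (simp add: right_diff_distrib)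
    finally show ?case using step by (simp add: Suc_diff_le)
  qed simp
  then show ?thesis using r by (simp add: r_def)
qed simp

text \<open>The forcing part of the mild solution. One factor \<open>r\<^sup>n\<close> is spent on
  \<open>\<Sum> h l\<^sup>2 r\<^sup>n \<le> 1\<close>, the other one remains as a smoothing weight.\<close>

lemma duhamel_sum_sq_le:
  fixes h l :: real
  assumes "0 < h"
  defines "r \<equiv> 1 / (1 + h * l\<^sup>2)"
  shows "(\<Sum>i=Suc k1..k. h * l * (r ^ (Suc k - i) * g i))\<^sup>2 \<le> (\<Sum>i=Suc k1..k. h * r ^ (Suc k - i) * (g i)\<^sup>2)"
proof -
  have r: "0 < r" using assms by (simp add: r_def add_pos_nonneg)
  have "(\<Sum>i=Suc k1..k. h * l * (r ^ (Suc k - i) * g i))\<^sup>2 = (\<Sum>i=Suc k1..k. (h * r ^ (Suc k - i)) * (l * g i))\<^sup>2"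
    by (simp add: mult_ac)
  also have "\<dots> \<le> (\<Sum>i=Suc k1..k. (h * r ^ (Suc k - i)) * l\<^sup>2) * (\<Sum>i=Suc k1..k. (h * r ^ (Suc k - i)) * (g i)\<^sup>2)"
    using assms r by (intro Cauchy_Schwarz_weighted) auto
  also have "\<dots> \<le> 1 * (\<Sum>i=Suc k1..k. (h * r ^ (Suc k - i)) * (g i)\<^sup>2)"
    using sum_resolvent_powers_le[where d = "h * l\<^sup>2" and ?k1.0 = k1 and k = k] assms r
    by (intro mult_right_mono sum_nonneg) (auto simp: r_def mult_ac)
  finally show ?thesis by simp
qed

context cubic_drift
begin

text \<open>The scheme for the modes \<open>1, \<dots>, N\<close>; \<open>A\<close> annihilates mode \<open>0\<close>, whose coefficient is constant in time.\<close>

definition coeff_scheme :: "nat \<Rightarrow> nat \<Rightarrow> real \<Rightarrow> (nat \<Rightarrow> nat \<Rightarrow> real) \<Rightarrow> (nat \<Rightarrow> nat \<Rightarrow> real) \<Rightarrow> bool" where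
  "coeff_scheme N K h a b \<longleftrightarrow> (\<forall>k<K. \<forall>j\<in>{1..N}.
     a (Suc k) j + h * (lam j)\<^sup>2 * a (Suc k) j + h * lam j * drift N (a (Suc k)) (b (Suc k)) j = a k j)"

text \<open>All pathwise bounds are polynomials in this number. The exponent \<open>15\<close> is the highest one that occurs: the squared
  norm of the drift contains the third power of the noise size and is used up to its fifth power.\<close>

definition noise_total :: "nat \<Rightarrow> nat \<Rightarrow> real \<Rightarrow> (nat \<Rightarrow> nat \<Rightarrow> real) \<Rightarrow> real" where
  "noise_total N K h b = 1 + (\<Sum>k=1..K. h * (noise_size N (b k))^15)"

definition drift_sq :: "nat \<Rightarrow> (nat \<Rightarrow> real) \<Rightarrow> (nat \<Rightarrow> real) \<Rightarrow> real" where
  "drift_sq N a b = (\<Sum>j=1..N. (drift N a b j)\<^sup>2)"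

definition drift_sum :: "nat \<Rightarrow> nat \<Rightarrow> nat \<Rightarrow> real \<Rightarrow> (nat \<Rightarrow> nat \<Rightarrow> real) \<Rightarrow> (nat \<Rightarrow> nat \<Rightarrow> real) \<Rightarrow> real" where
  "drift_sum m N K h a b = (\<Sum>i=1..K. h * (drift_sq N (a i) (b i))^m)"

lemma drift_sq_nonneg [simp]: "0 \<le> drift_sq N a b"
  by (simp add: drift_sq_def sum_nonneg)

text \<open>Test the scheme with \<open>A\<^sup>s y\<close> at the new time; \<open>(x + d)\<^sup>2 \<ge> x\<^sup>2 + 2 x d\<close> is the dissipativity of the implicit Euler
  method.\<close>

lemma energy_step:
  assumes "coeff_scheme N K h a b" "k < K" "0 < h"
  shows "sob N s (a (Suc k)) + 2 * h * sob N (s + 2) (a (Suc k))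
      + 2 * h * (\<Sum>j=1..N. lam j powr (s + 1) * a (Suc k) j * drift N (a (Suc k)) (b (Suc k)) j)
      \<le> sob N s (a k)"
proof -
  have "lam j powr s * (a (Suc k) j)\<^sup>2 + 2 * h * (lam j powr (s + 2) * (a (Suc k) j)\<^sup>2)
       + 2 * h * (lam j powr (s + 1) * a (Suc k) j * drift N (a (Suc k)) (b (Suc k)) j)
      \<le> lam j powr s * (a k j)\<^sup>2" if j: "j \<in> {1..N}" for j
  proof -
    define x g where "x = a (Suc k) j" and "g = drift N (a (Suc k)) (b (Suc k)) j"
    define d where "d = h * (lam j)\<^sup>2 * x + h * lam j * g"
    have l: "0 < lam j" using j lam_pos by auto
    have p: "lam j powr (s + 2) = lam j powr s * (lam j)\<^sup>2" "lam j powr (s + 1) = lam j powr s * lam j"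
      using l by (simp_all add: powr_add powr_realpow[of _ 2, simplified])
    have "a k j = x + d"
      using assms(1,2) j unfolding coeff_scheme_def x_def g_def d_def by (force simp: add.assoc)
    then have "(a k j)\<^sup>2 = x\<^sup>2 + 2 * x * d + d\<^sup>2" by (simp add: power2_eq_square algebra_simps)
    then have "x\<^sup>2 + 2 * x * d \<le> (a k j)\<^sup>2" by simp
    then have "lam j powr s * (x\<^sup>2 + 2 * x * d) \<le> lam j powr s * (a k j)\<^sup>2"
      by (rule mult_left_mono) simp
    then show ?thesis
      unfolding p x_def[symmetric] g_def[symmetric] d_def by (simp add: power2_eq_square algebra_simps)
  qed
  then have "(\<Sum>j=1..N. lam j powr s * (a (Suc k) j)\<^sup>2 + 2 * h * (lam j powr (s + 2) * (a (Suc k) j)\<^sup>2)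
       + 2 * h * (lam j powr (s + 1) * a (Suc k) j * drift N (a (Suc k)) (b (Suc k)) j))
      \<le> (\<Sum>j=1..N. lam j powr s * (a k j)\<^sup>2)"
    by (intro sum_mono)
  then show ?thesis by (simp add: sob_def sum.distrib sum_distrib_left)
qed

lemma energy_sum:
  assumes "coeff_scheme N K h a b" "0 < h" "k \<le> K"
    and "\<And>i. i < K \<Longrightarrow> - R (Suc i) \<le> (\<Sum>j=1..N. lam j powr (s + 1) * a (Suc i) j * drift N (a (Suc i)) (b (Suc i)) j)"
  shows "sob N s (a k) + 2 * (\<Sum>i=1..k. h * sob N (s + 2) (a i)) \<le> sob N s (a 0) + 2 * (\<Sum>i=1..k. h * R i)"
  using assms(3)
proof (induction k)
  case (Suc k)
  have "2 * h * (- R (Suc k)) \<le> 2 * h * (\<Sum>j=1..N. lam j powr (s + 1) * a (Suc k) j * drift N (a (Suc k)) (b (Suc k)) j)"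
    using Suc.prems assms(2) by (intro mult_left_mono assms(4)) auto
  then show ?case
    using energy_step[OF assms(1) _ assms(2), of k s] Suc by (simp add: algebra_simps)
qed simp

lemma noise_total_ge_1:
  assumes "0 < h"
  shows "1 \<le> noise_total N K h b"
proof -
  have "0 \<le> noise_size N (b i)" for i using noise_size_ge_1[of N "b i"] by simp
  then have "0 \<le> (\<Sum>k=1..K. h * (noise_size N (b k))^15)" using assms by (intro sum_nonneg) auto
  then show ?thesis by (simp add: noise_total_def)
qed

lemma noise_power_sum_le:
  assumes "0 < h" "k \<le> K" "m \<le> 15"
  shows "(\<Sum>i=1..k. h * (noise_size N (b i))^m) \<le> noise_total N K h b"
proof -
  have n0: "0 \<le> noise_size N (b i)" for i using noise_size_ge_1[of N "b i"] by simp
  have "(\<Sum>i=1..k. h * (noise_size N (b i))^m) \<le> (\<Sum>i=1..k. h * (noise_size N (b i))^15)"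
    using assms noise_size_ge_1 by (intro sum_mono mult_left_mono power_increasing) auto
  also have "\<dots> \<le> (\<Sum>i=1..K. h * (noise_size N (b i))^15)"
    using assms n0 by (intro sum_mono2) auto
  finally show ?thesis by (simp add: noise_total_def)
qed

text \<open>The case \<open>s = -1\<close>, where the nonlinear term is \<open>\<langle>f(u), y\<rangle>\<close>. Coercivity leaves only the noise on the right, so there
  is no Gronwall argument, which would destroy the integrability over the probability space.\<close>

lemma first_energy_estimate:
  "\<exists>C\<ge>0. \<forall>N K h a b. 0 < h \<longrightarrow> coeff_scheme N K h a b \<longrightarrow> sob N (-1) (a 0) \<le> M \<longrightarrow>
     (\<forall>k\<le>K. sob N (-1) (a k) \<le> C * noise_total N K h b \<and> (\<Sum>i=1..k. h * sob N 1 (a i)) \<le> C * noise_total N K h b)"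
proof -
  obtain C where C: "0 \<le> C" "\<And>N a b. - C * (noise_size N b)\<^sup>2 \<le> (\<Sum>j=1..N. a j * drift N a b j)"
    using drift_pairing_lower by auto
  have "sob N (-1) (a k) \<le> (\<bar>M\<bar> + 2 * C) * noise_total N K h b \<and> (\<Sum>i=1..k. h * sob N 1 (a i)) \<le> (\<bar>M\<bar> + 2 * C) * noise_total N K h b"
    if h: "0 < h" and sch: "coeff_scheme N K h a b" and init: "sob N (-1) (a 0) \<le> M" and k: "k \<le> K" for N K h a b k
  proof -
    have p0: "(\<Sum>j=1..N. lam j powr ((-1) + 1) * c j * d j) = (\<Sum>j=1..N. c j * d j)" for c d :: "nat \<Rightarrow> real"
      by (intro sum.cong) (use lam_pos in force)+
    have "sob N (-1) (a k) + 2 * (\<Sum>i=1..k. h * sob N (-1 + 2) (a i))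
        \<le> sob N (-1) (a 0) + 2 * (\<Sum>i=1..k. h * (C * (noise_size N (b i))\<^sup>2))"
      by (intro energy_sum[OF sch h k], unfold p0) (use C(2) in simp)
    also have "(\<Sum>i=1..k. h * (C * (noise_size N (b i))\<^sup>2)) = C * (\<Sum>i=1..k. h * (noise_size N (b i))\<^sup>2)"
      by (simp add: sum_distrib_left mult_ac)
    also have "\<dots> \<le> C * noise_total N K h b"
      using C(1) h k by (intro mult_left_mono noise_power_sum_le) auto
    also have "sob N (-1) (a 0) \<le> \<bar>M\<bar> * noise_total N K h b"
      using init noise_total_ge_1[OF h, of N K b] mult_left_mono[of 1 "noise_total N K h b" "\<bar>M\<bar>"] by simp
    finally have "sob N (-1) (a k) + 2 * (\<Sum>i=1..k. h * sob N 1 (a i)) \<le> (\<bar>M\<bar> + 2 * C) * noise_total N K h b"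
      by (simp add: algebra_simps)
    moreover have "0 \<le> (\<Sum>i=1..k. h * sob N 1 (a i))" "0 \<le> sob N (-1) (a k)" using h by (auto intro!: sum_nonneg)
    ultimately show ?thesis by linarith
  qed
  moreover have "0 \<le> \<bar>M\<bar> + 2 * C" using C by simp
  ultimately show ?thesis by (intro exI[of _ "\<bar>M\<bar> + 2 * C"]) blast
qed

text \<open>The case \<open>s = 0\<close>. The terms with \<open>y\<close> on the right are exactly those that the first estimate controls, with \<open>\<bbbH>\<^sup>-\<^sup>1\<close>
  uniformly and \<open>\<bbbH>\<^sup>1\<close> after summation over time.\<close>

lemma second_energy_estimate:
  assumes "0 \<le> M"
  shows "\<exists>C\<ge>0. \<forall>N K h a b. 0 < h \<longrightarrow> coeff_scheme N K h a b \<longrightarrow> sob N 0 (a 0) \<le> M \<longrightarrow>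
     (\<forall>k\<le>K. sob N 0 (a k) \<le> C * (noise_total N K h b)\<^sup>2 \<and> (\<Sum>i=1..k. h * sob N 2 (a i)) \<le> C * (noise_total N K h b)\<^sup>2)"
proof -
  obtain C where C: "0 \<le> C" "\<And>N a b. - C * (sob N 1 a + (noise_size N b)\<^sup>2 + (noise_size N b)^4 * sob N (-1) a)
      \<le> (\<Sum>j=1..N. (lam j * a j) * drift N a b j)"
    using drift_laplacian_pairing_lower by auto
  obtain D where D: "0 \<le> D" and est1: "\<And>N K h a b k. 0 < h \<Longrightarrow> coeff_scheme N K h a b \<Longrightarrow>
      sob N (-1) (a 0) \<le> lam 1 powr (-1) * M \<Longrightarrow> k \<le> K \<Longrightarrow>
      sob N (-1) (a k) \<le> D * noise_total N K h b \<and> (\<Sum>i=1..k. h * sob N 1 (a i)) \<le> D * noise_total N K h b"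
    using first_energy_estimate[of "lam 1 powr (-1) * M"] by metis
  define E where "E = M + 2 * C * (2 * D + 1)"
  have "sob N 0 (a k) \<le> E * (noise_total N K h b)\<^sup>2 \<and> (\<Sum>i=1..k. h * sob N 2 (a i)) \<le> E * (noise_total N K h b)\<^sup>2"
    if h: "0 < h" and sch: "coeff_scheme N K h a b" and init: "sob N 0 (a 0) \<le> M" and k: "k \<le> K" for N K h a b k
  proof -
    define V where "V = noise_total N K h b"
    have V: "1 \<le> V" "V \<le> V\<^sup>2" "1 \<le> V\<^sup>2"
      using noise_total_ge_1[OF h, of N K b] unfolding V_def
      by (blast intro: self_le_power one_le_power zero_less_numeral)+
    have "sob N (-1) (a 0) \<le> lam 1 powr (-1) * sob N 0 (a 0)" using sob_mono[of "-1" 0 N "a 0"] by simp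
    also have "\<dots> \<le> lam 1 powr (-1) * M" using init by (intro mult_left_mono) auto
    finally have init': "sob N (-1) (a 0) \<le> lam 1 powr (-1) * M" .
    note est = est1[OF h sch init', folded V_def]
    have p1: "lam j powr (0 + 1) = lam j" for j using lam_nonneg[of j] by simp
    have "sob N 0 (a k) + 2 * (\<Sum>i=1..k. h * sob N (0 + 2) (a i))
        \<le> sob N 0 (a 0) + 2 * (\<Sum>i=1..k. h * (C * (sob N 1 (a i) + (noise_size N (b i))\<^sup>2 + (noise_size N (b i))^4 * sob N (-1) (a i))))"
      by (intro energy_sum[OF sch h k], unfold p1) (use C(2) in simp)
    also have "(\<Sum>i=1..k. h * (C * (sob N 1 (a i) + (noise_size N (b i))\<^sup>2 + (noise_size N (b i))^4 * sob N (-1) (a i))))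
        = C * ((\<Sum>i=1..k. h * sob N 1 (a i)) + (\<Sum>i=1..k. h * (noise_size N (b i))\<^sup>2) + (\<Sum>i=1..k. h * (noise_size N (b i))^4 * sob N (-1) (a i)))"
      by (simp add: sum_distrib_left sum.distrib algebra_simps)
    also have "\<dots> \<le> C * (D * V\<^sup>2 + V\<^sup>2 + D * V\<^sup>2)"
    proof (intro mult_left_mono add_mono C(1))
      show "(\<Sum>i=1..k. h * sob N 1 (a i)) \<le> D * V\<^sup>2"
        using est[OF k] D V mult_left_mono[OF V(2) D] by linarith
      show "(\<Sum>i=1..k. h * (noise_size N (b i))\<^sup>2) \<le> V\<^sup>2"
        using noise_power_sum_le[OF h k, where m = 2 and N = N and b = b] V(2) unfolding V_def by linarith
      have "(\<Sum>i=1..k. h * (noise_size N (b i))^4 * sob N (-1) (a i)) \<le> (\<Sum>i=1..k. h * (noise_size N (b i))^4 * (D * V))"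
        using est h k noise_size_ge_1 by (intro sum_mono mult_left_mono) (auto intro!: mult_nonneg_nonneg)
      also have "\<dots> = (\<Sum>i=1..k. h * (noise_size N (b i))^4) * (D * V)" by (simp add: sum_distrib_right)
      also have "\<dots> \<le> V * (D * V)"
        using noise_power_sum_le[OF h k, where m = 4 and N = N and b = b] V D by (intro mult_right_mono) (auto simp: V_def)
      finally show "(\<Sum>i=1..k. h * (noise_size N (b i))^4 * sob N (-1) (a i)) \<le> D * V\<^sup>2"
        by (simp add: power2_eq_square mult_ac)
    qed
    also have "sob N 0 (a 0) \<le> M * V\<^sup>2" using init assms mult_left_mono[OF V(3) assms] by simp
    finally have "sob N 0 (a k) + 2 * (\<Sum>i=1..k. h * sob N 2 (a i)) \<le> E * V\<^sup>2"
      by (simp add: E_def algebra_simps)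
    moreover have "0 \<le> (\<Sum>i=1..k. h * sob N 2 (a i))" "0 \<le> sob N 0 (a k)" using h by (auto intro!: sum_nonneg)
    ultimately show ?thesis unfolding V_def by linarith
  qed
  moreover have "0 \<le> E" using C D assms by (simp add: E_def)
  ultimately show ?thesis by (intro exI[of _ E]) blast
qed


text \<open>The forcing is bounded in \<open>L\<^sup>4(0,T; H)\<close>. Apart from the noise, since \<open>\<parallel>y\<parallel>\<^sub>1\<^sup>4 \<le> \<parallel>y\<parallel>\<^sup>2 \<parallel>A y\<parallel>\<^sup>2\<close>, the square of its squared norm is a power of
  \<open>\<parallel>y\<parallel>\<close>, uniformly bounded, times the summable \<open>\<parallel>A y\<parallel>\<^sup>2\<close>.\<close>

lemma drift_sq_time_bound:
  assumes "0 \<le> M"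
  shows "\<exists>C\<ge>0. \<forall>N K h a b. 0 < h \<longrightarrow> coeff_scheme N K h a b \<longrightarrow> sob N 0 (a 0) \<le> M \<longrightarrow>
     drift_sum 2 N K h a b \<le> C * (noise_total N K h b)^12"
proof -
  obtain C where C: "0 \<le> C" "\<And>N a b. drift_sq N a b \<le> C * ((noise_size N b)^3 + (sob N 0 a)\<^sup>2 * sob N 1 a)"
    using drift_sq_le_energy unfolding drift_sq_def by auto
  obtain D where D: "0 \<le> D" and est: "\<And>N K h a b k. 0 < h \<Longrightarrow> coeff_scheme N K h a b \<Longrightarrow>
      sob N 0 (a 0) \<le> M \<Longrightarrow> k \<le> K \<Longrightarrow>
      sob N 0 (a k) \<le> D * (noise_total N K h b)\<^sup>2 \<and> (\<Sum>i=1..k. h * sob N 2 (a i)) \<le> D * (noise_total N K h b)\<^sup>2"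
    using second_energy_estimate[OF assms] by metis
  define E where "E = 2 * C\<^sup>2 * (1 + D^6)"
  have "drift_sum 2 N K h a b \<le> E * (noise_total N K h b)^12"
    if h: "0 < h" and sch: "coeff_scheme N K h a b" and init: "sob N 0 (a 0) \<le> M" for N K h a b
  proof -
    define V where "V = noise_total N K h b"
    have V: "1 \<le> V" using noise_total_ge_1[OF h] by (simp add: V_def)
    note est = est[OF h sch init, folded V_def]
    have G: "(drift_sq N (a i) (b i))^2 \<le> 2 * C\<^sup>2 * ((noise_size N (b i))^6 + (D * V\<^sup>2)^5 * sob N 2 (a i))" if i: "i \<in> {1..K}" for i
    proof -
      define \<beta> where "\<beta> = noise_size N (b i)"
      define s0 s1 s2 where "s0 = sob N 0 (a i)" and "s1 = sob N 1 (a i)" and "s2 = sob N 2 (a i)"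
      have nn: "0 \<le> s0" "0 \<le> s1" "0 \<le> s2" by (auto simp: s0_def s1_def s2_def)
      have "s1\<^sup>2 \<le> s0 * s2" using sob_interpolation[of N 1 "a i" 1] by (simp add: s0_def s1_def s2_def)
      have "(drift_sq N (a i) (b i))^2 \<le> (C * (\<beta>^3 + s0\<^sup>2 * s1))\<^sup>2"
        using C(2)[of N "a i" "b i"] by (intro power_mono) (auto simp: \<beta>_def s0_def s1_def)
      also have "\<dots> = C\<^sup>2 * (\<beta>^3 + s0\<^sup>2 * s1)\<^sup>2" by (simp add: power_mult_distrib)
      also have "\<dots> \<le> C\<^sup>2 * (2 * ((\<beta>^3)\<^sup>2 + (s0\<^sup>2 * s1)\<^sup>2))"
        using sum_squares_bound[of "\<beta>^3" "s0\<^sup>2 * s1"]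
        by (intro mult_left_mono) (auto simp: power2_sum)
      finally have 1: "(drift_sq N (a i) (b i))^2 \<le> C\<^sup>2 * (2 * ((\<beta>^3)\<^sup>2 + (s0\<^sup>2 * s1)\<^sup>2))" .
      have "(s0\<^sup>2 * s1)\<^sup>2 = s0^4 * s1\<^sup>2" by (simp add: power_mult_distrib)
      also have "\<dots> \<le> s0^4 * (s0 * s2)" using \<open>s1\<^sup>2 \<le> s0 * s2\<close> nn by (intro mult_left_mono) auto
      also have "\<dots> = s0^5 * s2" by (simp add: eval_nat_numeral)
      also have "\<dots> \<le> (D * V\<^sup>2)^5 * s2"
        using est[of i] i nn by (intro mult_right_mono power_mono) (auto simp: s0_def)
      finally have "C\<^sup>2 * (2 * ((\<beta>^3)\<^sup>2 + (s0\<^sup>2 * s1)\<^sup>2)) \<le> C\<^sup>2 * (2 * ((\<beta>^3)\<^sup>2 + (D * V\<^sup>2)^5 * s2))"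
        by (intro mult_left_mono add_left_mono) auto
      from order_trans[OF 1 this] show ?thesis
        by (simp add: \<beta>_def s2_def algebra_simps flip: power_mult)
    qed
    have "drift_sum 2 N K h a b
        \<le> (\<Sum>i=1..K. h * (2 * C\<^sup>2 * ((noise_size N (b i))^6 + (D * V\<^sup>2)^5 * sob N 2 (a i))))"
      unfolding drift_sum_def using G h by (intro sum_mono mult_left_mono) auto
    also have "\<dots> = 2 * C\<^sup>2 * ((\<Sum>i=1..K. h * (noise_size N (b i))^6) + (D * V\<^sup>2)^5 * (\<Sum>i=1..K. h * sob N 2 (a i)))"
      by (simp add: sum_distrib_left sum.distrib algebra_simps)
    also have "\<dots> \<le> 2 * C\<^sup>2 * (V^12 + (D * V\<^sup>2)^5 * (D * V\<^sup>2))"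
    proof (intro mult_left_mono add_mono)
      have "(\<Sum>i=1..K. h * (noise_size N (b i))^6) \<le> V"
        using noise_power_sum_le[OF h order_refl, where m = 6 and N = N and b = b] by (simp add: V_def)
      also have "V \<le> V^12" using V by (intro self_le_power) auto
      finally show "(\<Sum>i=1..K. h * (noise_size N (b i))^6) \<le> V^12" .
    qed (use est[of K] D V in auto)
    also have "(D * V\<^sup>2)^5 * (D * V\<^sup>2) = D^6 * V^12"
      by (simp add: power_mult_distrib flip: power_mult power_Suc2 power_add) (simp add: eval_nat_numeral)
    finally show ?thesis by (simp add: E_def V_def algebra_simps)
  qed
  moreover have "0 \<le> E" using C D by (simp add: E_def)
  ultimately show ?thesis by (intro exI[of _ E]) blast
qed

lemma coeff_duhamel:
  assumes "coeff_scheme N K h a b" "0 < h" "j \<in> {1..N}" "k1 \<le> k" "k \<le> K"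
  defines "r \<equiv> 1 / (1 + h * (lam j)\<^sup>2)"
  shows "a k j = r ^ (k - k1) * a k1 j - (\<Sum>i=Suc k1..k. h * lam j * (r ^ (Suc k - i) * drift N (a i) (b i) j))"
proof (rule discrete_duhamel[where K = K])
  fix k assume "k < K"
  then have "a (Suc k) j * (1 + h * (lam j)\<^sup>2) = a k j - h * lam j * drift N (a (Suc k)) (b (Suc k)) j"
    using assms(1,3) by (auto simp: coeff_scheme_def algebra_simps)
  moreover have "0 < 1 + h * (lam j)\<^sup>2" using assms(2) by (simp add: add_pos_nonneg)
  ultimately show "a (Suc k) j = r * (a k j - h * lam j * drift N (a (Suc k)) (b (Suc k)) j)"
    by (simp add: r_def field_simps)
qed (use assms in auto)

lemma powr_mult_square: "0 < l \<Longrightarrow> (x * (h * l\<^sup>2)) powr p = (x * h) powr p * l powr (2 * p)" for l :: real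
proof -
  assume l: "0 < l"
  have "(x * (h * l\<^sup>2)) powr p = (x * h * l powr 2) powr p" using l by (simp add: mult.assoc)
  also have "\<dots> = (x * h) powr p * (l powr 2) powr p" by (rule powr_mult)
  finally show ?thesis unfolding powr_powr .
qed

lemma square_diff_le: "(x - y)\<^sup>2 \<le> 2 * x\<^sup>2 + 2 * (y::real)\<^sup>2"
  using zero_le_power2[of "x + y"] by (simp add: power2_eq_square algebra_simps)

text \<open>After the Cauchy--Schwarz inequality has used \<open>\<Sum> h \<lambda>\<^sup>2 r\<^sup>n \<le> 1\<close>, the weight \<open>\<lambda>\<^sup>\<gamma> r\<^sup>n \<le> (n h)\<^sup>-\<^sup>\<gamma>\<^sup>/\<^sup>2\<close> remains: a forcing in \<open>H\<close> gains
  the regularity \<open>\<gamma>\<close> as soon as the singular weight can be summed.\<close>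

lemma mild_regularity:
  assumes sch: "coeff_scheme N K h a b" and h: "0 < h" and k: "k \<le> K" and \<gamma>: "0 \<le> \<gamma>" "\<gamma> \<le> 2"
  shows "sob N \<gamma> (a k) \<le> 2 * sob N \<gamma> (a 0)
      + 2 * (\<Sum>i=1..k. h * ((real (Suc k - i) * h) powr - (\<gamma> / 2) * drift_sq N (a i) (b i)))"
proof -
  have mode: "lam j powr \<gamma> * (a k j)\<^sup>2 \<le> 2 * (lam j powr \<gamma> * (a 0 j)\<^sup>2)
      + 2 * (\<Sum>i=1..k. h * ((real (Suc k - i) * h) powr - (\<gamma> / 2) * (drift N (a i) (b i) j)\<^sup>2))"
    if j: "j \<in> {1..N}" for j
  proof -
    define r where "r = 1 / (1 + h * (lam j)\<^sup>2)"
    define g where "g = (\<lambda>i. drift N (a i) (b i) j)"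
    have l: "0 < lam j" using j lam_pos by auto
    have x: "0 < h * (lam j)\<^sup>2" using h l by simp
    have r: "0 < r" "r \<le> 1" "n \<noteq> 0 \<Longrightarrow> r ^ n \<le> (real n * (h * (lam j)\<^sup>2)) powr - (\<gamma> / 2)" for n
      using resolvent_power_bounds[of "h * (lam j)\<^sup>2" "\<gamma> / 2"] x \<gamma> by (auto simp: r_def)
    have "(a k j)\<^sup>2 = (r ^ k * a 0 j - (\<Sum>i=Suc 0..k. h * lam j * (r ^ (Suc k - i) * g i)))\<^sup>2"
      using coeff_duhamel[OF sch h j, of 0 k] k unfolding r_def g_def by simp
    also have "\<dots> \<le> 2 * (r ^ k * a 0 j)\<^sup>2 + 2 * (\<Sum>i=Suc 0..k. h * lam j * (r ^ (Suc k - i) * g i))\<^sup>2"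
      by (rule square_diff_le)
    also have "\<dots> \<le> 2 * (a 0 j)\<^sup>2 + 2 * (\<Sum>i=Suc 0..k. h * r ^ (Suc k - i) * (g i)\<^sup>2)"
    proof (intro add_mono mult_left_mono)
      have "(r ^ k)\<^sup>2 * (a 0 j)\<^sup>2 \<le> 1 * (a 0 j)\<^sup>2"
        using r by (intro mult_right_mono power_le_one) auto
      then show "(r ^ k * a 0 j)\<^sup>2 \<le> (a 0 j)\<^sup>2" by (simp add: power_mult_distrib)
      show "(\<Sum>i=Suc 0..k. h * lam j * (r ^ (Suc k - i) * g i))\<^sup>2 \<le> (\<Sum>i=Suc 0..k. h * r ^ (Suc k - i) * (g i)\<^sup>2)"
        unfolding r_def using h by (rule duhamel_sum_sq_le)
    qed auto
    finally have "lam j powr \<gamma> * (a k j)\<^sup>2 \<le> lam j powr \<gamma> * (2 * (a 0 j)\<^sup>2 + 2 * (\<Sum>i=Suc 0..k. h * r ^ (Suc k - i) * (g i)\<^sup>2))"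
      by (rule mult_left_mono) simp
    also have "\<dots> = 2 * (lam j powr \<gamma> * (a 0 j)\<^sup>2) + 2 * (\<Sum>i=Suc 0..k. h * ((lam j powr \<gamma> * r ^ (Suc k - i)) * (g i)\<^sup>2))"
      by (simp add: sum_distrib_left algebra_simps)
    also have "\<dots> \<le> 2 * (lam j powr \<gamma> * (a 0 j)\<^sup>2) + 2 * (\<Sum>i=Suc 0..k. h * ((real (Suc k - i) * h) powr - (\<gamma> / 2) * (g i)\<^sup>2))"
    proof (intro add_mono mult_left_mono sum_mono mult_right_mono)
      fix i assume i: "i \<in> {Suc 0..k}"
      define n where "n = Suc k - i"
      have n: "n \<noteq> 0" using i by (auto simp: n_def)
      have "lam j powr \<gamma> * r ^ n \<le> lam j powr \<gamma> * (real n * (h * (lam j)\<^sup>2)) powr - (\<gamma> / 2)"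
        using r(3)[OF n] by (rule mult_left_mono) simp
      also have "(real n * (h * (lam j)\<^sup>2)) powr - (\<gamma> / 2) = (real n * h) powr - (\<gamma> / 2) * lam j powr - \<gamma>"
        using powr_mult_square[OF l, of "real n" h] by simp
      also have "lam j powr \<gamma> * ((real n * h) powr - (\<gamma> / 2) * lam j powr - \<gamma>) = (real n * h) powr - (\<gamma> / 2)"
        using l by (simp add: powr_minus field_simps)
      finally show "lam j powr \<gamma> * r ^ (Suc k - i) \<le> (real (Suc k - i) * h) powr - (\<gamma> / 2)"
        by (simp add: n_def)
    qed (use h in auto)
    finally show ?thesis by (simp add: g_def)
  qed
  have "sob N \<gamma> (a k) \<le> (\<Sum>j=1..N. 2 * (lam j powr \<gamma> * (a 0 j)\<^sup>2)
      + 2 * (\<Sum>i=1..k. h * ((real (Suc k - i) * h) powr - (\<gamma> / 2) * (drift N (a i) (b i) j)\<^sup>2)))"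
    unfolding sob_def using mode by (intro sum_mono)
  also have "\<dots> = 2 * sob N \<gamma> (a 0)
      + 2 * (\<Sum>j=1..N. \<Sum>i=1..k. h * ((real (Suc k - i) * h) powr - (\<gamma> / 2) * (drift N (a i) (b i) j)\<^sup>2))"
    by (simp add: sob_def sum.distrib sum_distrib_left)
  also have "(\<Sum>j=1..N. \<Sum>i=1..k. h * ((real (Suc k - i) * h) powr - (\<gamma> / 2) * (drift N (a i) (b i) j)\<^sup>2))
     = (\<Sum>i=1..k. h * ((real (Suc k - i) * h) powr - (\<gamma> / 2) * drift_sq N (a i) (b i)))"
    by (subst sum.swap) (simp add: drift_sq_def sum_distrib_left)
  finally show ?thesis .
qed

text \<open>The same decomposition, started at time \<open>k\<^sub>1\<close>. The linear part is \<open>(r\<^sup>n - 1) y\<close>, and for the forcing no regularity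
  has to be gained, so that the weights \<open>r\<^sup>n\<close> are bounded by \<open>1\<close>.\<close>

lemma mild_increment:
  assumes sch: "coeff_scheme N K h a b" and h: "0 < h" and k: "k1 \<le> k" "k \<le> K" and \<gamma>: "0 \<le> \<gamma>" "\<gamma> \<le> 2"
  shows "sob N 0 (\<lambda>j. a k j - a k1 j) \<le> 2 * ((real (k - k1) * h) powr (\<gamma> / 2) * sob N \<gamma> (a k1))
      + 2 * (\<Sum>i=Suc k1..k. h * drift_sq N (a i) (b i))"
proof -
  have mode: "(a k j - a k1 j)\<^sup>2 \<le> 2 * ((real (k - k1) * h) powr (\<gamma> / 2) * (lam j powr \<gamma> * (a k1 j)\<^sup>2))
      + 2 * (\<Sum>i=Suc k1..k. h * (drift N (a i) (b i) j)\<^sup>2)"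
    if j: "j \<in> {1..N}" for j
  proof -
    define r where "r = 1 / (1 + h * (lam j)\<^sup>2)"
    define n where "n = k - k1"
    define g where "g = (\<lambda>i. drift N (a i) (b i) j)"
    have l: "0 < lam j" using j lam_pos by auto
    have x: "0 < h * (lam j)\<^sup>2" using h l by simp
    have r: "0 < r" "r \<le> 1" "(1 - r ^ n)\<^sup>2 \<le> (real n * (h * (lam j)\<^sup>2)) powr (\<gamma> / 2)"
      using resolvent_power_bounds[of "h * (lam j)\<^sup>2" "\<gamma> / 2"] x \<gamma> by (auto simp: r_def)
    have "a k j - a k1 j = - ((1 - r ^ n) * a k1 j) - (\<Sum>i=Suc k1..k. h * lam j * (r ^ (Suc k - i) * g i))"
      using coeff_duhamel[OF sch h j k] unfolding r_def g_def n_def by (simp add: algebra_simps)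
    then have "(a k j - a k1 j)\<^sup>2 \<le> 2 * ((1 - r ^ n) * a k1 j)\<^sup>2 + 2 * (\<Sum>i=Suc k1..k. h * lam j * (r ^ (Suc k - i) * g i))\<^sup>2"
      using square_diff_le[of "- ((1 - r ^ n) * a k1 j)"] by simp
    also have "\<dots> \<le> 2 * ((real n * h) powr (\<gamma> / 2) * (lam j powr \<gamma> * (a k1 j)\<^sup>2)) + 2 * (\<Sum>i=Suc k1..k. h * (g i)\<^sup>2)"
    proof (intro add_mono mult_left_mono)
      have "((1 - r ^ n) * a k1 j)\<^sup>2 \<le> (real n * (h * (lam j)\<^sup>2)) powr (\<gamma> / 2) * (a k1 j)\<^sup>2"
        unfolding power_mult_distrib using r by (intro mult_right_mono) auto
      also have "(real n * (h * (lam j)\<^sup>2)) powr (\<gamma> / 2) = (real n * h) powr (\<gamma> / 2) * lam j powr \<gamma>"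
        using powr_mult_square[OF l, of "real n" h] by simp
      finally show "((1 - r ^ n) * a k1 j)\<^sup>2 \<le> (real n * h) powr (\<gamma> / 2) * (lam j powr \<gamma> * (a k1 j)\<^sup>2)"
        by (simp add: mult.assoc)
      have "(\<Sum>i=Suc k1..k. h * lam j * (r ^ (Suc k - i) * g i))\<^sup>2 \<le> (\<Sum>i=Suc k1..k. h * r ^ (Suc k - i) * (g i)\<^sup>2)"
        unfolding r_def using h by (rule duhamel_sum_sq_le)
      also have "\<dots> \<le> (\<Sum>i=Suc k1..k. h * 1 * (g i)\<^sup>2)"
        using h r by (intro sum_mono mult_right_mono mult_left_mono power_le_one) auto
      finally show "(\<Sum>i=Suc k1..k. h * lam j * (r ^ (Suc k - i) * g i))\<^sup>2 \<le> (\<Sum>i=Suc k1..k. h * (g i)\<^sup>2)"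
        by simp
    qed auto
    finally show ?thesis by (simp add: g_def n_def)
  qed
  have "sob N 0 (\<lambda>j. a k j - a k1 j) \<le> (\<Sum>j=1..N. 2 * ((real (k - k1) * h) powr (\<gamma> / 2) * (lam j powr \<gamma> * (a k1 j)\<^sup>2))
      + 2 * (\<Sum>i=Suc k1..k. h * (drift N (a i) (b i) j)\<^sup>2))"
    unfolding sob_0 using mode by (intro sum_mono)
  also have "\<dots> = 2 * ((real (k - k1) * h) powr (\<gamma> / 2) * sob N \<gamma> (a k1))
      + 2 * (\<Sum>j=1..N. \<Sum>i=Suc k1..k. h * (drift N (a i) (b i) j)\<^sup>2)"
    by (simp add: sob_def sum.distrib sum_distrib_left)
  also have "(\<Sum>j=1..N. \<Sum>i=Suc k1..k. h * (drift N (a i) (b i) j)\<^sup>2) = (\<Sum>i=Suc k1..k. h * drift_sq N (a i) (b i))"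
    by (subst sum.swap) (simp add: drift_sq_def sum_distrib_left)
  finally show ?thesis .
qed


text \<open>The two conclusions for one realization, in squared norms and with a common constant.\<close>

definition regular_path :: "real \<Rightarrow> nat \<Rightarrow> nat \<Rightarrow> real \<Rightarrow> real \<Rightarrow> (nat \<Rightarrow> nat \<Rightarrow> real) \<Rightarrow> bool" where
  "regular_path \<gamma> N K h B a \<longleftrightarrow> (\<forall>k\<le>K. sob N \<gamma> (a k) \<le> B) \<and>
     (\<forall>k\<le>K. \<forall>k1\<le>k. sob N 0 (\<lambda>j. a k j - a k1 j) \<le> B * (real (k - k1) * h) powr (\<gamma> / 2))"

text \<open>If the forcing is bounded in \<open>L\<^sup>2\<^sup>m\<close> in time with \<open>\<gamma> m / (2 (m - 1)) < 1\<close>, Young's inequality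
  separates the singular weight of the smoothing estimate, now with the summable exponent
  \<open>\<theta> = \<gamma> m / (2 (m - 1))\<close>, from the forcing. The same inequality with \<open>\<tau>\<^sup>-\<^sup>\<gamma>\<^sup>/\<^sup>2\<close> for the constant weight on an
  interval of length \<open>\<tau>\<close> yields the factor \<open>\<tau>\<^sup>\<gamma>\<^sup>/\<^sup>2\<close> in the increments.\<close>

lemma regularity_from_forcing:
  assumes \<gamma>: "0 < \<gamma>" "\<gamma> \<le> 2" and m: "2 \<le> m" and q: "\<gamma> / 2 * (real m / (real m - 1)) < 1"
    and D: "0 \<le> D" and T: "0 < T"
    and forcing: "\<forall>N K h a b. 0 < h \<longrightarrow> coeff_scheme N K h a b \<longrightarrow> real K * h \<le> T \<longrightarrow> sob N \<gamma> (a 0) \<le> M \<longrightarrow>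
      drift_sum m N K h a b \<le> D * (noise_total N K h b)^p"
  shows "\<exists>C\<ge>0. \<forall>N K h a b. 0 < h \<longrightarrow> real K * h \<le> T \<longrightarrow> coeff_scheme N K h a b \<longrightarrow> sob N \<gamma> (a 0) \<le> M \<longrightarrow>
     regular_path \<gamma> N K h (C * (noise_total N K h b)^p) a"
proof -
  define \<theta> where "\<theta> = \<gamma> / 2 * (real m / (real m - 1))"
  have \<theta>: "0 \<le> \<theta>" "\<theta> < 1" using \<gamma> m q by (auto simp: \<theta>_def)
  define A where "A = T powr (1 - \<theta>) / (1 - \<theta>)"
  have A: "0 \<le> A" "T powr (1 - \<theta>) \<le> A"
    using \<theta> by (auto simp: A_def field_simps)
  define C1 where "C1 = 2 * \<bar>M\<bar> + 2 * (A + D)"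
  define C2 where "C2 = 2 * C1 + 2 * (A + D)"
  have C: "0 \<le> C1" "C1 \<le> C2" using A D by (auto simp: C1_def C2_def)
  have young: "t powr - (\<gamma> / 2) * G \<le> t powr - \<theta> + G ^ m" if "0 \<le> G" for t G :: real
    using young_power[of "t powr - (\<gamma> / 2)" G m] that m by (simp add: powr_powr \<theta>_def)
  have "regular_path \<gamma> N K h (C2 * (noise_total N K h b)^p) a"
    if h: "0 < h" and hT: "real K * h \<le> T" and sch: "coeff_scheme N K h a b" and init: "sob N \<gamma> (a 0) \<le> M" for N K h a b
  proof -
    define V where "V = (noise_total N K h b)^p"
    have V: "1 \<le> V" using noise_total_ge_1[OF h] by (simp add: V_def one_le_power)
    have force': "(\<Sum>i=k1..k. h * (drift_sq N (a i) (b i))^m) \<le> D * V" if "1 \<le> k1" "k \<le> K" for k k1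
    proof -
      have "(\<Sum>i=k1..k. h * (drift_sq N (a i) (b i))^m) \<le> drift_sum m N K h a b"
        unfolding drift_sum_def using that h by (intro sum_mono2) auto
      then show ?thesis using forcing[rule_format, OF h sch hT init] by (simp add: V_def)
    qed
    have reg: "sob N \<gamma> (a k) \<le> C1 * V" if k: "k \<le> K" for k
    proof -
      have "(\<Sum>i=1..k. h * ((real (Suc k - i) * h) powr - (\<gamma> / 2) * drift_sq N (a i) (b i)))
          \<le> (\<Sum>i=1..k. h * ((real (Suc k - i) * h) powr - \<theta> + (drift_sq N (a i) (b i))^m))"
        using h young by (intro sum_mono mult_left_mono) auto
      also have "\<dots> = (\<Sum>i=1..k. h * (real (Suc k - i) * h) powr - \<theta>) + (\<Sum>i=1..k. h * (drift_sq N (a i) (b i))^m)"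
        by (simp add: sum.distrib distrib_left)
      also have "(\<Sum>i=1..k. h * (real (Suc k - i) * h) powr - \<theta>) = (\<Sum>n=1..k. h * (real n * h) powr - \<theta>)"
        by (rule sum.reindex_bij_witness[of _ "\<lambda>n. Suc k - n" "\<lambda>i. Suc k - i"]) auto
      also have "\<dots> \<le> A"
      proof -
        have "real k * h \<le> T" using hT h k by (meson mult_right_mono of_nat_le_iff less_imp_le order_trans)
        then show ?thesis unfolding A_def using sum_inverse_powr_le[OF \<theta> h] by blast
      qed
      finally have "(\<Sum>i=1..k. h * ((real (Suc k - i) * h) powr - (\<gamma> / 2) * drift_sq N (a i) (b i)))
          \<le> A + (\<Sum>i=1..k. h * (drift_sq N (a i) (b i))^m)" by simp
      moreover have "(\<Sum>i=1..k. h * (drift_sq N (a i) (b i))^m) \<le> D * V" using k by (intro force') auto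
      ultimately have "(\<Sum>i=1..k. h * ((real (Suc k - i) * h) powr - (\<gamma> / 2) * drift_sq N (a i) (b i))) \<le> A + D * V"
        by (rule order_trans[OF _ add_left_mono])
      then have "2 * sob N \<gamma> (a 0) + 2 * (\<Sum>i=1..k. h * ((real (Suc k - i) * h) powr - (\<gamma> / 2) * drift_sq N (a i) (b i)))
          \<le> 2 * M + 2 * (A + D * V)"
        using init by (intro add_mono mult_left_mono) auto
      with mild_regularity[OF sch h k less_imp_le[OF \<gamma>(1)] \<gamma>(2)]
      have "sob N \<gamma> (a k) \<le> 2 * M + 2 * (A + D * V)" by (rule order_trans)
      also have "\<dots> \<le> 2 * (\<bar>M\<bar> * V) + 2 * (A * V + D * V)"
        using mult_left_mono[OF V, of "\<bar>M\<bar>"] mult_left_mono[OF V, of A] A by simp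
      finally show ?thesis by (simp add: C1_def algebra_simps)
    qed
    have "sob N 0 (\<lambda>j. a k j - a k1 j) \<le> C2 * V * (real (k - k1) * h) powr (\<gamma> / 2)" if k: "k1 \<le> k" "k \<le> K" for k k1
    proof (cases "k = k1")
      case True
      then show ?thesis by (simp add: sob_0)
    next
      case False
      define \<tau> where "\<tau> = real (k - k1) * h"
      have \<tau>: "0 < \<tau>" using False k h by (simp add: \<tau>_def)
      have \<tau>T: "\<tau> \<le> T"
      proof -
        have "\<tau> \<le> real K * h" unfolding \<tau>_def using k h by (intro mult_right_mono) auto
        then show ?thesis using hT by simp
      qed
      have "(\<Sum>i=Suc k1..k. h * drift_sq N (a i) (b i))
          = \<tau> powr (\<gamma> / 2) * (\<Sum>i=Suc k1..k. h * (\<tau> powr - (\<gamma> / 2) * drift_sq N (a i) (b i)))"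
        using \<tau> by (simp add: sum_distrib_left powr_minus field_simps)
      also have "\<dots> \<le> \<tau> powr (\<gamma> / 2) * (\<Sum>i=Suc k1..k. h * (\<tau> powr - \<theta> + (drift_sq N (a i) (b i))^m))"
        using h young by (intro mult_left_mono sum_mono) auto
      also have "(\<Sum>i=Suc k1..k. h * (\<tau> powr - \<theta> + (drift_sq N (a i) (b i))^m))
          = \<tau> * \<tau> powr - \<theta> + (\<Sum>i=Suc k1..k. h * (drift_sq N (a i) (b i))^m)"
      proof -
        have "(\<Sum>i=Suc k1..k. h * c) = \<tau> * c" for c using k by (simp add: \<tau>_def of_nat_diff)
        then show ?thesis by (simp only: sum.distrib distrib_left)
      qed
      also have "\<tau> * \<tau> powr - \<theta> = \<tau> powr (1 - \<theta>)" using \<tau> by (simp add: powr_mult_base)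
      also have "\<tau> powr (\<gamma> / 2) * (\<tau> powr (1 - \<theta>) + (\<Sum>i=Suc k1..k. h * (drift_sq N (a i) (b i))^m))
          \<le> \<tau> powr (\<gamma> / 2) * (A * V + D * V)"
      proof (intro mult_left_mono add_mono)
        have "\<tau> powr (1 - \<theta>) \<le> T powr (1 - \<theta>)" using \<tau> \<tau>T \<theta> by (intro powr_mono2) auto
        then show "\<tau> powr (1 - \<theta>) \<le> A * V" using A mult_left_mono[OF V A(1)] by simp
        show "(\<Sum>i=Suc k1..k. h * (drift_sq N (a i) (b i))^m) \<le> D * V" using k by (intro force') auto
      qed simp
      finally have f: "(\<Sum>i=Suc k1..k. h * drift_sq N (a i) (b i)) \<le> \<tau> powr (\<gamma> / 2) * (A * V + D * V)" .
      have "\<tau> powr (\<gamma> / 2) * sob N \<gamma> (a k1) \<le> \<tau> powr (\<gamma> / 2) * (C1 * V)"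
        using k by (intro mult_left_mono reg) auto
      then have "sob N 0 (\<lambda>j. a k j - a k1 j) \<le> 2 * (\<tau> powr (\<gamma> / 2) * (C1 * V)) + 2 * (\<tau> powr (\<gamma> / 2) * (A * V + D * V))"
        using mild_increment[OF sch h k, of \<gamma>] \<gamma> f by (simp add: \<tau>_def)
      then show ?thesis by (simp add: C2_def \<tau>_def algebra_simps)
    qed
    moreover have "sob N \<gamma> (a k) \<le> C2 * V" if "k \<le> K" for k
    proof -
      have "C1 * V \<le> C2 * V" using C(2) V by (intro mult_right_mono) auto
      then show ?thesis using reg[OF that] by linarith
    qed
    ultimately show ?thesis unfolding V_def regular_path_def by blast
  qed
  moreover have "0 \<le> C2" using C by simp
  ultimately show ?thesis by (intro exI[of _ C2]) blast
qed

text \<open>For \<open>\<gamma> < 1\<close> the forcing in \<open>L\<^sup>4\<close> suffices (\<open>m = 2\<close>). For \<open>1 \<le> \<gamma> < 3/2\<close> this case is applied with \<open>3/4\<close> in place of \<open>\<gamma>\<close>: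
  since \<open>3/4 > 1/2\<close>, it bounds the supremum of \<open>y\<close> and thereby the forcing in \<open>L\<^sup>1\<^sup>0\<close> (\<open>m = 5\<close>), which is enough because
  \<open>5 \<gamma> / 8 < 1\<close>.\<close>

theorem pathwise_bound:
  assumes \<gamma>: "0 < \<gamma>" "\<gamma> < 3 / 2" and T: "0 < T" and M: "0 \<le> M"
  shows "\<exists>C\<ge>0. \<exists>p. \<forall>N K h a b. 0 < h \<longrightarrow> real K * h \<le> T \<longrightarrow> coeff_scheme N K h a b \<longrightarrow> sob N \<gamma> (a 0) \<le> M \<longrightarrow>
     regular_path \<gamma> N K h (C * (noise_total N K h b)^p) a"
proof -
  have force: "\<exists>D\<ge>0. \<forall>N K h a b. 0 < h \<longrightarrow> coeff_scheme N K h a b \<longrightarrow> sob N s (a 0) \<le> R \<longrightarrow>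
     drift_sum 2 N K h a b \<le> D * (noise_total N K h b)^12" if s: "0 < s" and R: "0 \<le> R" for s R
  proof -
    have init: "sob N 0 a \<le> lam 1 powr (0 - s) * R" if "sob N s a \<le> R" for N a
      by (rule order_trans[OF sob_mono mult_left_mono[OF that]]) (use s in auto)
    have "0 \<le> lam 1 powr (0 - s) * R" using R by simp
    from drift_sq_time_bound[OF this] obtain D where "0 \<le> D"
      and D: "\<forall>N K h a b. 0 < h \<longrightarrow> coeff_scheme N K h a b \<longrightarrow> sob N 0 (a 0) \<le> lam 1 powr (0 - s) * R \<longrightarrow>
        drift_sum 2 N K h a b \<le> D * (noise_total N K h b)^12"
      by (elim exE conjE)
    then show ?thesis by (intro exI[of _ D] conjI allI impI D[rule_format] init)
  qed
  obtain D where D: "0 \<le> D" and force\<gamma>: "\<forall>N K h a b. 0 < h \<longrightarrow> coeff_scheme N K h a b \<longrightarrow> real K * h \<le> T \<longrightarrow>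
     sob N \<gamma> (a 0) \<le> M \<longrightarrow> drift_sum 2 N K h a b \<le> D * (noise_total N K h b)^12"
    using force[OF \<gamma>(1) M] by auto
  show ?thesis
  proof (cases "\<gamma> < 1")
    case True
    have "\<gamma> \<le> 2" "\<gamma> / 2 * (real 2 / (real 2 - 1)) < 1" using True by auto
    from regularity_from_forcing[OF \<gamma>(1) this(1) order_refl this(2) D T force\<gamma>] show ?thesis
      by (elim exE conjE, intro exI conjI) assumption+
  next
    case False
    define M' where "M' = lam 1 powr (3 / 4 - \<gamma>) * M"
    have init': "sob N (3 / 4) a \<le> M'" if "sob N \<gamma> a \<le> M" for N a
      using sob_mono[of "3 / 4" \<gamma> N a] False mult_left_mono[OF that, of "lam 1 powr (3 / 4 - \<gamma>)"]
      by (simp add: M'_def)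
    have M': "0 \<le> M'" using M by (simp add: M'_def)
    obtain D' where D': "0 \<le> D'" and force': "\<forall>N K h a b. 0 < h \<longrightarrow> coeff_scheme N K h a b \<longrightarrow> real K * h \<le> T \<longrightarrow>
       sob N (3 / 4) (a 0) \<le> M' \<longrightarrow>
       drift_sum 2 N K h a b \<le> D' * (noise_total N K h b)^12"
      using force[of "3 / 4" M'] M' by auto
    have "(0::real) < 3 / 4" "(3 / 4 :: real) \<le> 2" "3 / 4 / 2 * (real 2 / (real 2 - 1)) < 1" by auto
    from regularity_from_forcing[OF this(1,2) order_refl this(3) D' T force']
    obtain C where C: "0 \<le> C" and reg: "\<forall>N K h a b. 0 < h \<longrightarrow> real K * h \<le> T \<longrightarrow> coeff_scheme N K h a b \<longrightarrow> sob N (3 / 4) (a 0) \<le> M' \<longrightarrow>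
     regular_path (3 / 4) N K h (C * (noise_total N K h b)^12) a"
      by (elim exE conjE)
    obtain B where B: "0 \<le> B" "\<And>N a b. drift_sq N a b \<le> B * ((noise_size N b)^3 + (sob N (3 / 4) a)^3)"
      using drift_sq_le_sobolev[of "3 / 4"] unfolding drift_sq_def by auto
    \<comment> \<open>\<open>16\<close> is the constant in the convexity inequality for fifth powers, and \<open>180 = 12 * 15\<close> below\<close>
    define E where "E = 16 * B^5 * (1 + T * C^15)"
    have E: "0 \<le> E" using B C T by (simp add: E_def)
    have force5: "drift_sum 5 N K h a b \<le> E * (noise_total N K h b)^180"
      if h: "0 < h" and sch: "coeff_scheme N K h a b" and hT: "real K * h \<le> T" and init: "sob N \<gamma> (a 0) \<le> M" for N K h a b
    proof -
      define V where "V = noise_total N K h b"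
      have V: "1 \<le> V" using noise_total_ge_1[OF h] by (simp add: V_def)
      have pow5: "(x + y)^5 \<le> 16 * (x^5 + y^5)" if "0 \<le> x" "0 \<le> y" for x y :: real
      proof -
        have "convex_on {0::real..} (\<lambda>x. x^5)" by (rule convex_power_odd) simp
        from convex_onD[OF this, of "1/2" x y] that show ?thesis
          by (simp add: power_divide flip: add_divide_distrib)
      qed
      have "(drift_sq N (a i) (b i))^5 \<le> 16 * B^5 * ((noise_size N (b i))^15 + C^15 * V^180)" if i: "i \<in> {1..K}" for i
      proof -
        have n: "0 \<le> noise_size N (b i)" using noise_size_ge_1[of N "b i"] by simp
        have "sob N (3 / 4) (a i) \<le> C * V^12"
          unfolding V_def using reg[rule_format, OF h hT sch init'[OF init]] i by (simp add: regular_path_def)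
        then have "(sob N (3 / 4) (a i))^15 \<le> (C * V^12)^15" by (intro power_mono) auto
        then have s: "(sob N (3 / 4) (a i))^15 \<le> C^15 * V^180" by (simp add: power_mult_distrib flip: power_mult)
        have "(drift_sq N (a i) (b i))^5 \<le> (B * ((noise_size N (b i))^3 + (sob N (3 / 4) (a i))^3))^5"
          using B(2) by (intro power_mono) auto
        also have "\<dots> = B^5 * ((noise_size N (b i))^3 + (sob N (3 / 4) (a i))^3)^5" by (simp add: power_mult_distrib)
        also have "\<dots> \<le> B^5 * (16 * (((noise_size N (b i))^3)^5 + ((sob N (3 / 4) (a i))^3)^5))"
          using B(1) n by (intro mult_left_mono pow5) auto
        also have "\<dots> = 16 * B^5 * ((noise_size N (b i))^15 + (sob N (3 / 4) (a i))^15)"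
          by (simp flip: power_mult)
        also have "\<dots> \<le> 16 * B^5 * ((noise_size N (b i))^15 + C^15 * V^180)"
          using s B(1) by (intro mult_left_mono add_mono) auto
        finally show ?thesis .
      qed
      then have "drift_sum 5 N K h a b \<le> (\<Sum>i=1..K. h * (16 * B^5 * ((noise_size N (b i))^15 + C^15 * V^180)))"
        unfolding drift_sum_def using h by (intro sum_mono mult_left_mono) auto
      also have "\<dots> = 16 * B^5 * ((\<Sum>i=1..K. h * (noise_size N (b i))^15) + (real K * h) * (C^15 * V^180))"
        by (simp add: sum_distrib_left sum.distrib algebra_simps)
      also have "\<dots> \<le> 16 * B^5 * (V^180 + T * (C^15 * V^180))"
      proof (intro mult_left_mono add_mono mult_right_mono hT)
        have "(\<Sum>i=1..K. h * (noise_size N (b i))^15) \<le> V"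
          using noise_power_sum_le[OF h order_refl, where m = 15 and N = N and b = b] by (simp add: V_def)
        also have "V \<le> V^180" using V by (intro self_le_power) auto
        finally show "(\<Sum>i=1..K. h * (noise_size N (b i))^15) \<le> V^180" .
      qed (use B C V in auto)
      finally show ?thesis by (simp add: E_def V_def algebra_simps)
    qed
    have force5': "\<forall>N K h a b. 0 < h \<longrightarrow> coeff_scheme N K h a b \<longrightarrow> real K * h \<le> T \<longrightarrow> sob N \<gamma> (a 0) \<le> M \<longrightarrow>
        drift_sum 5 N K h a b \<le> E * (noise_total N K h b)^180"
      by (intro allI impI force5)
    have "\<gamma> \<le> 2" "(2::nat) \<le> 5" "\<gamma> / 2 * (real 5 / (real 5 - 1)) < 1" using \<gamma> by auto
    from regularity_from_forcing[OF \<gamma>(1) this E T force5'] show ?thesis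
      by (elim exE conjE, intro exI conjI) assumption+
  qed
qed

end

section \<open>Moments of Wiener integrals\<close>

lemma nn_integral_exp_normal:
  assumes "0 < \<sigma>"
  shows "(\<integral>\<^sup>+x. ennreal (normal_density 0 \<sigma> x) * ennreal (exp (\<theta> * x)) \<partial>lborel) = ennreal (exp (\<theta>\<^sup>2 * \<sigma>\<^sup>2 / 2))"
proof -
  have "normal_density 0 \<sigma> x * exp (\<theta> * x) = exp (\<theta>\<^sup>2 * \<sigma>\<^sup>2 / 2) * normal_density (\<theta> * \<sigma>\<^sup>2) \<sigma> x" for x
  proof -
    have "- (x - 0)\<^sup>2 / (2 * \<sigma>\<^sup>2) + \<theta> * x = \<theta>\<^sup>2 * \<sigma>\<^sup>2 / 2 + - (x - \<theta> * \<sigma>\<^sup>2)\<^sup>2 / (2 * \<sigma>\<^sup>2)"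
      using assms by (simp add: field_simps power2_eq_square)
    then have "exp (- (x - 0)\<^sup>2 / (2 * \<sigma>\<^sup>2)) * exp (\<theta> * x) = exp (\<theta>\<^sup>2 * \<sigma>\<^sup>2 / 2) * exp (- (x - \<theta> * \<sigma>\<^sup>2)\<^sup>2 / (2 * \<sigma>\<^sup>2))"
      by (simp flip: exp_add)
    then show ?thesis unfolding normal_density_def by simp
  qed
  then have "(\<integral>\<^sup>+x. ennreal (normal_density 0 \<sigma> x) * ennreal (exp (\<theta> * x)) \<partial>lborel)
      = (\<integral>\<^sup>+x. ennreal (exp (\<theta>\<^sup>2 * \<sigma>\<^sup>2 / 2)) * ennreal (normal_density (\<theta> * \<sigma>\<^sup>2) \<sigma> x) \<partial>lborel)"
    by (intro nn_integral_cong) (simp flip: ennreal_mult)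
  also have "\<dots> = ennreal (exp (\<theta>\<^sup>2 * \<sigma>\<^sup>2 / 2)) * (\<integral>\<^sup>+x. ennreal (normal_density (\<theta> * \<sigma>\<^sup>2) \<sigma> x) \<partial>lborel)"
    by (rule nn_integral_cmult) simp
  also have "(\<integral>\<^sup>+x. ennreal (normal_density (\<theta> * \<sigma>\<^sup>2) \<sigma> x) \<partial>lborel) = 1"
    using assms by (subst nn_integral_eq_integral) (auto simp: normal_density_nonneg)
  finally show ?thesis by simp
qed

text \<open>Independence is needed only for exponentials of a variable from the past and of an increment. The hypothesis
  has the form in which independent increments are expressed in the definition of Brownian motion.\<close>

lemma (in prob_space) nn_integral_indep_product:
  fixes X Y :: "'a \<Rightarrow> real"
  assumes sub: "subalgebra M G" and X: "X \<in> borel_measurable G" and Y: "Y \<in> borel_measurable M"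
    and indep: "indep_set (sets G) {Y -` U \<inter> space M | U. U \<in> sets borel}"
  shows "(\<integral>\<^sup>+\<omega>. ennreal (exp (X \<omega>)) * ennreal (exp (Y \<omega>)) \<partial>M)
     = (\<integral>\<^sup>+\<omega>. ennreal (exp (X \<omega>)) \<partial>M) * (\<integral>\<^sup>+\<omega>. ennreal (exp (Y \<omega>)) \<partial>M)"
proof -
  define Z where "Z = case_bool (\<lambda>\<omega>. ennreal (exp (X \<omega>))) (\<lambda>\<omega>. ennreal (exp (Y \<omega>)))"
  have sp: "space G = space M" "sets G \<subseteq> sets M" using sub by (auto simp: subalgebra_def)
  have XM: "X \<in> borel_measurable M" using X sub by (rule measurable_from_subalg[rotated])
  have "indep_vars (\<lambda>_. borel) Z UNIV"
    unfolding indep_vars_def2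
  proof (intro conjI ballI)
    show "random_variable borel (Z i)" for i
      using XM Y by (cases i) (auto simp: Z_def)
    have "indep_sets (case_bool (sets G) {Y -` U \<inter> space M | U. U \<in> sets borel}) UNIV"
      using indep by (simp add: indep_set_def)
    then show "indep_sets (\<lambda>i. {Z i -` A \<inter> space M |A. A \<in> sets borel}) UNIV"
    proof (rule indep_sets_mono_sets)
      fix i :: bool
      have 1: "(\<lambda>\<omega>. ennreal (exp (X \<omega>))) -` A \<inter> space M \<in> sets G" if "A \<in> sets borel" for A
      proof -
        have "(\<lambda>\<omega>. ennreal (exp (X \<omega>))) \<in> borel_measurable G" using X by measurable
        from measurable_sets[OF this that] show ?thesis by (simp add: sp)
      qed
      have 2: "\<exists>U. (\<lambda>\<omega>. ennreal (exp (Y \<omega>))) -` A \<inter> space M = Y -` U \<inter> space M \<and> U \<in> sets borel" if "A \<in> sets borel" for A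
      proof -
        have "(\<lambda>x::real. ennreal (exp x)) \<in> borel_measurable borel" by measurable
        from measurable_sets[OF this that] have "(\<lambda>x::real. ennreal (exp x)) -` A \<in> sets borel" by simp
        then show ?thesis by (intro exI[of _ "(\<lambda>x::real. ennreal (exp x)) -` A"]) auto
      qed
      show "{Z i -` A \<inter> space M |A. A \<in> sets borel} \<subseteq> case_bool (sets G) {Y -` U \<inter> space M | U. U \<in> sets borel} i"
        using 1 2 by (cases i) (auto simp: Z_def)
    qed
  qed
  from indep_vars_nn_integral[OF _ this] show ?thesis
    by (simp add: UNIV_bool Z_def mult.commute)
qed

text \<open>This turns bounds on the moment generating function into bounds on even moments.\<close>

lemma power_even_le_exp: "x ^ (2 * n) \<le> fact (2 * n) * (exp x + exp (- x))" for x :: real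
proof -
  have *: "\<bar>x\<bar> ^ (2 * n) \<le> fact (2 * n) * exp \<bar>x\<bar>"
  proof -
    have "(\<lambda>k. \<bar>x\<bar> ^ k /\<^sub>R fact k) sums exp \<bar>x\<bar>" by (rule exp_converges)
    then have "\<bar>x\<bar> ^ (2 * n) /\<^sub>R fact (2 * n) \<le> exp \<bar>x\<bar>"
      using sum_le_suminf[of "\<lambda>k. \<bar>x\<bar> ^ k /\<^sub>R fact k" "{2 * n}"]
      by (auto simp: sums_iff)
    then show ?thesis by (simp add: field_simps)
  qed
  have "x ^ (2 * n) = \<bar>x\<bar> ^ (2 * n)" by (simp add: power_mult)
  also note *
  also have "exp \<bar>x\<bar> \<le> exp x + exp (- x)" by (auto simp: abs_if)
  finally show ?thesis by (simp add: mult_left_mono order_trans)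
qed

lemma grid_mono:
  fixes \<tau> :: "nat \<Rightarrow> real"
  assumes "\<And>i. i < n \<Longrightarrow> \<tau> i \<le> \<tau> (Suc i)" and "i \<le> j" "j \<le> n"
  shows "\<tau> i \<le> \<tau> j"
  using assms(2,3)
proof (induction j rule: dec_induct)
  case (step k)
  then have "\<tau> i \<le> \<tau> k" "\<tau> k \<le> \<tau> (Suc k)" using assms(1)[of k] by auto
  then show ?case by (rule order_trans)
qed simp

definition step_var :: "nat \<Rightarrow> (nat \<Rightarrow> real) \<Rightarrow> (nat \<Rightarrow> real) \<Rightarrow> real" where
  "step_var n \<tau> a = (\<Sum>i<n. (a i)\<^sup>2 * (\<tau> (Suc i) - \<tau> i))"

locale brownian = prob_space M for M :: "'w measure" +
  fixes \<F> :: "real \<Rightarrow> 'w measure" and B :: "real \<Rightarrow> 'w \<Rightarrow> real"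
  assumes filt: "filtered_prob_space M \<F>" and bm: "brownian_motion M \<F> B"
begin

definition elementary :: "nat \<Rightarrow> (nat \<Rightarrow> real) \<Rightarrow> (nat \<Rightarrow> real) \<Rightarrow> 'w \<Rightarrow> real" where
  "elementary n \<tau> a \<omega> = (\<Sum>i<n. a i * (B (\<tau> (Suc i)) \<omega> - B (\<tau> i) \<omega>))"

lemma B_adapted: "0 \<le> s \<Longrightarrow> s \<le> t \<Longrightarrow> B s \<in> borel_measurable (\<F> t)"
proof -
  assume st: "0 \<le> s" "s \<le> t"
  have "space (\<F> s) = space (\<F> t)" "sets (\<F> s) \<subseteq> sets (\<F> t)"
    using filt st unfolding filtered_prob_space_def subalgebra_def by (metis order_trans)+
  then have "subalgebra (\<F> t) (\<F> s)" by (simp add: subalgebra_def)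
  moreover have "B s \<in> borel_measurable (\<F> s)" using bm st by (auto simp: brownian_motion_def)
  ultimately show ?thesis by (rule measurable_from_subalg)
qed

lemma B_measurable: "0 \<le> s \<Longrightarrow> B s \<in> borel_measurable M"
  using B_adapted[of s s] filt by (auto simp: filtered_prob_space_def intro: measurable_from_subalg)

lemma grid_nonneg:
  fixes \<tau> :: "nat \<Rightarrow> real"
  assumes "\<tau> 0 = 0" "\<And>i. i < n \<Longrightarrow> \<tau> i \<le> \<tau> (Suc i)" "i \<le> n"
  shows "0 \<le> \<tau> i"
  using grid_mono[of n \<tau> 0 i] assms by simp

lemma increment_mgf:
  assumes "0 \<le> s" "s \<le> t"
  shows "(\<integral>\<^sup>+\<omega>. ennreal (exp (\<theta> * (B t \<omega> - B s \<omega>))) \<partial>M) = ennreal (exp (\<theta>\<^sup>2 * (t - s) / 2))"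
proof (cases "s = t")
  case True
  then show ?thesis by (simp add: emeasure_space_1)
next
  case False
  then have st: "s < t" using assms by simp
  have d: "distributed M lborel (\<lambda>\<omega>. B t \<omega> - B s \<omega>) (\<lambda>x. ennreal (normal_density 0 (sqrt (t - s)) x))"
    using bm assms st by (auto simp: brownian_motion_def)
  have "(\<integral>\<^sup>+\<omega>. ennreal (exp (\<theta> * (B t \<omega> - B s \<omega>))) \<partial>M)
      = (\<integral>\<^sup>+x. ennreal (normal_density 0 (sqrt (t - s)) x) * ennreal (exp (\<theta> * x)) \<partial>lborel)"
    by (rule distributed_nn_integral[OF d, symmetric]) simp
  also have "\<dots> = ennreal (exp (\<theta>\<^sup>2 * (sqrt (t - s))\<^sup>2 / 2))"
    using st by (intro nn_integral_exp_normal) auto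
  finally show ?thesis using st by simp
qed

lemma elementary_adapted:
  assumes "\<tau> 0 = 0" "\<And>i. i < n \<Longrightarrow> \<tau> i \<le> \<tau> (Suc i)"
  shows "elementary n \<tau> a \<in> borel_measurable (\<F> (\<tau> n))"
  unfolding elementary_def
  by (intro borel_measurable_sum borel_measurable_times borel_measurable_diff B_adapted)
     (auto intro!: grid_nonneg[where \<tau> = \<tau> and n = n] grid_mono[where \<tau> = \<tau> and n = n] assms)

lemma elementary_measurable:
  assumes "\<tau> 0 = 0" "\<And>i. i < n \<Longrightarrow> \<tau> i \<le> \<tau> (Suc i)"
  shows "elementary n \<tau> a \<in> borel_measurable M"
  unfolding elementary_def
  by (intro borel_measurable_sum borel_measurable_times borel_measurable_diff B_measurable)
     (auto intro!: grid_nonneg[where \<tau> = \<tau> and n = n] assms)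

text \<open>The moment generating function is used in place of the distribution: by independence of the increments it
  multiplies along the grid, and it keeps its meaning for intervals of length zero and vanishing coefficients, where
  the normal law has no density.\<close>

lemma elementary_mgf:
  assumes "\<tau> 0 = 0" "\<And>i. i < n \<Longrightarrow> \<tau> i \<le> \<tau> (Suc i)"
  shows "(\<integral>\<^sup>+\<omega>. ennreal (exp (\<theta> * elementary n \<tau> a \<omega>)) \<partial>M)
     = ennreal (exp (\<theta>\<^sup>2 * step_var n \<tau> a / 2))"
  using assms(2)
proof (induction n)
  case 0
  then show ?case by (simp add: elementary_def step_var_def emeasure_space_1)
next
  case (Suc n)
  define Y where "Y = (\<lambda>\<omega>. \<theta> * a n * (B (\<tau> (Suc n)) \<omega> - B (\<tau> n) \<omega>))"
  define X where "X = (\<lambda>\<omega>. \<theta> * elementary n \<tau> a \<omega>)"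
  have t: "0 \<le> \<tau> n" "\<tau> n \<le> \<tau> (Suc n)"
    using grid_nonneg[where \<tau> = \<tau> and n = "Suc n" and i = n] Suc.prems assms(1) by auto
  have YM: "Y \<in> borel_measurable M" unfolding Y_def using t B_measurable by (intro borel_measurable_times) auto
  have XG: "X \<in> borel_measurable (\<F> (\<tau> n))"
    unfolding X_def using Suc.prems by (intro borel_measurable_times elementary_adapted assms(1)) auto
  have prod: "(\<integral>\<^sup>+\<omega>. ennreal (exp (X \<omega>)) * ennreal (exp (Y \<omega>)) \<partial>M)
     = (\<integral>\<^sup>+\<omega>. ennreal (exp (X \<omega>)) \<partial>M) * (\<integral>\<^sup>+\<omega>. ennreal (exp (Y \<omega>)) \<partial>M)"
  proof (cases "\<tau> n = \<tau> (Suc n)")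
    case True
    then show ?thesis by (simp add: Y_def emeasure_space_1)
  next
    case False
    let ?D = "\<lambda>\<omega>. B (\<tau> (Suc n)) \<omega> - B (\<tau> n) \<omega>"
    have "indep_set (sets (\<F> (\<tau> n))) {?D -` U \<inter> space M | U. U \<in> sets borel}"
      using bm t False by (auto simp: brownian_motion_def)
    then have "indep_set (sets (\<F> (\<tau> n))) {Y -` U \<inter> space M | U. U \<in> sets borel}"
      unfolding indep_set_def
    proof (rule indep_sets_mono_sets)
      fix i :: bool
      have "\<exists>V. Y -` U \<inter> space M = ?D -` V \<inter> space M \<and> V \<in> sets borel" if "U \<in> sets borel" for U
      proof -
        have "(\<lambda>x::real. \<theta> * a n * x) \<in> borel_measurable borel" by measurable
        from measurable_sets[OF this that] have "(\<lambda>x::real. \<theta> * a n * x) -` U \<in> sets borel" by simp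
        then show ?thesis by (intro exI[of _ "(\<lambda>x::real. \<theta> * a n * x) -` U"]) (auto simp: Y_def)
      qed
      then show "case_bool (sets (\<F> (\<tau> n))) {Y -` U \<inter> space M | U. U \<in> sets borel} i
         \<subseteq> case_bool (sets (\<F> (\<tau> n))) {?D -` U \<inter> space M | U. U \<in> sets borel} i"
        by (cases i) auto
    qed
    moreover have "subalgebra M (\<F> (\<tau> n))" using filt t by (auto simp: filtered_prob_space_def)
    ultimately show ?thesis using XG YM by (intro nn_integral_indep_product)
  qed
  have "(\<integral>\<^sup>+\<omega>. ennreal (exp (\<theta> * elementary (Suc n) \<tau> a \<omega>)) \<partial>M) = (\<integral>\<^sup>+\<omega>. ennreal (exp (X \<omega>)) * ennreal (exp (Y \<omega>)) \<partial>M)"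
    by (intro nn_integral_cong)
       (simp add: elementary_def X_def Y_def distrib_left mult.assoc exp_add flip: ennreal_mult)
  also note prod
  also have "(\<integral>\<^sup>+\<omega>. ennreal (exp (X \<omega>)) \<partial>M) = ennreal (exp (\<theta>\<^sup>2 * step_var n \<tau> a / 2))"
    unfolding X_def using Suc.prems by (intro Suc.IH) auto
  also have "(\<integral>\<^sup>+\<omega>. ennreal (exp (Y \<omega>)) \<partial>M) = ennreal (exp ((\<theta> * a n)\<^sup>2 * (\<tau> (Suc n) - \<tau> n) / 2))"
    unfolding Y_def by (rule increment_mgf[OF t])
  finally show ?case
    by (simp add: step_var_def power_mult_distrib distrib_left add_divide_distrib mult.assoc flip: ennreal_mult exp_add)
qed

lemma elementary_moment:
  assumes \<tau>: "\<tau> 0 = 0" "\<And>i. i < n \<Longrightarrow> \<tau> i \<le> \<tau> (Suc i)"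
    and s: "0 < s" "step_var n \<tau> a \<le> s"
  shows "(\<integral>\<^sup>+\<omega>. ennreal ((elementary n \<tau> a \<omega>) ^ (2 * m)) \<partial>M) \<le> ennreal (4 * fact (2 * m) * s ^ m)"
proof -
  define X where "X = elementary n \<tau> a"
  define v where "v = step_var n \<tau> a"
  have XM[measurable]: "X \<in> borel_measurable M" unfolding X_def by (rule elementary_measurable[OF \<tau>])
  \<comment> \<open>rescales the integral to variance at most one\<close>
  define \<theta> where "\<theta> = 1 / sqrt s"
  have \<theta>2: "\<theta>\<^sup>2 * s = 1" "0 < \<theta>" using s by (auto simp: \<theta>_def power_divide)
  have e: "(\<integral>\<^sup>+\<omega>. ennreal (exp (\<rho> * X \<omega>)) \<partial>M) \<le> 2" if "\<rho>\<^sup>2 = \<theta>\<^sup>2" for \<rho>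
  proof -
    have "(\<integral>\<^sup>+\<omega>. ennreal (exp (\<rho> * X \<omega>)) \<partial>M) = ennreal (exp (\<theta>\<^sup>2 * v / 2))"
      unfolding X_def v_def that[symmetric] by (rule elementary_mgf[OF \<tau>])
    also have "\<dots> \<le> ennreal 2"
    proof (rule ennreal_leI)
      have "\<theta>\<^sup>2 * v \<le> \<theta>\<^sup>2 * s" using s by (intro mult_left_mono) (auto simp: v_def)
      then have "exp (\<theta>\<^sup>2 * v / 2) \<le> exp (1 / 2)" using \<theta>2 by simp
      also have "exp (1 / 2 :: real) \<le> 1 + 1 / 2 + (1 / 2)\<^sup>2" by (rule exp_bound) auto
      also have "\<dots> \<le> 2" by (simp add: power2_eq_square)
      finally show "exp (\<theta>\<^sup>2 * v / 2) \<le> 2" .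
    qed
    finally show ?thesis by simp
  qed
  have pt: "(X \<omega>) ^ (2 * m) \<le> fact (2 * m) * s ^ m * (exp (\<theta> * X \<omega>) + exp ((- \<theta>) * X \<omega>))" for \<omega>
  proof -
    have "X \<omega> ^ (2 * m) = s ^ m * (\<theta> * X \<omega>) ^ (2 * m)"
    proof -
      have "s ^ m * (\<theta> * X \<omega>) ^ (2 * m) = (\<theta>\<^sup>2 * s) ^ m * X \<omega> ^ (2 * m)"
        by (simp add: power_mult_distrib power_mult)
      then show ?thesis using \<theta>2 by simp
    qed
    also have "\<dots> \<le> s ^ m * (fact (2 * m) * (exp (\<theta> * X \<omega>) + exp (- (\<theta> * X \<omega>))))"
      using s by (intro mult_left_mono power_even_le_exp) auto
    finally show ?thesis by (simp add: mult_ac)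
  qed
  have "(\<integral>\<^sup>+\<omega>. ennreal ((X \<omega>) ^ (2 * m)) \<partial>M)
      \<le> (\<integral>\<^sup>+\<omega>. ennreal (fact (2 * m) * s ^ m) * (ennreal (exp (\<theta> * X \<omega>)) + ennreal (exp ((- \<theta>) * X \<omega>))) \<partial>M)"
    using pt s by (intro nn_integral_mono) (auto simp flip: ennreal_mult ennreal_plus intro!: ennreal_leI)
  also have "\<dots> = ennreal (fact (2 * m) * s ^ m) * ((\<integral>\<^sup>+\<omega>. ennreal (exp (\<theta> * X \<omega>)) \<partial>M) + (\<integral>\<^sup>+\<omega>. ennreal (exp ((- \<theta>) * X \<omega>)) \<partial>M))"
    by (subst nn_integral_cmult nn_integral_add, measurable)+
  also have "\<dots> \<le> ennreal (fact (2 * m) * s ^ m) * (2 + 2)"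
    by (intro mult_left_mono add_mono e) auto
  also have "(2 + 2 :: ennreal) = ennreal 4" by simp
  also have "ennreal (fact (2 * m) * s ^ m) * ennreal 4 = ennreal (4 * fact (2 * m) * s ^ m)"
    using s by (subst ennreal_mult[symmetric]) (auto simp: mult_ac)
  finally show ?thesis unfolding X_def .
qed

end

definition step_fun :: "nat \<Rightarrow> (nat \<Rightarrow> real) \<Rightarrow> (nat \<Rightarrow> real) \<Rightarrow> real \<Rightarrow> real" where
  "step_fun n \<tau> a u = (\<Sum>i<n. a i * indicator {\<tau> i<..\<tau> (Suc i)} u)"

lemma step_function_sq:
  fixes \<tau> a :: "nat \<Rightarrow> real"
  assumes "\<And>i. i < n \<Longrightarrow> \<tau> i \<le> \<tau> (Suc i)"
  shows "(step_fun n \<tau> a u)\<^sup>2 = (\<Sum>i<n. (a i)\<^sup>2 * indicator {\<tau> i<..\<tau> (Suc i)} u)"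
  using assms unfolding step_fun_def
proof (induction n)
  case (Suc n)
  have mono: "\<tau> i \<le> \<tau> n" if "i \<le> n" for i
    using grid_mono[where \<tau> = \<tau> and n = "Suc n"] Suc.prems that by auto
  have "indicator {\<tau> n<..\<tau> (Suc n)} u * (\<Sum>i<n. a i * indicator {\<tau> i<..\<tau> (Suc i)} u) = 0"
  proof (cases "\<tau> n < u")
    case True
    have "indicator {\<tau> i<..\<tau> (Suc i)} u = (0::real)" if "i < n" for i
      using mono[of "Suc i"] that True by (auto simp: indicator_def)
    then show ?thesis by simp
  qed (simp add: indicator_def)
  then have "(\<Sum>i<Suc n. a i * indicator {\<tau> i<..\<tau> (Suc i)} u)\<^sup>2
    = (\<Sum>i<n. a i * indicator {\<tau> i<..\<tau> (Suc i)} u)\<^sup>2 + (a n * indicator {\<tau> n<..\<tau> (Suc n)} u)\<^sup>2"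
    by (simp add: power2_sum mult_ac)
  then show ?case using Suc by (simp add: power_mult_distrib indicator_def)
qed simp

text \<open>The variance of an elementary integral is the squared norm of its step function in \<open>L\<^sup>2(0,t)\<close>.\<close>

lemma step_function_L2:
  fixes \<tau> a :: "nat \<Rightarrow> real"
  assumes \<tau>: "\<tau> 0 = 0" "\<And>i. i < n \<Longrightarrow> \<tau> i \<le> \<tau> (Suc i)" "\<tau> n = t"
  shows "ennreal (step_var n \<tau> a)
     \<le> (\<integral>\<^sup>+u\<in>{0..t}. ennreal ((step_fun n \<tau> a u)\<^sup>2) \<partial>lborel)"
proof -
  have mono: "\<tau> i \<le> \<tau> j" if "i \<le> j" "j \<le> n" for i j
    using grid_mono[where \<tau> = \<tau> and n = n] \<tau>(2) that by auto
  have "ennreal (step_var n \<tau> a) = (\<Sum>i<n. ennreal ((a i)\<^sup>2) * emeasure lborel {\<tau> i<..\<tau> (Suc i)})"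
    unfolding step_var_def using \<tau>(2) by (subst sum_ennreal[symmetric]) (auto simp: ennreal_mult intro!: sum.cong)
  also have "\<dots> = (\<Sum>i<n. \<integral>\<^sup>+u. ennreal ((a i)\<^sup>2) * indicator {\<tau> i<..\<tau> (Suc i)} u \<partial>lborel)"
    by (intro sum.cong) (auto simp: nn_integral_cmult_indicator)
  also have "\<dots> = (\<integral>\<^sup>+u. (\<Sum>i<n. ennreal ((a i)\<^sup>2) * indicator {\<tau> i<..\<tau> (Suc i)} u) \<partial>lborel)"
    by (subst nn_integral_sum) auto
  also have "\<dots> \<le> (\<integral>\<^sup>+u\<in>{0..t}. ennreal ((step_fun n \<tau> a u)\<^sup>2) \<partial>lborel)"
  proof (intro nn_integral_mono)
    fix u
    have "(\<Sum>i<n. ennreal ((a i)\<^sup>2) * indicator {\<tau> i<..\<tau> (Suc i)} u) = (\<Sum>i<n. ennreal ((a i)\<^sup>2 * indicator {\<tau> i<..\<tau> (Suc i)} u)) * indicator {0..t} u"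
      unfolding sum_distrib_right
    proof (intro sum.cong refl)
      fix i assume "i \<in> {..<n}"
      then have "0 \<le> \<tau> i" "\<tau> (Suc i) \<le> t" using mono[of 0 i] mono[of "Suc i" n] \<tau> by auto
      then show "ennreal ((a i)\<^sup>2) * indicator {\<tau> i<..\<tau> (Suc i)} u = ennreal ((a i)\<^sup>2 * indicator {\<tau> i<..\<tau> (Suc i)} u) * indicator {0..t} u"
        by (auto simp: indicator_def)
    qed
    also have "(\<Sum>i<n. ennreal ((a i)\<^sup>2 * indicator {\<tau> i<..\<tau> (Suc i)} u)) = ennreal ((step_fun n \<tau> a u)\<^sup>2)"
      by (subst step_function_sq[where \<tau> = \<tau> and n = n]) (auto intro: sum_ennreal \<tau>(2))
    finally show "(\<Sum>i<n. ennreal ((a i)\<^sup>2) * indicator {\<tau> i<..\<tau> (Suc i)} u)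
       \<le> ennreal ((step_fun n \<tau> a u)\<^sup>2) * indicator {0..t} u" by simp
  qed
  finally show ?thesis .
qed

text \<open>Fatou's lemma along an almost surely convergent subsequence.\<close>

lemma moment_of_L2_limit:
  fixes X :: "nat \<Rightarrow> 'a \<Rightarrow> real" and Y :: "'a \<Rightarrow> real"
  assumes [measurable]: "\<And>m. X m \<in> borel_measurable M" "Y \<in> borel_measurable M"
    and lim: "(\<lambda>m. \<integral>\<^sup>+\<omega>. ennreal ((X m \<omega> - Y \<omega>)\<^sup>2) \<partial>M) \<longlonglongrightarrow> 0"
    and bound: "eventually (\<lambda>m. (\<integral>\<^sup>+\<omega>. ennreal ((X m \<omega>) ^ (2 * k)) \<partial>M) \<le> c) sequentially"
  shows "(\<integral>\<^sup>+\<omega>. ennreal ((Y \<omega>) ^ (2 * k)) \<partial>M) \<le> c"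
proof -
  have "eventually (\<lambda>m. (\<integral>\<^sup>+\<omega>. ennreal ((X m \<omega> - Y \<omega>)\<^sup>2) \<partial>M) < 1) sequentially"
    using order_tendstoD(2)[OF lim, of 1] by simp
  from eventually_conj[OF this bound] obtain m0
    where m0: "\<And>m. m0 \<le> m \<Longrightarrow> (\<integral>\<^sup>+\<omega>. ennreal ((X m \<omega> - Y \<omega>)\<^sup>2) \<partial>M) < 1"
    "\<And>m. m0 \<le> m \<Longrightarrow> (\<integral>\<^sup>+\<omega>. ennreal ((X m \<omega>) ^ (2 * k)) \<partial>M) \<le> c"
    unfolding eventually_sequentially by (elim exE) auto
  define u where "u = (\<lambda>m \<omega>. (X (m + m0) \<omega> - Y \<omega>)\<^sup>2)"
  have [measurable]: "u m \<in> borel_measurable M" for m unfolding u_def by measurable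
  have int: "integrable M (u m)" for m
  proof (rule integrableI_nonneg)
    show "(\<integral>\<^sup>+ x. ennreal (u m x) \<partial>M) < \<infinity>"
      unfolding u_def using m0(1)[of "m + m0"] by (simp add: order_less_trans)
  qed (auto simp: u_def)
  have "(\<lambda>m. \<integral>\<omega>. norm (u m \<omega>) \<partial>M) \<longlonglongrightarrow> 0"
  proof -
    have "(\<integral>\<omega>. norm (u m \<omega>) \<partial>M) = enn2real (\<integral>\<^sup>+\<omega>. ennreal (u m \<omega>) \<partial>M)" for m
      by (subst integral_eq_nn_integral) (auto simp: u_def)
    moreover have "(\<lambda>m. enn2real (\<integral>\<^sup>+\<omega>. ennreal (u m \<omega>) \<partial>M)) \<longlonglongrightarrow> enn2real 0"
      using LIMSEQ_ignore_initial_segment[OF lim, of m0] unfolding u_def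
      by (intro tendsto_enn2real) auto
    ultimately show ?thesis by simp
  qed
  from tendsto_L1_AE_subseq[OF int this] obtain r :: "nat \<Rightarrow> nat" where r: "strict_mono r"
    "AE \<omega> in M. (\<lambda>m. u (r m) \<omega>) \<longlonglongrightarrow> 0" by auto
  have "(\<integral>\<^sup>+\<omega>. ennreal ((Y \<omega>) ^ (2 * k)) \<partial>M) \<le> (\<integral>\<^sup>+\<omega>. liminf (\<lambda>m. ennreal ((X (r m + m0) \<omega>) ^ (2 * k))) \<partial>M)"
  proof (rule nn_integral_mono_AE)
    show "AE \<omega> in M. ennreal ((Y \<omega>) ^ (2 * k)) \<le> liminf (\<lambda>m. ennreal ((X (r m + m0) \<omega>) ^ (2 * k)))"
      using r(2)
    proof eventually_elim
      fix \<omega> assume "(\<lambda>m. u (r m) \<omega>) \<longlonglongrightarrow> 0"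
      then have "(\<lambda>m. sqrt (u (r m) \<omega>)) \<longlonglongrightarrow> sqrt 0" by (rule tendsto_real_sqrt)
      then have "(\<lambda>m. \<bar>X (r m + m0) \<omega> - Y \<omega>\<bar>) \<longlonglongrightarrow> 0" by (simp add: u_def)
      then have "(\<lambda>m. X (r m + m0) \<omega> - Y \<omega>) \<longlonglongrightarrow> 0" by (rule tendsto_rabs_zero_cancel)
      then have "(\<lambda>m. X (r m + m0) \<omega>) \<longlonglongrightarrow> Y \<omega>" by (rule LIM_zero_cancel)
      then have "(\<lambda>m. ennreal ((X (r m + m0) \<omega>) ^ (2 * k))) \<longlonglongrightarrow> ennreal ((Y \<omega>) ^ (2 * k))"
        by (intro tendsto_ennrealI tendsto_power)
      from lim_imp_Liminf[OF _ this] show "ennreal ((Y \<omega>) ^ (2 * k)) \<le> liminf (\<lambda>m. ennreal ((X (r m + m0) \<omega>) ^ (2 * k)))"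
        by simp
    qed
  qed
  also have "\<dots> \<le> liminf (\<lambda>m. \<integral>\<^sup>+\<omega>. ennreal ((X (r m + m0) \<omega>) ^ (2 * k)) \<partial>M)"
    by (rule nn_integral_liminf) measurable
  also have "\<dots> \<le> c"
    by (rule Liminf_le) (auto intro!: always_eventually m0)
  finally show ?thesis .
qed

text \<open>Even moments bounded like those of a centred Gaussian variable of variance \<open>s\<close>, up to the constants that
  come from exponential moments and from the approximation by elementary integrals.\<close>

definition gaussian_moments :: "'a measure \<Rightarrow> ('a \<Rightarrow> real) \<Rightarrow> real \<Rightarrow> bool" where
  "gaussian_moments M X s \<longleftrightarrow> X \<in> borel_measurable M \<and>
     (\<forall>n. (\<integral>\<^sup>+\<omega>. ennreal (X \<omega> ^ (2 * n)) \<partial>M) \<le> ennreal (4 * fact (2 * n) * (4 * s) ^ n))"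

text \<open>The variances of the approximating elementary integrals are eventually at most \<open>4 s\<close>, by
  \<open>h\<^sup>2 \<le> 2 (h - g)\<^sup>2 + 2 g\<^sup>2\<close> with an approximation error below \<open>s\<close>; their moments pass to the limit.\<close>

lemma (in brownian) wiener_integral_moment:
  assumes I: "wiener_integral M B t g I" and t: "0 \<le> t" and [measurable]: "g \<in> borel_measurable borel"
    and s: "0 < s" "(\<integral>\<^sup>+u\<in>{0..t}. ennreal ((g u)\<^sup>2) \<partial>lborel) \<le> ennreal s"
  shows "gaussian_moments M I s"
proof -
  obtain n :: "nat \<Rightarrow> nat" and \<tau> a :: "nat \<Rightarrow> nat \<Rightarrow> real" where
    grid: "\<And>m. \<tau> m 0 = 0" "\<And>m. \<tau> m (n m) = t" "\<And>m i. i < n m \<Longrightarrow> \<tau> m i \<le> \<tau> m (Suc i)"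
    and L2g: "(\<lambda>m. \<integral>\<^sup>+u\<in>{0..t}. ennreal ((step_fun (n m) (\<tau> m) (a m) u - g u)\<^sup>2) \<partial>lborel) \<longlonglongrightarrow> 0"
    and L2I: "(\<lambda>m. \<integral>\<^sup>+\<omega>. ennreal (((\<Sum>i<n m. a m i * (B (\<tau> m (Suc i)) \<omega> - B (\<tau> m i) \<omega>)) - I \<omega>)\<^sup>2) \<partial>M) \<longlonglongrightarrow> 0"
    using I unfolding wiener_integral_def step_fun_def by blast
  have "eventually (\<lambda>m. (\<integral>\<^sup>+u\<in>{0..t}. ennreal ((step_fun (n m) (\<tau> m) (a m) u - g u)\<^sup>2) \<partial>lborel) < ennreal s) sequentially"
    by (rule order_tendstoD(2)[OF L2g]) (use s(1) in simp)
  then have var: "eventually (\<lambda>m. step_var (n m) (\<tau> m) (a m) \<le> 4 * s) sequentially"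
  proof eventually_elim
    case (elim m)
    define h where "h = step_fun (n m) (\<tau> m) (a m)"
    have [measurable]: "h \<in> borel_measurable borel" unfolding h_def step_fun_def by measurable
    have "ennreal (step_var (n m) (\<tau> m) (a m)) \<le> (\<integral>\<^sup>+u\<in>{0..t}. ennreal ((h u)\<^sup>2) \<partial>lborel)"
      unfolding h_def by (intro step_function_L2 grid)
    also have "\<dots> \<le> (\<integral>\<^sup>+u. 2 * (ennreal ((h u - g u)\<^sup>2) * indicator {0..t} u) + 2 * (ennreal ((g u)\<^sup>2) * indicator {0..t} u) \<partial>lborel)"
    proof (rule nn_integral_mono)
      fix u
      have "(h u)\<^sup>2 \<le> 2 * (h u - g u)\<^sup>2 + 2 * (g u)\<^sup>2"
        using zero_le_power2[of "h u - 2 * g u"] by (simp add: power2_eq_square algebra_simps)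
      then have "ennreal ((h u)\<^sup>2) \<le> 2 * ennreal ((h u - g u)\<^sup>2) + 2 * ennreal ((g u)\<^sup>2)"
        by (simp add: ennreal_leI flip: ennreal_mult' ennreal_plus ennreal_numeral)
      then show "ennreal ((h u)\<^sup>2) * indicator {0..t} u \<le> 2 * (ennreal ((h u - g u)\<^sup>2) * indicator {0..t} u) + 2 * (ennreal ((g u)\<^sup>2) * indicator {0..t} u)"
        by (simp add: indicator_def)
    qed
    also have "\<dots> = 2 * (\<integral>\<^sup>+u\<in>{0..t}. ennreal ((h u - g u)\<^sup>2) \<partial>lborel) + 2 * (\<integral>\<^sup>+u\<in>{0..t}. ennreal ((g u)\<^sup>2) \<partial>lborel)"
      by (subst nn_integral_add nn_integral_cmult, measurable)+
    also have "\<dots> \<le> 2 * ennreal s + 2 * ennreal s"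
      using elim s(2) by (intro add_mono mult_left_mono) (auto simp: h_def)
    also have "\<dots> = ennreal (4 * s)"
      using s(1) by (simp flip: ennreal_mult' ennreal_plus ennreal_numeral)
    finally show ?case using s(1) by (simp add: ennreal_le_iff)
  qed
  have IM: "I \<in> borel_measurable M" using I by (simp add: wiener_integral_def)
  have "(\<integral>\<^sup>+\<omega>. ennreal ((I \<omega>) ^ (2 * k)) \<partial>M) \<le> ennreal (4 * fact (2 * k) * (4 * s) ^ k)" for k
  proof (rule moment_of_L2_limit[of "\<lambda>m. elementary (n m) (\<tau> m) (a m)"])
    show "elementary (n m) (\<tau> m) (a m) \<in> borel_measurable M" for m
      by (intro elementary_measurable grid)
    show "I \<in> borel_measurable M" by (rule IM)
    show "(\<lambda>m. \<integral>\<^sup>+ \<omega>. ennreal ((elementary (n m) (\<tau> m) (a m) \<omega> - I \<omega>)\<^sup>2) \<partial>M) \<longlonglongrightarrow> 0"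
      using L2I by (simp add: elementary_def)
    show "\<forall>\<^sub>F m in sequentially. (\<integral>\<^sup>+\<omega>. ennreal (elementary (n m) (\<tau> m) (a m) \<omega> ^ (2 * k)) \<partial>M) \<le> ennreal (4 * fact (2 * k) * (4 * s) ^ k)"
      using var by eventually_elim (intro elementary_moment grid, use s in auto)
  qed
  with IM show ?thesis by (simp add: gaussian_moments_def)
qed

section \<open>Weighted power means\<close>

lemma power_mean_weighted:
  fixes w x :: "'i \<Rightarrow> real"
  assumes "finite I" "\<And>i. i \<in> I \<Longrightarrow> 0 \<le> w i" "\<And>i. i \<in> I \<Longrightarrow> 0 \<le> x i"
  shows "(\<Sum>i\<in>I. w i * x i) ^ Suc m \<le> (\<Sum>i\<in>I. w i) ^ m * (\<Sum>i\<in>I. w i * x i ^ Suc m)"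
proof (cases "(\<Sum>i\<in>I. w i) = 0")
  case True
  then have "\<forall>i\<in>I. w i = 0" using assms by (simp add: sum_nonneg_eq_0_iff)
  then show ?thesis by simp
next
  case False
  define W where "W = (\<Sum>i\<in>I. w i)"
  have W: "0 < W" using False assms(2) sum_nonneg[of I w] by (simp add: W_def order_less_le)
  have conv: "convex_on {0::real..} (\<lambda>x. x ^ Suc m)"
  proof (cases "odd (Suc m)")
    case False
    then have "convex_on UNIV (\<lambda>x::real. x ^ Suc m)" by (intro convex_power_even) auto
    then show ?thesis by (rule convex_on_subset) auto
  qed (rule convex_power_odd)
  have "(\<Sum>i\<in>I. (w i / W) *\<^sub>R x i) ^ Suc m \<le> (\<Sum>i\<in>I. (w i / W) * x i ^ Suc m)"
    using assms W False
    by (intro convex_on_sum[OF _ _ conv]) (auto simp: W_def simp flip: sum_divide_distrib)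
  also have "(\<Sum>i\<in>I. (w i / W) *\<^sub>R x i) = (\<Sum>i\<in>I. w i * x i) / W"
    by (simp add: sum_divide_distrib)
  also have "(\<Sum>i\<in>I. (w i / W) * x i ^ Suc m) = (\<Sum>i\<in>I. w i * x i ^ Suc m) / W"
    by (simp add: sum_divide_distrib)
  finally have "(\<Sum>i\<in>I. w i * x i) ^ Suc m / W ^ Suc m \<le> (\<Sum>i\<in>I. w i * x i ^ Suc m) / W"
    by (simp only: power_divide)
  then have "(\<Sum>i\<in>I. w i * x i) ^ Suc m / W ^ Suc m * W ^ Suc m \<le> (\<Sum>i\<in>I. w i * x i ^ Suc m) / W * W ^ Suc m"
    using W by (intro mult_right_mono) auto
  then show ?thesis using W by (simp add: W_def[symmetric] mult_ac)
qed

text \<open>Moments of a weighted sum from moments of its terms, whatever the dependence between the terms.\<close>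

lemma nn_integral_weighted_power:
  fixes X :: "'i \<Rightarrow> 'a \<Rightarrow> real"
  assumes "finite I" "\<And>i. i \<in> I \<Longrightarrow> 0 \<le> w i" "\<And>i \<omega>. i \<in> I \<Longrightarrow> 0 \<le> X i \<omega>"
    and [measurable]: "\<And>i. i \<in> I \<Longrightarrow> X i \<in> borel_measurable M"
    and c: "0 \<le> c" "\<And>i. i \<in> I \<Longrightarrow> (\<integral>\<^sup>+\<omega>. ennreal (X i \<omega> ^ Suc m) \<partial>M) \<le> ennreal c"
  shows "(\<integral>\<^sup>+\<omega>. ennreal ((\<Sum>i\<in>I. w i * X i \<omega>) ^ Suc m) \<partial>M) \<le> ennreal ((\<Sum>i\<in>I. w i) ^ Suc m * c)"
proof -
  define W where "W = (\<Sum>i\<in>I. w i)"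
  have W: "0 \<le> W" using assms(2) by (simp add: W_def sum_nonneg)
  have "(\<integral>\<^sup>+\<omega>. ennreal ((\<Sum>i\<in>I. w i * X i \<omega>) ^ Suc m) \<partial>M)
      \<le> (\<integral>\<^sup>+\<omega>. (\<Sum>i\<in>I. ennreal (W ^ m * w i) * ennreal (X i \<omega> ^ Suc m)) \<partial>M)"
  proof (rule nn_integral_mono)
    fix \<omega>
    have "(\<Sum>i\<in>I. ennreal (W ^ m * w i) * ennreal (X i \<omega> ^ Suc m)) = (\<Sum>i\<in>I. ennreal (W ^ m * w i * X i \<omega> ^ Suc m))"
      using assms(2,3) W by (intro sum.cong) (auto simp: ennreal_mult)
    also have "\<dots> = ennreal (\<Sum>i\<in>I. W ^ m * w i * X i \<omega> ^ Suc m)"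
      using assms(2,3) W by (intro sum_ennreal) auto
    also have "(\<Sum>i\<in>I. W ^ m * w i * X i \<omega> ^ Suc m) = W ^ m * (\<Sum>i\<in>I. w i * X i \<omega> ^ Suc m)"
      by (simp add: sum_distrib_left mult_ac)
    finally show "ennreal ((\<Sum>i\<in>I. w i * X i \<omega>) ^ Suc m) \<le> (\<Sum>i\<in>I. ennreal (W ^ m * w i) * ennreal (X i \<omega> ^ Suc m))"
      using power_mean_weighted[of I w "\<lambda>i. X i \<omega>" m] assms(1-3) by (simp add: W_def ennreal_leI)
  qed
  also have "\<dots> = (\<Sum>i\<in>I. ennreal (W ^ m * w i) * (\<integral>\<^sup>+\<omega>. ennreal (X i \<omega> ^ Suc m) \<partial>M))"
    by (subst nn_integral_sum) (auto intro!: sum.cong nn_integral_cmult)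
  also have "\<dots> \<le> (\<Sum>i\<in>I. ennreal (W ^ m * w i) * ennreal c)"
    by (intro sum_mono mult_left_mono c) auto
  also have "\<dots> = (\<Sum>i\<in>I. ennreal (W ^ m * w i * c))"
    using assms(2) c W by (intro sum.cong) (auto simp: ennreal_mult)
  also have "\<dots> = ennreal (\<Sum>i\<in>I. W ^ m * w i * c)"
    using assms(2) c W by (intro sum_ennreal) auto
  also have "(\<Sum>i\<in>I. W ^ m * w i * c) = W ^ Suc m * c"
    by (simp add: W_def sum_distrib_left sum_distrib_right mult_ac)
  finally show ?thesis by (simp only: W_def)
qed

lemma (in prob_space) nn_integral_const_plus_power:
  fixes X :: "'a \<Rightarrow> real"
  assumes X: "\<And>\<omega>. 0 \<le> X \<omega>" "X \<in> borel_measurable M" and c: "0 \<le> c" "0 \<le> d"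
    and int: "(\<integral>\<^sup>+\<omega>. ennreal (X \<omega> ^ m) \<partial>M) \<le> ennreal d"
  shows "(\<integral>\<^sup>+\<omega>. ennreal ((c + X \<omega>) ^ m) \<partial>M) \<le> ennreal (2 ^ m * (c ^ m + d))"
proof -
  have [measurable]: "X \<in> borel_measurable M" by fact
  have pt: "(c + x) ^ m \<le> 2 ^ m * (c ^ m + x ^ m)" if "0 \<le> x" for x
  proof -
    have "(c + x) ^ m \<le> (2 * max c x) ^ m" using that c by (intro power_mono) auto
    also have "\<dots> = 2 ^ m * (max c x) ^ m" by (simp add: power_mult_distrib)
    also have "(max c x) ^ m \<le> c ^ m + x ^ m" using that c by (auto simp: max_def)
    finally show ?thesis by simp
  qed
  have "(\<integral>\<^sup>+\<omega>. ennreal ((c + X \<omega>) ^ m) \<partial>M) \<le> (\<integral>\<^sup>+\<omega>. ennreal (2 ^ m) * (ennreal (c ^ m) + ennreal (X \<omega> ^ m)) \<partial>M)"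
    using pt X(1) c by (intro nn_integral_mono) (auto simp flip: ennreal_mult ennreal_plus intro!: ennreal_leI)
  also have "\<dots> = ennreal (2 ^ m) * (ennreal (c ^ m) + (\<integral>\<^sup>+\<omega>. ennreal (X \<omega> ^ m) \<partial>M))"
    by (subst nn_integral_cmult nn_integral_add, measurable)+ (simp add: emeasure_space_1)
  also have "\<dots> \<le> ennreal (2 ^ m) * (ennreal (c ^ m) + ennreal d)"
    by (intro mult_left_mono add_mono int) auto
  also have "\<dots> = ennreal (2 ^ m * (c ^ m + d))"
    using c by (simp flip: ennreal_mult ennreal_plus)
  finally show ?thesis .
qed

section \<open>The Cahn--Hilliard drift\<close>

text \<open>Coercivity is proved by comparing \<open>u\<close> with \<open>R max 1 \<bar>z\<bar>\<close>. If \<open>\<bar>u\<bar>\<close> is larger, the leading term fixes the sign of \<open>f(u)\<close>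
  to be that of \<open>u\<close>, which is also the sign of \<open>u - z\<close>; otherwise every term is at most a multiple of
  \<open>(max 1 \<bar>z\<bar>)\<^sup>4\<close>.\<close>

lemma quartic_potential_cubic_drift:
  fixes c\<^sub>0 c\<^sub>1 c\<^sub>2 c\<^sub>3 c\<^sub>4 L\<^sub>f :: real and F :: "real poly"
  assumes L: "0 < L" and eig: "neumann_eigensystem L lam e"
    and F: "F = [:c\<^sub>0, c\<^sub>1, c\<^sub>2, c\<^sub>3, c\<^sub>4:]" and c4: "0 < c\<^sub>4"
    and Lf: "\<forall>\<xi>. - poly (pderiv (pderiv F)) \<xi> \<le> L\<^sub>f"
  shows "\<exists>\<kappa>. cubic_drift L lam e \<kappa> (poly (pderiv F)) (poly (pderiv (pderiv F)))"
proof -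
  define f f' where "f = poly (pderiv F)" and "f' = poly (pderiv (pderiv F))"
  have f: "f u = 4 * c\<^sub>4 * u^3 + 3 * c\<^sub>3 * u\<^sup>2 + 2 * c\<^sub>2 * u + c\<^sub>1" for u
    by (simp add: f_def F pderiv_pCons algebra_simps power2_eq_square power3_eq_cube)
  have f': "f' u = 12 * c\<^sub>4 * u\<^sup>2 + 6 * c\<^sub>3 * u + 2 * c\<^sub>2" for u
    by (simp add: f'_def F pderiv_pCons algebra_simps power2_eq_square)
  define S where "S = 3 * \<bar>c\<^sub>3\<bar> + 2 * \<bar>c\<^sub>2\<bar> + \<bar>c\<^sub>1\<bar>"
  define G where "G = 4 * c\<^sub>4 + S"
  define R where "R = 1 + S / (4 * c\<^sub>4)"
  have S: "0 \<le> S" and G: "0 \<le> G" and R: "1 \<le> R" "S \<le> 4 * c\<^sub>4 * R"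
    using c4 by (auto simp: S_def G_def R_def field_simps)
  have low: "\<bar>3 * c\<^sub>3 * u\<^sup>2 + 2 * c\<^sub>2 * u + c\<^sub>1\<bar> \<le> S * m\<^sup>2" if m: "1 \<le> m" "\<bar>u\<bar> \<le> m" for u m
  proof -
    have m2: "1 \<le> m\<^sup>2" "u\<^sup>2 \<le> m\<^sup>2" "\<bar>u\<bar> \<le> m\<^sup>2"
      using m one_le_power[of m 2] power_mono[of "\<bar>u\<bar>" m 2] self_le_power[of m 2] by auto
    have "\<bar>3 * c\<^sub>3 * u\<^sup>2 + 2 * c\<^sub>2 * u + c\<^sub>1\<bar> \<le> \<bar>3 * c\<^sub>3 * u\<^sup>2\<bar> + \<bar>2 * c\<^sub>2 * u\<bar> + \<bar>c\<^sub>1\<bar>" by linarith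
    also have "\<dots> = 3 * \<bar>c\<^sub>3\<bar> * u\<^sup>2 + 2 * \<bar>c\<^sub>2\<bar> * \<bar>u\<bar> + \<bar>c\<^sub>1\<bar> * 1" by (simp add: abs_mult)
    also have "\<dots> \<le> 3 * \<bar>c\<^sub>3\<bar> * m\<^sup>2 + 2 * \<bar>c\<^sub>2\<bar> * m\<^sup>2 + \<bar>c\<^sub>1\<bar> * m\<^sup>2"
      using m2 by (intro add_mono mult_left_mono) auto
    finally show ?thesis by (simp add: S_def algebra_simps)
  qed
  have f_abs: "\<bar>f u\<bar> \<le> G * m^3" if m: "1 \<le> m" "\<bar>u\<bar> \<le> m" for u m
  proof -
    have "\<bar>4 * c\<^sub>4 * u^3\<bar> \<le> 4 * c\<^sub>4 * m^3"
      using c4 power_mono[OF m(2), of 3] by (simp add: abs_mult power_abs)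
    moreover have "S * m\<^sup>2 \<le> S * m^3" using S m by (intro mult_left_mono power_increasing) auto
    moreover have "\<bar>f u\<bar> \<le> \<bar>4 * c\<^sub>4 * u^3\<bar> + \<bar>3 * c\<^sub>3 * u\<^sup>2 + 2 * c\<^sub>2 * u + c\<^sub>1\<bar>"
      using abs_triangle_ineq[of "4 * c\<^sub>4 * u^3" "3 * c\<^sub>3 * u\<^sup>2 + 2 * c\<^sub>2 * u + c\<^sub>1"] by (simp add: f add.assoc)
    ultimately have "\<bar>f u\<bar> \<le> 4 * c\<^sub>4 * m^3 + S * m^3" using low[OF m] by linarith
    then show ?thesis by (simp only: G_def distrib_right)
  qed
  have f_sign: "0 \<le> f u * u" if u: "R \<le> \<bar>u\<bar>" for u
  proof -
    have "S * u\<^sup>2 \<le> 4 * c\<^sub>4 * \<bar>u\<bar> * u\<^sup>2"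
      using R(2) u c4 by (intro mult_right_mono order_trans[OF R(2)] mult_left_mono) auto
    then have "\<bar>3 * c\<^sub>3 * u\<^sup>2 + 2 * c\<^sub>2 * u + c\<^sub>1\<bar> * \<bar>u\<bar> \<le> 4 * c\<^sub>4 * \<bar>u\<bar> * u\<^sup>2 * \<bar>u\<bar>"
      using low[of "\<bar>u\<bar>" u] R u by (intro mult_right_mono) auto
    also have "\<dots> = 4 * c\<^sub>4 * (u * u) * u\<^sup>2"
      unfolding abs_mult_self_eq[of u, symmetric] by (simp only: mult_ac)
    finally have "\<bar>(3 * c\<^sub>3 * u\<^sup>2 + 2 * c\<^sub>2 * u + c\<^sub>1) * u\<bar> \<le> 4 * c\<^sub>4 * (u * u) * u\<^sup>2"
      unfolding abs_mult .
    then have "0 \<le> 4 * c\<^sub>4 * (u * u) * u\<^sup>2 + (3 * c\<^sub>3 * u\<^sup>2 + 2 * c\<^sub>2 * u + c\<^sub>1) * u"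
      by linarith
    then show ?thesis by (simp add: f distrib_right power2_eq_square power3_eq_cube mult.assoc)
  qed
  define \<kappa> where "\<kappa> = G * R^3 * (R + 1) + G\<^sup>2 + (12 * c\<^sub>4 + 3 * \<bar>c\<^sub>3\<bar> + 2 * \<bar>c\<^sub>2\<bar>) + \<bar>L\<^sub>f\<bar>"
  have parts: "0 \<le> G * R^3 * (R + 1)" "0 \<le> G\<^sup>2" "0 \<le> 12 * c\<^sub>4 + 3 * \<bar>c\<^sub>3\<bar> + 2 * \<bar>c\<^sub>2\<bar>" "0 \<le> \<bar>L\<^sub>f\<bar>"
    using G R c4 by auto
  have \<kappa>: "G * R^3 * (R + 1) \<le> \<kappa>" "G\<^sup>2 \<le> \<kappa>" "12 * c\<^sub>4 + 3 * \<bar>c\<^sub>3\<bar> + 2 * \<bar>c\<^sub>2\<bar> \<le> \<kappa>" "\<bar>L\<^sub>f\<bar> \<le> \<kappa>" "0 \<le> \<kappa>"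
    using parts unfolding \<kappa>_def by linarith+
  have coercive: "- \<kappa> * (1 + z^4) \<le> f u * (u - z)" for u z
  proof -
    define m where "m = max 1 \<bar>z\<bar>"
    have m: "1 \<le> m" "\<bar>z\<bar> \<le> m" by (auto simp: m_def)
    have m4: "m^4 \<le> 1 + z^4" by (auto simp: m_def max_def)
    show ?thesis
    proof (cases "R * m \<le> \<bar>u\<bar>")
      case True
      have "R * 1 \<le> R * m" "1 * m \<le> R * m" using R m by (auto intro!: mult_mono)
      then have u: "R \<le> \<bar>u\<bar>" "\<bar>z\<bar> \<le> \<bar>u\<bar>" using True m R by linarith+
      have u0: "u \<noteq> 0" using u(1) R by auto
      have "z * u \<le> \<bar>u\<bar> * \<bar>u\<bar>" using u(2) by (metis abs_ge_self abs_ge_zero abs_mult mult_right_mono order_trans)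
      then have "0 \<le> (f u * u) * (u\<^sup>2 - z * u)" by (intro mult_nonneg_nonneg[OF f_sign[OF u(1)]]) (simp add: power2_eq_square)
      also have "\<dots> = (f u * (u - z)) * u\<^sup>2" by (simp add: power2_eq_square algebra_simps)
      finally have "0 \<le> f u * (u - z)" using u0 by (simp add: zero_le_mult_iff)
      moreover have "0 \<le> \<kappa> * (1 + z^4)" using \<kappa>(5) by (simp add: zero_le_even_power add_nonneg_nonneg)
      ultimately show ?thesis by simp
    next
      case False
      have Rm: "1 \<le> R * m" using R m mult_mono[of 1 R 1 m] by simp
      have "\<bar>f u * (u - z)\<bar> \<le> (G * (R * m)^3) * ((R + 1) * m)"
        unfolding abs_mult
      proof (intro mult_mono)
        show "\<bar>f u\<bar> \<le> G * (R * m)^3" using False Rm by (intro f_abs) auto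
        show "\<bar>u - z\<bar> \<le> (R + 1) * m" using False m by (simp add: algebra_simps)
      qed (use G Rm in auto)
      also have "\<dots> = G * R^3 * (R + 1) * m^4" by (simp add: power_mult_distrib power4_eq_xxxx power3_eq_cube)
      also have "\<dots> \<le> \<kappa> * (1 + z^4)" using \<kappa>(1,5) m4 parts(1) by (intro mult_mono) auto
      finally show ?thesis by (simp add: abs_le_iff)
    qed
  qed
  have growth: "(f u)\<^sup>2 \<le> \<kappa> * (1 + u^6)" for u
  proof -
    define m where "m = max 1 \<bar>u\<bar>"
    have m: "1 \<le> m" "\<bar>u\<bar> \<le> m" by (auto simp: m_def)
    have m6: "m^6 \<le> 1 + u^6" by (auto simp: m_def max_def)
    have "(f u)\<^sup>2 = \<bar>f u\<bar>\<^sup>2" by simp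
    also have "\<dots> \<le> (G * m^3)\<^sup>2" using f_abs[OF m] by (intro power_mono) auto
    also have "\<dots> = G\<^sup>2 * m^6" by (simp add: power_mult_distrib flip: power_mult)
    also have "\<dots> \<le> \<kappa> * (1 + u^6)" using \<kappa> m6 m by (intro mult_mono) auto
    finally show ?thesis .
  qed
  have upper: "f' u \<le> \<kappa> * (1 + u\<^sup>2)" for u
  proof -
    have "2 * (c\<^sub>3 * u) \<le> \<bar>c\<^sub>3\<bar> * (1 + u\<^sup>2)"
    proof -
      have "2 * \<bar>u\<bar> \<le> 1 + u\<^sup>2" using zero_le_power2[of "\<bar>u\<bar> - 1"] by (simp add: power2_eq_square algebra_simps)
      then have "\<bar>c\<^sub>3\<bar> * (2 * \<bar>u\<bar>) \<le> \<bar>c\<^sub>3\<bar> * (1 + u\<^sup>2)" by (intro mult_left_mono) auto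
      moreover have "c\<^sub>3 * u \<le> \<bar>c\<^sub>3\<bar> * \<bar>u\<bar>" using abs_ge_self[of "c\<^sub>3 * u"] by (simp add: abs_mult)
      ultimately show ?thesis by simp
    qed
    moreover have "2 * c\<^sub>2 \<le> 2 * \<bar>c\<^sub>2\<bar> * (1 + u\<^sup>2)"
      using mult_left_mono[of 1 "1 + u\<^sup>2" "2 * \<bar>c\<^sub>2\<bar>"] by simp
    moreover have "12 * c\<^sub>4 * u\<^sup>2 \<le> 12 * c\<^sub>4 * (1 + u\<^sup>2)" using c4 by simp
    ultimately have "f' u \<le> (12 * c\<^sub>4 + 3 * \<bar>c\<^sub>3\<bar> + 2 * \<bar>c\<^sub>2\<bar>) * (1 + u\<^sup>2)"
      by (simp add: f' algebra_simps)
    also have "\<dots> \<le> \<kappa> * (1 + u\<^sup>2)" using \<kappa>(3) by (intro mult_right_mono) auto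
    finally show ?thesis .
  qed
  have "cubic_drift L lam e \<kappa> f f'"
  proof unfold_locales
    show "(f has_real_derivative f' u) (at u)" for u
      unfolding f_def f'_def by (rule poly_DERIV)
    show "continuous_on UNIV f'" unfolding f'_def by (intro continuous_intros)
    show "- \<kappa> \<le> f' u" for u using Lf \<kappa>(4) unfolding f'_def by (metis abs_ge_self minus_le_iff order_trans)
  qed (use L eig \<kappa>(5) coercive growth upper in auto)
  then show ?thesis unfolding f_def f'_def by blast
qed

section \<open>From functions to Fourier coefficients\<close>

context neumann
begin

lemma ip_cong: "(\<And>x. x \<in> {0..L} \<Longrightarrow> v x = w x) \<Longrightarrow> ip L v (e j) = ip L w (e j)"
  unfolding ip_def by (intro intO_cong) simp

lemma in_PN_comb:
  assumes "in_PN L e N v" "x \<in> {0..L}"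
  shows "v x = comb {..N} (\<lambda>j. ip L v (e j)) x"
proof -
  obtain a where a: "\<And>x. x \<in> {0..L} \<Longrightarrow> v x = comb {..N} a x"
    using assms(1) by (auto simp: in_PN_def comb_def)
  have "ip L v (e j) = a j" if "j \<le> N" for j
    using ip_cong[of v "comb {..N} a" j] a ip_comb[of "{..N}" a j] that by simp
  then show ?thesis using a[OF assms(2)] by (simp add: comb_def)
qed

lemma A_op_comb:
  assumes "\<And>x. x \<in> {0..L} \<Longrightarrow> v x = comb {..N} a x"
  shows "A_op L lam e v x = comb {..N} (\<lambda>j. lam j * a j) x"
proof -
  have ip: "ip L v (e j) = (if j \<le> N then a j else 0)" for j
    using ip_cong[OF assms, where j = j] ip_comb[of "{..N}" a j] by simp
  have "A_op L lam e v x = (\<Sum>j\<le>N. lam j * ip L v (e j) * e j x)"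
    unfolding A_op_def spectral_op_def by (intro suminf_finite) (auto simp: ip)
  then show ?thesis by (simp add: comb_def ip)
qed

lemma P_op_comb: "P_op L e N v = comb {..N} (\<lambda>j. ip L v (e j))"
  by (simp add: P_op_def comb_def fun_eq_iff)

text \<open>Removing the mean changes only the coefficient with index \<open>0\<close>, as \<open>e\<^sub>0\<close> is constant.\<close>

lemma ip_mean_free:
  assumes "v \<in> L2_fun L"
  shows "ip L (mean_free L v) (e (Suc j)) = ip L v (e (Suc j))"
proof -
  define c where "c = (1 / L) * intO v"
  have "intO (e (Suc j)) = sqrt L * ip L (e 0) (e (Suc j))"
  proof -
    have "intO (\<lambda>x. sqrt L * (e 0 x * e (Suc j) x)) = intO (e (Suc j))"
      using L_pos by (intro intO_cong) (simp add: e_0)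
    then show ?thesis by (simp add: ip_def)
  qed
  then have 0: "intO (e (Suc j)) = 0" by (simp add: ip_e)
  have "ip L (mean_free L v) (e (Suc j)) = intO (\<lambda>x. v x * e (Suc j) x - c * e (Suc j) x)"
    by (simp add: ip_def mean_free_def c_def left_diff_distrib)
  also have "\<dots> = intO (\<lambda>x. v x * e (Suc j) x) - intO (\<lambda>x. c * e (Suc j) x)"
    by (intro Bochner_Integration.integral_diff integrable_L2_mult assms e_L2 continuous_imp_integrable_real continuous_intros)
  finally show ?thesis by (simp add: 0 ip_def)
qed

lemma sum_Suc_shift: "(\<Sum>j=1..N. g j) = (\<Sum>j<N. g (Suc j))" for g :: "nat \<Rightarrow> real"
  by (rule sum.reindex_bij_witness[of _ Suc "\<lambda>j. j - 1"]) auto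

lemma Hdot_norm_in_PN:
  assumes "in_PN L e N v"
  shows "Hdot_norm L lam e s (mean_free L v) = sqrt (sob N s (\<lambda>j. ip L v (e j)))"
proof -
  have eq: "mean_free L v x = mean_free L (comb {..N} (\<lambda>j. ip L v (e j))) x" if "x \<in> {0..L}" for x
    using in_PN_comb[OF assms] intO_cong[of v "comb {..N} (\<lambda>j. ip L v (e j))"] that
    by (simp add: mean_free_def)
  have ip: "ip L (mean_free L v) (e (Suc j)) = (if Suc j \<le> N then ip L v (e (Suc j)) else 0)" for j
    using ip_cong[OF eq, where j = "Suc j"] ip_mean_free[OF L2_fun_continuous[OF comb_cont]]
      ip_comb[of "{..N}" "\<lambda>j. ip L v (e j)" "Suc j"] by simp
  have "(\<Sum>j. lam (Suc j) powr s * (ip L (mean_free L v) (e (Suc j)))\<^sup>2)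
      = (\<Sum>j<N. lam (Suc j) powr s * (ip L (mean_free L v) (e (Suc j)))\<^sup>2)"
    by (intro suminf_finite) (auto simp: ip)
  also have "\<dots> = sob N s (\<lambda>j. ip L v (e j))"
    unfolding sob_def sum_Suc_shift by (intro sum.cong) (auto simp: ip)
  finally show ?thesis by (simp add: Hdot_norm_def)
qed

lemma H_norm_diff_in_PN:
  assumes v: "in_PN L e N v" and w: "in_PN L e N w" and mean: "ip L v (e 0) = ip L w (e 0)"
  shows "H_norm L (\<lambda>x. v x - w x) = sqrt (sob N 0 (\<lambda>j. ip L v (e j) - ip L w (e j)))"
proof -
  define d where "d = (\<lambda>j. ip L v (e j) - ip L w (e j))"
  have "ip L (\<lambda>x. v x - w x) (\<lambda>x. v x - w x) = intO (\<lambda>x. (comb {..N} d x)\<^sup>2)"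
    unfolding ip_def
    by (intro intO_cong)
       (simp add: in_PN_comb[OF v] in_PN_comb[OF w] d_def comb_def power2_eq_square left_diff_distrib sum_subtractf)
  also have "\<dots> = (\<Sum>j\<le>N. (d j)\<^sup>2)" by (rule intO_comb_sq) simp
  also have "\<dots> = sob N 0 d"
    using mean unfolding sob_0 sum_Suc_shift by (simp add: d_def sum.atMost_shift)
  finally show ?thesis by (simp add: H_norm_def d_def)
qed

lemma sob_initial_le:
  assumes "X0 \<in> L2_fun L" "in_Hdot L lam e \<gamma> (mean_free L X0)"
  shows "\<exists>M\<ge>0. \<forall>N. sob N \<gamma> (\<lambda>j. ip L X0 (e j)) \<le> M"
proof (intro exI conjI allI)
  let ?s = "\<lambda>j. lam (Suc j) powr \<gamma> * (ip L X0 (e (Suc j)))\<^sup>2"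
  have "summable ?s" using assms(2) by (simp add: in_Hdot_def ip_mean_free[OF assms(1)])
  then show "sob N \<gamma> (\<lambda>j. ip L X0 (e j)) \<le> (\<Sum>j. ?s j)" for N
    unfolding sob_def sum_Suc_shift by (intro sum_le_suminf) auto
  show "0 \<le> (\<Sum>j. ?s j)" by (intro suminf_nonneg \<open>summable ?s\<close>) auto
qed

end

context cubic_drift
begin

definition add_mean :: "real \<Rightarrow> (nat \<Rightarrow> real) \<Rightarrow> nat \<Rightarrow> real" where
  "add_mean \<mu> \<zeta> j = (if j = 0 then \<mu> else 0) + \<zeta> j"

text \<open>A bound for the variance of mode \<open>j\<close> of the stochastic convolution on \<open>[0,T]\<close>; the mode \<open>0\<close> is a Brownian motion.\<close>

definition mode_variance :: "real \<Rightarrow> nat \<Rightarrow> real" where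
  "mode_variance T j = (if j = 0 then T else 1 / (2 * (lam j)\<^sup>2))"

text \<open>Taking inner products with \<open>e\<^sub>j\<close> turns the scheme into its coordinate form. For \<open>j = 0\<close> it says that the mean is
  conserved, which permits moving it from \<open>Y\<close> to the noise coefficients \<open>b\<close>.\<close>

lemma implicit_scheme_coeffs:
  assumes sch: "implicit_scheme L lam e F N K h X0 z y" and F: "poly (pderiv F) = f"
    and z: "\<And>k x. k \<le> K \<Longrightarrow> x \<in> {0..L} \<Longrightarrow> z k x = (\<Sum>j\<le>N. \<zeta> k j * e j x)"
  defines "a \<equiv> \<lambda>k j. ip L (y k) (e j)"
    and "b \<equiv> \<lambda>k. add_mean (ip L X0 (e 0)) (\<zeta> k)"
  shows "coeff_scheme N K h a b" and "k \<le> K \<Longrightarrow> a k 0 = ip L X0 (e 0)" and "j \<le> N \<Longrightarrow> a 0 j = ip L X0 (e j)"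
proof -
  have PN: "in_PN L e N (y k)" if "k \<le> K" for k using sch that by (simp add: implicit_scheme_def)
  have y: "y k x = comb {..N} (a k) x" if "k \<le> K" "x \<in> {0..L}" for k x
    unfolding a_def by (rule in_PN_comb[OF PN[OF that(1)] that(2)])
  show init: "a 0 j = ip L X0 (e j)" if "j \<le> N" for j
  proof -
    have "a 0 j = ip L (comb {..N} (\<lambda>j. ip L X0 (e j))) (e j)"
      unfolding a_def using sch by (intro ip_cong) (simp add: implicit_scheme_def P_op_comb)
    then show ?thesis using that by (simp add: ip_comb)
  qed
  define g where "g = (\<lambda>k j. ip L (\<lambda>u. f (y k u + z k u)) (e j))"
  have step: "a (Suc k) j = a k j - h * ((lam j)\<^sup>2 * a (Suc k) j) - h * (lam j * g (Suc k) j)"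
    if k: "k < K" and j: "j \<le> N" for k j
  proof -
    define c where "c = (\<lambda>j. a k j - h * ((lam j)\<^sup>2 * a (Suc k) j) - h * (lam j * g (Suc k) j))"
    have "y (Suc k) x = comb {..N} c x" if x: "x \<in> {0..L}" for x
    proof -
      have "A_op L lam e (A_op L lam e (y (Suc k))) x = comb {..N} (\<lambda>j. lam j * (lam j * a (Suc k) j)) x"
        using k by (intro A_op_comb A_op_comb y) auto
      moreover have "A_op L lam e (P_op L e N (\<lambda>u. f (y (Suc k) u + z (Suc k) u))) x = comb {..N} (\<lambda>j. lam j * g (Suc k) j) x"
        unfolding P_op_comb g_def by (rule A_op_comb) simp
      moreover have "y (Suc k) x = y k x - A_op L lam e (A_op L lam e (y (Suc k))) x * h
          - A_op L lam e (P_op L e N (\<lambda>u. f (y (Suc k) u + z (Suc k) u))) x * h"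
        using sch k x by (auto simp: implicit_scheme_def F)
      moreover have "y k x = comb {..N} (a k) x" using k x by (intro y) auto
      ultimately show ?thesis
        by (simp add: c_def comb_def sum_subtractf sum.distrib sum_distrib_left power2_eq_square algebra_simps)
    qed
    then have "ip L (y (Suc k)) (e j) = ip L (comb {..N} c) (e j)" by (rule ip_cong)
    then show ?thesis using j by (simp add: ip_comb a_def[symmetric]) (simp add: c_def a_def)
  qed
  show mean: "a k 0 = ip L X0 (e 0)" if "k \<le> K" for k
    using that
  proof (induction k)
    case 0 then show ?case using init by simp
  next
    case (Suc k) then show ?case using step[of k 0] by simp
  qed
  have drift: "g k j = drift N (a k) (b k) j" if k: "k \<le> K" for k j
    unfolding g_def drift_def
  proof (rule ip_cong)
    fix x assume x: "x \<in> {0..L}"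
    have split: "(\<Sum>j\<le>N. c j * e j x) = c 0 * e 0 x + (\<Sum>j=1..N. c j * e j x)" for c
      unfolding sum_Suc_shift by (rule sum.atMost_shift)
    have "y k x + z k x = u_fun N (a k) (b k) x"
      unfolding u_fun_def y[OF k x] z[OF k x] comb_def split
      using mean[OF k] by (simp add: b_def add_mean_def distrib_right)
    then show "f (y k x + z k x) = f (u_fun N (a k) (b k) x)" by simp
  qed
  show "coeff_scheme N K h a b"
    unfolding coeff_scheme_def
  proof (intro allI impI ballI)
    fix k j assume "k < K" "j \<in> {1..N}"
    then show "a (Suc k) j + h * (lam j)\<^sup>2 * a (Suc k) j + h * lam j * drift N (a (Suc k)) (b (Suc k)) j = a k j"
      using step[of k j] drift[of "Suc k" j] by simp
  qed
qed

section \<open>Moments of the discretised noise\<close>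

text \<open>Writing \<open>\<lambda>\<^sub>j \<zeta>\<^sub>j\<^sup>2 = \<lambda>\<^sub>j\<^sup>-\<^sup>1 (\<lambda>\<^sub>j \<zeta>\<^sub>j)\<^sup>2\<close> exhibits the noise size as a weighted sum with summable weights \<open>\<lambda>\<^sub>j\<^sup>-\<^sup>1\<close> of terms
  whose moments are bounded uniformly in \<open>j\<close>, because the variance of \<open>\<zeta>\<^sub>j\<close> is of order \<open>\<lambda>\<^sub>j\<^sup>-\<^sup>2\<close>, and of order \<open>T\<close> for \<open>j = 0\<close>. The number \<open>\<mu>\<close> stands for the coefficient of the conserved mean.\<close>

lemma noise_size_moment:
  assumes T: "0 \<le> T"
  shows "\<exists>C\<ge>0. \<forall>(M :: 'w measure) N \<zeta>. prob_space M \<longrightarrow>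
     (\<forall>j\<le>N. gaussian_moments M (\<zeta> j) (mode_variance T j)) \<longrightarrow>
     (\<integral>\<^sup>+\<omega>. ennreal (noise_size N (add_mean \<mu> (\<lambda>j. \<zeta> j \<omega>)) ^ Suc n) \<partial>M) \<le> ennreal C"
proof -
  define \<Lambda> where "\<Lambda> = (\<Sum>j. lam (Suc j) powr - 1)"
  define c where "c = 4 * fact (2 * Suc n) * (4 * T + 2) ^ Suc n"
  define C where "C = 2 ^ Suc n * ((1 + 2 * \<mu>\<^sup>2) ^ Suc n + (2 + \<Lambda>) ^ Suc n * c)"
  have c: "0 \<le> c" using T by (simp add: c_def)
  have \<Lambda>: "0 \<le> \<Lambda>" unfolding \<Lambda>_def by (intro suminf_nonneg summable_lam) auto
  have "(\<integral>\<^sup>+\<omega>. ennreal (noise_size N (add_mean \<mu> (\<lambda>j. \<zeta> j \<omega>)) ^ Suc n) \<partial>M) \<le> ennreal C"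
    if M: "prob_space M" and \<zeta>: "\<And>j. j \<le> N \<Longrightarrow> gaussian_moments M (\<zeta> j) (mode_variance T j)" for M :: "'w measure" and N \<zeta>
  proof -
    interpret M: prob_space M by fact
    define w where "w = (\<lambda>j. if j = 0 then 2 else 1 / lam j)"
    define l where "l = (\<lambda>j. if j = 0 then 1 else lam j)"
    define X where "X = (\<lambda>j \<omega>. (l j * \<zeta> j \<omega>)\<^sup>2)"
    define Q where "Q = (\<lambda>\<omega>. \<Sum>j\<le>N. w j * X j \<omega>)"
    have w: "0 \<le> w j" for j using lam_nonneg[of j] by (simp add: w_def)
    have XM: "X j \<in> borel_measurable M" if "j \<le> N" for j
    proof -
      have [measurable]: "\<zeta> j \<in> borel_measurable M" using \<zeta>[OF that] by (simp add: gaussian_moments_def)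
      show ?thesis unfolding X_def by measurable
    qed
    have QM: "Q \<in> borel_measurable M" unfolding Q_def using XM by (intro borel_measurable_sum borel_measurable_times) auto
    have Q0: "0 \<le> Q \<omega>" for \<omega> unfolding Q_def X_def using w by (intro sum_nonneg mult_nonneg_nonneg) auto
    have Xm: "(\<integral>\<^sup>+\<omega>. ennreal (X j \<omega> ^ Suc n) \<partial>M) \<le> ennreal c" if j: "j \<le> N" for j
    proof -
      define v where "v = mode_variance T j"
      have [measurable]: "\<zeta> j \<in> borel_measurable M" using \<zeta>[OF j] by (simp add: gaussian_moments_def)
      have lv: "0 \<le> (l j)\<^sup>2 * (4 * v)" "(l j)\<^sup>2 * (4 * v) \<le> 4 * T + 2"
        using T lam_pos[of j] by (auto simp: l_def v_def mode_variance_def)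
      have "X j \<omega> ^ Suc n = ((l j)\<^sup>2) ^ Suc n * \<zeta> j \<omega> ^ (2 * Suc n)" for \<omega>
        unfolding X_def power_mult power_mult_distrib ..
      then have "(\<integral>\<^sup>+\<omega>. ennreal (X j \<omega> ^ Suc n) \<partial>M) = (\<integral>\<^sup>+\<omega>. ennreal (((l j)\<^sup>2) ^ Suc n) * ennreal (\<zeta> j \<omega> ^ (2 * Suc n)) \<partial>M)"
        by (simp only: ennreal_mult zero_le_even_power even_mult_iff even_numeral simp_thms zero_le_power2 zero_le_power)
      also have "\<dots> = ennreal (((l j)\<^sup>2) ^ Suc n) * (\<integral>\<^sup>+\<omega>. ennreal (\<zeta> j \<omega> ^ (2 * Suc n)) \<partial>M)"
        by (rule nn_integral_cmult) measurable
      also have "\<dots> \<le> ennreal (((l j)\<^sup>2) ^ Suc n) * ennreal (4 * fact (2 * Suc n) * (4 * v) ^ Suc n)"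
        using \<zeta>[OF j] unfolding gaussian_moments_def v_def by (intro mult_left_mono[OF _ zero_le]) blast
      also have "\<dots> = ennreal (4 * fact (2 * Suc n) * ((l j)\<^sup>2 * (4 * v)) ^ Suc n)"
        by (subst ennreal_mult'[symmetric], simp) (simp only: power_mult_distrib mult_ac)
      also have "\<dots> \<le> ennreal c"
        unfolding c_def using lv by (intro ennreal_leI mult_left_mono power_mono) auto
      finally show ?thesis .
    qed
    have W: "(\<Sum>j\<le>N. w j) \<le> 2 + \<Lambda>"
    proof -
      have "(\<Sum>j\<le>N. w j) = 2 + (\<Sum>j<N. lam (Suc j) powr - 1)"
        unfolding sum.atMost_shift
        by (intro arg_cong2[where f = "(+)"] sum.cong) (simp_all add: w_def powr_minus_divide lam_nonneg)
      also have "(\<Sum>j<N. lam (Suc j) powr - 1) \<le> \<Lambda>"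
        unfolding \<Lambda>_def by (intro sum_le_suminf summable_lam) auto
      finally show ?thesis by simp
    qed
    have "(\<integral>\<^sup>+\<omega>. ennreal (Q \<omega> ^ Suc n) \<partial>M) \<le> ennreal ((\<Sum>j\<le>N. w j) ^ Suc n * c)"
      unfolding Q_def using w XM Xm c by (intro nn_integral_weighted_power) (auto simp: X_def)
    also have "\<dots> \<le> ennreal ((2 + \<Lambda>) ^ Suc n * c)"
      using W w c by (intro ennreal_leI mult_right_mono power_mono sum_nonneg) auto
    finally have Qm: "(\<integral>\<^sup>+\<omega>. ennreal (Q \<omega> ^ Suc n) \<partial>M) \<le> ennreal ((2 + \<Lambda>) ^ Suc n * c)" .
    have pt: "noise_size N (add_mean \<mu> (\<lambda>j. \<zeta> j \<omega>)) \<le> (1 + 2 * \<mu>\<^sup>2) + Q \<omega>" for \<omega>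
    proof -
      have "sob N 1 (add_mean \<mu> (\<lambda>j. \<zeta> j \<omega>)) = (\<Sum>j<N. w (Suc j) * X (Suc j) \<omega>)"
        unfolding sob_1 sum_Suc_shift add_mean_def using lam_pos
        by (intro sum.cong) (simp_all add: w_def X_def l_def power_mult_distrib power2_eq_square less_imp_neq[symmetric])
      moreover have "Q \<omega> = w 0 * X 0 \<omega> + (\<Sum>j<N. w (Suc j) * X (Suc j) \<omega>)"
        unfolding Q_def by (rule sum.atMost_shift)
      moreover have "(\<mu> + \<zeta> 0 \<omega>)\<^sup>2 \<le> 2 * \<mu>\<^sup>2 + w 0 * X 0 \<omega>"
        using zero_le_power2[of "\<mu> - \<zeta> 0 \<omega>"] by (simp add: w_def X_def l_def power2_eq_square algebra_simps)
      ultimately show ?thesis by (simp add: noise_size_def add_mean_def)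
    qed
    have "(\<integral>\<^sup>+\<omega>. ennreal (noise_size N (add_mean \<mu> (\<lambda>j. \<zeta> j \<omega>)) ^ Suc n) \<partial>M)
        \<le> (\<integral>\<^sup>+\<omega>. ennreal (((1 + 2 * \<mu>\<^sup>2) + Q \<omega>) ^ Suc n) \<partial>M)"
    proof (intro nn_integral_mono ennreal_leI power_mono pt)
      show "0 \<le> noise_size N (add_mean \<mu> (\<lambda>j. \<zeta> j \<omega>))" for \<omega>
        by (rule order_trans[OF zero_le_one noise_size_ge_1])
    qed
    also have "\<dots> \<le> ennreal C"
      unfolding C_def using \<Lambda> c Q0 by (intro M.nn_integral_const_plus_power QM Qm) auto
    finally show ?thesis .
  qed
  moreover have "0 \<le> C" using c \<Lambda> by (simp add: C_def)
  ultimately show ?thesis by (intro exI[of _ C]) blast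
qed

text \<open>The variance of the stochastic convolution on one mode.\<close>

lemma exp_kernel_L2:
  assumes "0 \<le> t" "t \<le> T"
  shows "(\<integral>\<^sup>+u\<in>{0..t}. ennreal ((exp (- (t - u) * (lam j)\<^sup>2))\<^sup>2) \<partial>lborel) \<le> ennreal (mode_variance T j)"
proof (cases "j = 0")
  case True
  then show ?thesis using assms by (simp add: ennreal_leI mode_variance_def)
next
  case False
  then have l: "0 < lam j" by (simp add: lam_pos)
  define \<Phi> where "\<Phi> = (\<lambda>u. exp (2 * (- (t - u) * (lam j)\<^sup>2)) / (2 * (lam j)\<^sup>2))"
  have "(\<integral>\<^sup>+u\<in>{0..t}. ennreal ((exp (- (t - u) * (lam j)\<^sup>2))\<^sup>2) \<partial>lborel) = ennreal (\<Phi> t - \<Phi> 0)"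
  proof (rule nn_integral_FTC_Icc)
    fix u
    have "(\<Phi> has_real_derivative exp (2 * (- (t - u) * (lam j)\<^sup>2)) * (2 * (lam j)\<^sup>2) / (2 * (lam j)\<^sup>2)) (at u)"
      unfolding \<Phi>_def by (intro DERIV_cdivide) (auto intro!: derivative_eq_intros)
    moreover have "exp (2 * (- (t - u) * (lam j)\<^sup>2)) * (2 * (lam j)\<^sup>2) / (2 * (lam j)\<^sup>2) = (exp (- (t - u) * (lam j)\<^sup>2))\<^sup>2"
      unfolding exp_double using l by simp
    ultimately show "DERIV \<Phi> u :> (exp (- (t - u) * (lam j)\<^sup>2))\<^sup>2" by simp
  qed (use assms in auto)
  also have "\<dots> \<le> ennreal (1 / (2 * (lam j)\<^sup>2))"
    by (intro ennreal_leI) (simp add: \<Phi>_def)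
  finally show ?thesis using False by (simp add: mode_variance_def)
qed

text \<open>Apart from constants, the noise total is an average over time of powers of the noise size, so convexity reduces its moments to those at
  single times; no maximal inequality for the stochastic convolution is involved.\<close>

lemma noise_total_moment:
  assumes T: "0 < T"
  shows "\<exists>C\<ge>0. \<forall>(M :: 'w measure) N K h \<zeta>. prob_space M \<longrightarrow> 0 < h \<longrightarrow> real K * h \<le> T \<longrightarrow>
     (\<forall>k\<le>K. \<forall>j\<le>N. gaussian_moments M (\<zeta> k j) (mode_variance T j)) \<longrightarrow>
     (\<integral>\<^sup>+\<omega>. ennreal (noise_total N K h (\<lambda>k. add_mean \<mu> (\<lambda>j. \<zeta> k j \<omega>)) ^ Suc m) \<partial>M) \<le> ennreal C"
proof -
  define n where "n = 15 * m + 14"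
  have n: "Suc n = 15 * Suc m" by (simp add: n_def)
  obtain D where D: "0 \<le> D" and size: "\<forall>(M :: 'w measure) N \<zeta>. prob_space M \<longrightarrow>
     (\<forall>j\<le>N. gaussian_moments M (\<zeta> j) (mode_variance T j)) \<longrightarrow>
     (\<integral>\<^sup>+\<omega>. ennreal (noise_size N (add_mean \<mu> (\<lambda>j. \<zeta> j \<omega>)) ^ Suc n) \<partial>M) \<le> ennreal D"
    using noise_size_moment[OF less_imp_le[OF T], where n = n and \<mu> = \<mu>] by (elim exE conjE)
  define C where "C = 2 ^ Suc m * (1 ^ Suc m + T ^ Suc m * D)"
  have "(\<integral>\<^sup>+\<omega>. ennreal (noise_total N K h (\<lambda>k. add_mean \<mu> (\<lambda>j. \<zeta> k j \<omega>)) ^ Suc m) \<partial>M) \<le> ennreal C"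
    if M: "prob_space M" and h: "0 < h" "real K * h \<le> T"
      and \<zeta>: "\<forall>k\<le>K. \<forall>j\<le>N. gaussian_moments M (\<zeta> k j) (mode_variance T j)"
    for M :: "'w measure" and N K h \<zeta>
  proof -
    interpret M: prob_space M by fact
    define b where "b = (\<lambda>\<omega> k. add_mean \<mu> (\<lambda>j. \<zeta> k j \<omega>))"
    define X where "X = (\<lambda>k \<omega>. noise_size N (b \<omega> k) ^ 15)"
    have XM: "X k \<in> borel_measurable M" if "k \<le> K" for k
    proof -
      have [measurable]: "\<zeta> k j \<in> borel_measurable M" if "j \<le> N" for j
        using \<zeta> that \<open>k \<le> K\<close> by (simp add: gaussian_moments_def)
      have "(\<lambda>\<omega>. sob N 1 (b \<omega> k)) \<in> borel_measurable M" "(\<lambda>\<omega>. b \<omega> k 0) \<in> borel_measurable M"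
        unfolding sob_def b_def add_mean_def by (intro borel_measurable_sum borel_measurable_times borel_measurable_power borel_measurable_add; simp)+
      then show ?thesis unfolding X_def noise_size_def by measurable
    qed
    have X0: "0 \<le> X k \<omega>" for k \<omega>
      unfolding X_def by (intro zero_le_power order_trans[OF zero_le_one noise_size_ge_1])
    have Xm: "(\<integral>\<^sup>+\<omega>. ennreal (X k \<omega> ^ Suc m) \<partial>M) \<le> ennreal D" if "k \<le> K" for k
    proof -
      have "(\<integral>\<^sup>+\<omega>. ennreal (X k \<omega> ^ Suc m) \<partial>M) = (\<integral>\<^sup>+\<omega>. ennreal (noise_size N (add_mean \<mu> (\<lambda>j. \<zeta> k j \<omega>)) ^ Suc n) \<partial>M)"
        unfolding X_def b_def n power_mult ..
      also have "\<dots> \<le> ennreal D"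
        using \<zeta> that by (intro size[rule_format] M) blast
      finally show ?thesis .
    qed
    have "(\<integral>\<^sup>+\<omega>. ennreal ((\<Sum>k=1..K. h * X k \<omega>) ^ Suc m) \<partial>M) \<le> ennreal ((\<Sum>k=1..K. h) ^ Suc m * D)"
      using h X0 XM Xm D by (intro nn_integral_weighted_power) auto
    also have "\<dots> \<le> ennreal (T ^ Suc m * D)"
      using h D by (intro ennreal_leI mult_right_mono power_mono) auto
    finally have S: "(\<integral>\<^sup>+\<omega>. ennreal ((\<Sum>k=1..K. h * X k \<omega>) ^ Suc m) \<partial>M) \<le> ennreal (T ^ Suc m * D)" .
    have "(\<integral>\<^sup>+\<omega>. ennreal ((1 + (\<Sum>k=1..K. h * X k \<omega>)) ^ Suc m) \<partial>M) \<le> ennreal C"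
      unfolding C_def using h X0 XM S T D
      by (intro M.nn_integral_const_plus_power)
         (auto intro!: sum_nonneg borel_measurable_sum borel_measurable_times simp del: power_Suc)
    then show ?thesis by (simp only: noise_total_def X_def b_def)
  qed
  moreover have "0 \<le> C" using D T by (simp add: C_def)
  ultimately show ?thesis by (intro exI[of _ C] conjI allI impI)
qed

end

section \<open>Moment bounds for the implicit scheme\<close>

lemma sqrt_powr_le:
  fixes x c v p :: real
  assumes "0 \<le> x" "x \<le> c * v ^ n" "0 \<le> c" "1 \<le> v" "0 \<le> p" "real n * p / 2 \<le> real m"
  shows "sqrt x powr p \<le> c powr (p / 2) * v ^ m"
proof -
  have "sqrt x powr p = x powr (p / 2)" using assms by (simp add: powr_half_sqrt[symmetric] powr_powr)
  also have "\<dots> \<le> (c * v ^ n) powr (p / 2)" using assms by (intro powr_mono2) auto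
  also have "\<dots> = c powr (p / 2) * (v ^ n) powr (p / 2)" by (rule powr_mult)
  also have "(v ^ n) powr (p / 2) = v powr (real n * p / 2)"
    using assms by (simp add: powr_realpow[symmetric] powr_powr)
  also have "\<dots> \<le> v powr real m" using assms by (intro powr_mono) auto
  also have "v powr real m = v ^ m" using assms by (simp add: powr_realpow)
  finally show ?thesis by (simp add: mult_left_mono)
qed

theorem lemma5:
  fixes T L c\<^sub>0 c\<^sub>1 c\<^sub>2 c\<^sub>3 c\<^sub>4 L\<^sub>f \<gamma> p :: real
    and F :: "real poly"
    and lam :: "nat \<Rightarrow> real" and e :: "nat \<Rightarrow> real \<Rightarrow> real"
    and X0 :: "real \<Rightarrow> real"
  assumes "0 < T" and "0 < L"
    and "neumann_eigensystem L lam e"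
    and "F = [:c\<^sub>0, c\<^sub>1, c\<^sub>2, c\<^sub>3, c\<^sub>4:]" and "0 < c\<^sub>4"
    and "\<forall>\<xi>. - poly (pderiv (pderiv F)) \<xi> \<le> L\<^sub>f"
    and "0 < \<gamma>" and "\<gamma> < 3 / 2" and "1 \<le> p"
    and "X0 \<in> L2_fun L" and "in_Hdot L lam e \<gamma> (mean_free L X0)"
  shows "\<exists>C>0. \<forall>(M :: 'w measure) \<F> W (N :: nat) (K :: nat) Z (Y :: nat \<Rightarrow> 'w \<Rightarrow> real \<Rightarrow> real).
    filtered_prob_space M \<F> \<longrightarrow>
    cylindrical_wiener L M \<F> W \<longrightarrow>
    1 \<le> N \<longrightarrow> 1 \<le> K \<longrightarrow>
    ereal (T / real K) < min 1 (1 / ereal (max (L\<^sub>f - lam 1) 0)) \<longrightarrow>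
    stochastic_convolution L lam e M W N T Z \<longrightarrow>
    (AE \<omega> in M. implicit_scheme L lam e F N K (T / real K) X0
                  (\<lambda>k. Z (real k * (T / real K)) \<omega>) (\<lambda>k. Y k \<omega>)) \<longrightarrow>
    (\<integral>\<^sup>+\<omega>. (SUP k\<in>{..K}. ennreal (Hdot_norm L lam e \<gamma> (mean_free L (Y k \<omega>)) powr p)) \<partial>M) \<le> ennreal C \<and>
    (\<forall>k\<le>K. \<forall>k\<^sub>1\<le>K.
      (\<integral>\<^sup>+\<omega>. ennreal (H_norm L (\<lambda>x. Y k \<omega> x - Y k\<^sub>1 \<omega> x) powr p) \<partial>M)
        \<le> ennreal (C * \<bar>(real k - real k\<^sub>1) * (T / real K)\<bar> powr (\<gamma> * p / 4)))"
proof -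
  obtain \<kappa> where \<kappa>: "cubic_drift L lam e \<kappa> (poly (pderiv F)) (poly (pderiv (pderiv F)))"
    using quartic_potential_cubic_drift[OF assms(2-6)] by blast
  interpret cubic_drift L lam e \<kappa> "poly (pderiv F)" "poly (pderiv (pderiv F))" by (rule \<kappa>)
  define \<mu> where "\<mu> = ip L X0 (e 0)"
  obtain R where R: "0 \<le> R" "\<And>N. sob N \<gamma> (\<lambda>j. ip L X0 (e j)) \<le> R"
    using sob_initial_le[OF assms(10,11)] by auto
  obtain C q where C: "0 \<le> C" and path: "\<forall>N K h a b. 0 < h \<longrightarrow> real K * h \<le> T \<longrightarrow> coeff_scheme N K h a b \<longrightarrow> sob N \<gamma> (a 0) \<le> R \<longrightarrow>
     regular_path \<gamma> N K h (C * (noise_total N K h b)^q) a"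
    using pathwise_bound[OF assms(7,8,1) R(1)] by (elim exE conjE)
  \<comment> \<open>a natural exponent for the moment of the noise total that dominates \<open>V\<^sup>q\<^sup>p\<^sup>/\<^sup>2\<close>\<close>
  define m where "m = nat \<lceil>real q * p / 2\<rceil>"
  have m: "real q * p / 2 \<le> real (Suc m)" unfolding m_def by linarith
  obtain D where D: "0 \<le> D" and moment: "\<forall>(M :: 'w measure) N K h \<zeta>. prob_space M \<longrightarrow> 0 < h \<longrightarrow> real K * h \<le> T \<longrightarrow>
     (\<forall>k\<le>K. \<forall>j\<le>N. gaussian_moments M (\<zeta> k j) (mode_variance T j)) \<longrightarrow>
     (\<integral>\<^sup>+\<omega>. ennreal (noise_total N K h (\<lambda>k. add_mean \<mu> (\<lambda>j. \<zeta> k j \<omega>)) ^ Suc m) \<partial>M) \<le> ennreal D"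
    using noise_total_moment[OF assms(1), where \<mu> = \<mu> and m = m] by (elim exE conjE)
  \<comment> \<open>the summand \<open>1\<close> ensures positivity\<close>
  define E where "E = C powr (p / 2) * D + 1"
  have E: "0 < E" "C powr (p / 2) * D \<le> E" using D by (auto simp: E_def add_nonneg_pos)
  have "(\<integral>\<^sup>+\<omega>. (SUP k\<in>{..K}. ennreal (Hdot_norm L lam e \<gamma> (mean_free L (Y k \<omega>)) powr p)) \<partial>M) \<le> ennreal E \<and>
    (\<forall>k\<le>K. \<forall>k\<^sub>1\<le>K.
      (\<integral>\<^sup>+\<omega>. ennreal (H_norm L (\<lambda>x. Y k \<omega> x - Y k\<^sub>1 \<omega> x) powr p) \<partial>M)
        \<le> ennreal (E * \<bar>(real k - real k\<^sub>1) * (T / real K)\<bar> powr (\<gamma> * p / 4)))"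
    if filt: "filtered_prob_space M \<F>" and W: "cylindrical_wiener L M \<F> W" and K: "1 \<le> K"
      and conv: "stochastic_convolution L lam e M W N T Z"
      and sch: "AE \<omega> in M. implicit_scheme L lam e F N K (T / real K) X0
                  (\<lambda>k. Z (real k * (T / real K)) \<omega>) (\<lambda>k. Y k \<omega>)"
    for M :: "'w measure" and \<F> W N K Z and Y :: "nat \<Rightarrow> 'w \<Rightarrow> real \<Rightarrow> real"
  proof -
    define h where "h = T / real K"
    have h: "0 < h" "real K * h \<le> T" using K assms(1) by (auto simp: h_def)
    have tk: "real k * h \<in> {0..T}" if "k \<le> K" for k
    proof -
      have "real k * h \<le> real K * h" using that h(1) by (intro mult_right_mono) auto
      then have "real k * h \<le> T" using h(2) by (rule order_trans)
      then show ?thesis using h(1) by simp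
    qed
    have M: "prob_space M" using filt by (simp add: filtered_prob_space_def)
    have bm: "brownian M \<F> (\<lambda>t. W t (e j))" for j
    proof -
      have "brownian_motion M \<F> (\<lambda>t. W t (e j))"
        using W e_L2[of j] by (auto simp: cylindrical_wiener_def H_norm_def ip_e)
      then show ?thesis using M filt by (simp add: brownian_def brownian_axioms_def)
    qed
    obtain \<zeta>' where \<zeta>': "\<forall>t\<in>{0..T}. (\<forall>j\<le>N. wiener_integral M (\<lambda>s. W s (e j)) t (\<lambda>s. exp (- (t - s) * (lam j)\<^sup>2)) (\<zeta>' t j)) \<and>
        (\<forall>\<omega>\<in>space M. \<forall>x\<in>{0..L}. Z t \<omega> x = (\<Sum>j\<le>N. \<zeta>' t j \<omega> * e j x))"
      using conv unfolding stochastic_convolution_def by (elim bchoice[THEN exE])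
    define \<zeta> where "\<zeta> = (\<lambda>k. \<zeta>' (real k * h))"
    define V where "V = (\<lambda>\<omega>. noise_total N K h (\<lambda>k. add_mean \<mu> (\<lambda>j. \<zeta> k j \<omega>)))"
    have V1: "1 \<le> V \<omega>" for \<omega> unfolding V_def by (rule noise_total_ge_1[OF h(1)])
    have Vm: "(\<integral>\<^sup>+\<omega>. ennreal (V \<omega> ^ Suc m) \<partial>M) \<le> ennreal D"
      unfolding V_def
    proof (rule moment[rule_format, OF M h])
      fix k j assume k: "k \<le> K" and j: "j \<le> N"
      have wi: "wiener_integral M (\<lambda>s. W s (e j)) (real k * h) (\<lambda>s. exp (- (real k * h - s) * (lam j)\<^sup>2)) (\<zeta> k j)"
        using \<zeta>' tk[OF k] j unfolding \<zeta>_def by blast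
      show "gaussian_moments M (\<zeta> k j) (mode_variance T j)"
      proof (rule brownian.wiener_integral_moment[OF bm wi])
        show "0 < mode_variance T j" using assms(1) lam_pos[of j] by (cases "j = 0") (auto simp: mode_variance_def)
        show "(\<integral>\<^sup>+u\<in>{0..real k * h}. ennreal ((exp (- (real k * h - u) * (lam j)\<^sup>2))\<^sup>2) \<partial>lborel) \<le> ennreal (mode_variance T j)"
          using tk[OF k] by (intro exp_kernel_L2) auto
      qed (use tk[OF k] in auto)
    qed
    have path_AE: "AE \<omega> in M.
       (\<forall>k\<le>K. Hdot_norm L lam e \<gamma> (mean_free L (Y k \<omega>)) powr p \<le> C powr (p / 2) * V \<omega> ^ Suc m) \<and>
       (\<forall>k\<le>K. \<forall>k1\<le>k. H_norm L (\<lambda>x. Y k \<omega> x - Y k1 \<omega> x) powr p \<le> (real (k - k1) * h) powr (\<gamma> * p / 4) * (C powr (p / 2) * V \<omega> ^ Suc m))"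
      using sch AE_space
    proof eventually_elim
      fix \<omega> assume s: "implicit_scheme L lam e F N K (T / real K) X0 (\<lambda>k. Z (real k * (T / real K)) \<omega>) (\<lambda>k. Y k \<omega>)"
        and \<omega>: "\<omega> \<in> space M"
      define a where "a = (\<lambda>k j. ip L (Y k \<omega>) (e j))"
      define b where "b = (\<lambda>k. add_mean \<mu> (\<lambda>j. \<zeta> k j \<omega>))"
      have z: "Z (real k * h) \<omega> x = (\<Sum>j\<le>N. \<zeta> k j \<omega> * e j x)" if "k \<le> K" "x \<in> {0..L}" for k x
        using \<zeta>' tk[OF that(1)] \<omega> that(2) unfolding \<zeta>_def by blast
      have PN: "in_PN L e N (Y k \<omega>)" if "k \<le> K" for k using s that by (simp add: implicit_scheme_def)
      have co: "coeff_scheme N K h a b" "\<And>k. k \<le> K \<Longrightarrow> a k 0 = \<mu>" "\<And>j. j \<le> N \<Longrightarrow> a 0 j = ip L X0 (e j)"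
        unfolding a_def b_def \<mu>_def
        by (rule implicit_scheme_coeffs[OF s[folded h_def] refl z]; assumption)+
      have sc: "coeff_scheme N K h a b" by (rule co(1))
      have "sob N \<gamma> (a 0) = sob N \<gamma> (\<lambda>j. ip L X0 (e j))"
        unfolding sob_def using co(3) by (intro sum.cong) auto
      then have "sob N \<gamma> (a 0) \<le> R" using R by simp
      from path[rule_format, OF h sc this]
      have reg: "\<And>k. k \<le> K \<Longrightarrow> sob N \<gamma> (a k) \<le> C * V \<omega> ^ q"
        and inc: "\<And>k k1. k \<le> K \<Longrightarrow> k1 \<le> k \<Longrightarrow> sob N 0 (\<lambda>j. a k j - a k1 j) \<le> C * V \<omega> ^ q * (real (k - k1) * h) powr (\<gamma> / 2)"
        by (auto simp: V_def b_def regular_path_def)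
      have "Hdot_norm L lam e \<gamma> (mean_free L (Y k \<omega>)) powr p \<le> C powr (p / 2) * V \<omega> ^ Suc m" if k: "k \<le> K" for k
      proof -
        have "Hdot_norm L lam e \<gamma> (mean_free L (Y k \<omega>)) = sqrt (sob N \<gamma> (a k))"
          unfolding a_def by (rule Hdot_norm_in_PN[OF PN[OF k]])
        then show ?thesis using sqrt_powr_le[OF _ reg[OF k] C V1 _ m] assms(9) by (simp del: power_Suc)
      qed
      moreover have "H_norm L (\<lambda>x. Y k \<omega> x - Y k1 \<omega> x) powr p \<le> (real (k - k1) * h) powr (\<gamma> * p / 4) * (C powr (p / 2) * V \<omega> ^ Suc m)"
        if k: "k \<le> K" "k1 \<le> k" for k k1
      proof -
        have "a k 0 = a k1 0" using co(2)[of k] co(2)[of k1] k by simp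
        then have "H_norm L (\<lambda>x. Y k \<omega> x - Y k1 \<omega> x) = sqrt (sob N 0 (\<lambda>j. a k j - a k1 j))"
          using k unfolding a_def by (intro H_norm_diff_in_PN PN) auto
        also have "\<dots> powr p \<le> (C * (real (k - k1) * h) powr (\<gamma> / 2)) powr (p / 2) * V \<omega> ^ Suc m"
          using inc[OF k] C assms(9) m V1 by (intro sqrt_powr_le[where n = q]) (auto simp: mult_ac simp del: power_Suc)
        also have "(C * (real (k - k1) * h) powr (\<gamma> / 2)) powr (p / 2) = C powr (p / 2) * (real (k - k1) * h) powr (\<gamma> * p / 4)"
          unfolding powr_mult[of C] powr_powr by simp
        finally show ?thesis by (simp only: mult_ac)
      qed
      ultimately show "(\<forall>k\<le>K. Hdot_norm L lam e \<gamma> (mean_free L (Y k \<omega>)) powr p \<le> C powr (p / 2) * V \<omega> ^ Suc m) \<and>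
       (\<forall>k\<le>K. \<forall>k1\<le>k. H_norm L (\<lambda>x. Y k \<omega> x - Y k1 \<omega> x) powr p \<le> (real (k - k1) * h) powr (\<gamma> * p / 4) * (C powr (p / 2) * V \<omega> ^ Suc m))"
        by blast
    qed
    have VM: "(\<lambda>\<omega>. ennreal (V \<omega> ^ Suc m)) \<in> borel_measurable M"
    proof -
      have \<zeta>M: "\<zeta> k j \<in> borel_measurable M" if "k \<le> K" "j \<le> N" for k j
        using \<zeta>' tk[OF that(1)] that(2) unfolding \<zeta>_def wiener_integral_def by blast
      have "V \<in> borel_measurable M"
        unfolding V_def noise_total_def noise_size_def sob_def add_mean_def
        by (intro borel_measurable_add borel_measurable_sum borel_measurable_times borel_measurable_power borel_measurable_const)
           (auto intro: \<zeta>M)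
      then show ?thesis by measurable
    qed
    \<comment> \<open>\<open>\<phi>\<close> may fail to be measurable; only the dominating function has to be\<close>
    have main: "(\<integral>\<^sup>+\<omega>. \<phi> \<omega> \<partial>M) \<le> ennreal (E * c)"
      if c: "0 \<le> c" and \<phi>: "AE \<omega> in M. \<phi> \<omega> \<le> ennreal (c * (C powr (p / 2) * V \<omega> ^ Suc m))" for \<phi> c
    proof -
      have "(\<integral>\<^sup>+\<omega>. \<phi> \<omega> \<partial>M) \<le> (\<integral>\<^sup>+\<omega>. ennreal (c * C powr (p / 2)) * ennreal (V \<omega> ^ Suc m) \<partial>M)"
      proof (rule nn_integral_mono_AE)
        show "AE \<omega> in M. \<phi> \<omega> \<le> ennreal (c * C powr (p / 2)) * ennreal (V \<omega> ^ Suc m)"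
          using \<phi> by eventually_elim (simp only: ennreal_mult'[symmetric] c powr_ge_zero mult_nonneg_nonneg mult.assoc)
      qed
      also have "\<dots> = ennreal (c * C powr (p / 2)) * (\<integral>\<^sup>+\<omega>. ennreal (V \<omega> ^ Suc m) \<partial>M)"
        by (rule nn_integral_cmult[OF VM])
      also have "\<dots> \<le> ennreal (c * C powr (p / 2)) * ennreal D"
        by (intro mult_left_mono Vm) auto
      also have "\<dots> = ennreal (c * (C powr (p / 2) * D))"
        using c by (simp add: ennreal_mult'[symmetric] mult.assoc)
      also have "\<dots> \<le> ennreal (E * c)"
        using mult_left_mono[OF E(2) c] by (intro ennreal_leI) (simp add: mult.commute)
      finally show ?thesis .
    qed
    have "(\<integral>\<^sup>+\<omega>. (SUP k\<in>{..K}. ennreal (Hdot_norm L lam e \<gamma> (mean_free L (Y k \<omega>)) powr p)) \<partial>M) \<le> ennreal (E * 1)"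
    proof (rule main)
      show "AE \<omega> in M. (SUP k\<in>{..K}. ennreal (Hdot_norm L lam e \<gamma> (mean_free L (Y k \<omega>)) powr p)) \<le> ennreal (1 * (C powr (p / 2) * V \<omega> ^ Suc m))"
        using path_AE by eventually_elim (auto intro!: SUP_least ennreal_leI simp del: power_Suc)
    qed simp
    moreover have ordered: "(\<integral>\<^sup>+\<omega>. ennreal (H_norm L (\<lambda>x. Y k \<omega> x - Y k1 \<omega> x) powr p) \<partial>M)
        \<le> ennreal (E * \<bar>(real k - real k1) * (T / real K)\<bar> powr (\<gamma> * p / 4))" if k: "k \<le> K" "k1 \<le> k" for k k1
    proof -
      have eq: "real (k - k1) * h = \<bar>(real k - real k1) * (T / real K)\<bar>"
        using k h(1) unfolding h_def[symmetric] by (simp add: of_nat_diff abs_mult)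
      show ?thesis unfolding eq[symmetric]
      proof (rule main)
        show "AE \<omega> in M. ennreal (H_norm L (\<lambda>x. Y k \<omega> x - Y k1 \<omega> x) powr p)
            \<le> ennreal ((real (k - k1) * h) powr (\<gamma> * p / 4) * (C powr (p / 2) * V \<omega> ^ Suc m))"
          using path_AE by eventually_elim (intro ennreal_leI, use k in blast)
      qed simp
    qed
    moreover have "(\<integral>\<^sup>+\<omega>. ennreal (H_norm L (\<lambda>x. Y k \<omega> x - Y k1 \<omega> x) powr p) \<partial>M)
        \<le> ennreal (E * \<bar>(real k - real k1) * (T / real K)\<bar> powr (\<gamma> * p / 4))" if k: "k \<le> K" "k1 \<le> K" for k k1
    proof (cases "k1 \<le> k")
      case False
      have "H_norm L (\<lambda>x. Y k \<omega> x - Y k1 \<omega> x) = H_norm L (\<lambda>x. Y k1 \<omega> x - Y k \<omega> x)" for \<omega>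
        unfolding H_norm_def ip_def by (simp add: algebra_simps)
      moreover have "\<bar>(real k - real k1) * (T / real K)\<bar> = \<bar>(real k1 - real k) * (T / real K)\<bar>"
        by (simp add: abs_mult abs_minus_commute)
      ultimately show ?thesis using ordered[of k1 k] False k by simp
    qed (use ordered k in blast)
    ultimately show ?thesis by auto
  qed
  with E(1) show ?thesis by (intro exI[of _ E] conjI allI impI) blast+
qed

end
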